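(* Let $\alpha,\beta>-1$ and let $J=J_{\alpha,\beta}$ be the Jacobi operator whose spectral measure is $d\rho(\lambda)=\tau(\lambda)d\lambda$, $\tau(\lambda)=k(1-\lambda)^\alpha(1+\lambda)^\beta$, $\lambda\in(-1,1)$. Suppose that $g=\Phi f\in C_0^\infty((-1,1)\setminus\{0\})$. Put $\gamma=(\alpha+\beta+1)/2$ and, for $\xi\in(0,1)$, $\psi(\xi)=\xi\arccos\xi-\sqrt{1-\xi^2}$ and $$h_{\pm}(\xi)=e^{\pm i\pi/4}\,e^{\pm i\gamma\arccos\xi}\,\xi^{1/2}(1-\xi^2)^{-1/4}\,g\big(\pm\sqrt{1-\xi^2}\big)$$ (upper signs for $h_+$, lower signs for $h_-$). For $\pm t>0$ and $n\in\mathbb Z_+$ such that $\xi=n|t|^{-1}\in(0,1)$, set $$(U(t)g)_n=i^{\mp n}\,e^{\pm i(\alpha-\beta)\pi/4}\,|t|^{-1/2}\Big(e^{i\psi(\xi)t}h_+(\xi)+e^{-i\psi(\xi)t}h_-(\xi)\Big)$$ (here the upper signs in $i^{\mp n}e^{\pm i(\alpha-\beta)\pi/4}$ are taken for $t>0$ and the lower ones for $t<0$), and set $(U(t)g)_n=0$ for $n\ge|t|$ and for $n=0$. Then $$\lim_{t\to\pm\infty}\big\|e^{-iJt}f-U(t)\Phi f\big\|=0 .$$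
   Context: $\mathbb Z_+=\{0,1,2,\dots\}$; $\|\cdot\|$ is the norm of $\ell^2(\mathbb Z_+)$. The constant $k=k_{\alpha,\beta}>0$ is chosen so that $\int_{-1}^1\tau(\lambda)d\lambda=1$. The (orthonormal) Jacobi polynomials $\mathsf G_n$, $n\in\mathbb Z_+$, are the polynomials of degree $n$ with positive leading coefficient, orthonormal in $L^2((-1,1);\tau(\lambda)d\lambda)$; they satisfy a recurrence $a_{n-1}\mathsf G_{n-1}(\lambda)+b_n\mathsf G_n(\lambda)+a_n\mathsf G_{n+1}(\lambda)=\lambda\mathsf G_n(\lambda)$ with $a_n>0$, $b_n\in\mathbb R$, $\mathsf G_{-1}=0$, $\mathsf G_0=1$. The operator $J=J_{\alpha,\beta}$ is the bounded self-adjoint Jacobi operator in $\ell^2(\mathbb Z_+)$ given by $(Jf)_n=a_{n-1}f_{n-1}+b_nf_n+a_nf_{n+1}$, $a_{-1}=0$, with these coefficients. The operator $\Phi:\ell^2(\mathbb Z_+)\to L^2(-1,1)$ is the unitary operator given by $(\Phi f)(\lambda)=\sum_{n=0}^\infty\sqrt{\tau(\lambda)}\,\mathsf G_n(\lambda)f_n$ for finitely supported $f$ (and extended by continuity).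
   Formalization: For t<0 the phases e^{±iπ/4}e^{±iγ arccos ξ} in h_± are replaced by their conjugates (the argument of g is unchanged); with the printed phases the limit t→−∞ fails, e.g. for α=β=−1/2 and nonzero g. For t>0 the formula is as stated. *)

theory Defs
  imports "HOL-Analysis.Analysis" "HOL-Computational_Algebra.Polynomial"
begin

section \<open>The space of square-summable complex sequences\<close>

definition square_summable :: "(nat \<Rightarrow> complex) \<Rightarrow> bool" where
  "square_summable x \<longleftrightarrow> summable (\<lambda>n. (cmod (x n))\<^sup>2)"

lemma square_summable_bounded_mult:
  assumes "square_summable x" "\<And>n. cmod (c n) \<le> M"
  shows "square_summable (\<lambda>n. c n * x n)"
  unfolding square_summable_def
proof (rule summable_comparison_test)
  show "summable (\<lambda>n. M\<^sup>2 * (cmod (x n))\<^sup>2)"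
    using assms(1) by (simp add: square_summable_def summable_mult)
  show "\<exists>N. \<forall>n\<ge>N. norm ((cmod (c n * x n))\<^sup>2) \<le> M\<^sup>2 * (cmod (x n))\<^sup>2"
    using assms(2) by (auto simp: norm_mult power_mult_distrib intro!: mult_right_mono power_mono)
qed

lemma square_summable_finite: "finite {n. x n \<noteq> 0} \<Longrightarrow> square_summable x"
  unfolding square_summable_def
  by (rule summable_finite[of "{n. x n \<noteq> 0}"]) auto

lemma square_summable_L2:
  assumes "square_summable x"
  shows "(\<lambda>N. L2_set (\<lambda>n. cmod (x n)) {..<N}) \<longlonglongrightarrow> sqrt (\<Sum>n. (cmod (x n))\<^sup>2)"
  using assms unfolding L2_set_def square_summable_def
  by (intro tendsto_real_sqrt summable_LIMSEQ)

lemma square_summable_add: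
  assumes x: "square_summable x" and y: "square_summable y"
  shows "square_summable (\<lambda>n. x n + y n)"
    and "sqrt (\<Sum>n. (cmod (x n + y n))\<^sup>2)
           \<le> sqrt (\<Sum>n. (cmod (x n))\<^sup>2) + sqrt (\<Sum>n. (cmod (y n))\<^sup>2)"
proof -
  have "(cmod (x n + y n))\<^sup>2 \<le> 2 * (cmod (x n))\<^sup>2 + 2 * (cmod (y n))\<^sup>2" for n
  proof -
    have "(cmod (x n + y n))\<^sup>2 \<le> (cmod (x n) + cmod (y n))\<^sup>2"
      by (intro power_mono norm_triangle_ineq) auto
    also have "\<dots> \<le> 2 * (cmod (x n))\<^sup>2 + 2 * (cmod (y n))\<^sup>2"
      using sum_squares_bound[of "cmod (x n)" "cmod (y n)"] by (simp add: power2_sum)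
    finally show ?thesis .
  qed
  moreover have "summable (\<lambda>n. 2 * (cmod (x n))\<^sup>2 + 2 * (cmod (y n))\<^sup>2)"
    using x y unfolding square_summable_def by (rule summable_add[OF summable_mult summable_mult])
  ultimately have "summable (\<lambda>n. (cmod (x n + y n))\<^sup>2)"
    by (auto intro: summable_comparison_test'[where N = 0])
  then show xy: "square_summable (\<lambda>n. x n + y n)" by (simp add: square_summable_def)
  have "L2_set (\<lambda>n. cmod (x n + y n)) {..<N}
          \<le> L2_set (\<lambda>n. cmod (x n)) {..<N} + L2_set (\<lambda>n. cmod (y n)) {..<N}" for N
    using L2_set_mono[of "{..<N}" "\<lambda>n. cmod (x n + y n)" "\<lambda>n. cmod (x n) + cmod (y n)"]
      L2_set_triangle_ineq[of "\<lambda>n. cmod (x n)" "\<lambda>n. cmod (y n)" "{..<N}"]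
    by (simp add: norm_triangle_ineq)
  then show "sqrt (\<Sum>n. (cmod (x n + y n))\<^sup>2)
           \<le> sqrt (\<Sum>n. (cmod (x n))\<^sup>2) + sqrt (\<Sum>n. (cmod (y n))\<^sup>2)"
    by (intro LIMSEQ_le[OF square_summable_L2[OF xy]
          tendsto_add[OF square_summable_L2[OF x] square_summable_L2[OF y]]]) auto
qed

typedef ell2 = "{x. square_summable x}"
  morphisms ell2_nth Abs_ell2
  by (rule exI[of _ "\<lambda>_. 0"]) (simp add: square_summable_def)

setup_lifting type_definition_ell2

instantiation ell2 :: real_normed_vector
begin

lift_definition zero_ell2 :: ell2 is "\<lambda>_. 0"
  by (simp add: square_summable_def)
lift_definition plus_ell2 :: "ell2 \<Rightarrow> ell2 \<Rightarrow> ell2" is "\<lambda>x y n. x n + y n"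
  by (rule square_summable_add)
lift_definition uminus_ell2 :: "ell2 \<Rightarrow> ell2" is "\<lambda>x n. - x n"
  by (simp add: square_summable_def)
lift_definition minus_ell2 :: "ell2 \<Rightarrow> ell2 \<Rightarrow> ell2" is "\<lambda>x y n. x n - y n"
  using square_summable_add(1)[of _ "\<lambda>n. - y n" for y] by (simp add: square_summable_def)
lift_definition scaleR_ell2 :: "real \<Rightarrow> ell2 \<Rightarrow> ell2" is "\<lambda>r x n. r *\<^sub>R x n"
  by (simp add: square_summable_def power_mult_distrib summable_mult)
lift_definition norm_ell2 :: "ell2 \<Rightarrow> real" is "\<lambda>x. sqrt (\<Sum>n. (cmod (x n))\<^sup>2)" .
definition dist_ell2 :: "ell2 \<Rightarrow> ell2 \<Rightarrow> real" where "dist_ell2 x y = norm (x - y)"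
definition sgn_ell2 :: "ell2 \<Rightarrow> ell2" where "sgn_ell2 x = scaleR (inverse (norm x)) x"
definition uniformity_ell2 :: "(ell2 \<times> ell2) filter"
  where "uniformity_ell2 = (INF e\<in>{0<..}. principal {(x, y). dist x y < e})"
definition open_ell2 :: "ell2 set \<Rightarrow> bool"
  where "open_ell2 U = (\<forall>x\<in>U. eventually (\<lambda>(x', y). x' = x \<longrightarrow> y \<in> U) uniformity)"

instance
proof
  fix x y z :: ell2 and r q :: real
  show "x + y + z = x + (y + z)" by transfer (simp add: add.assoc)
  show "x + y = y + x" by transfer (simp add: add.commute)
  show "0 + x = x" by transfer simp
  show "- x + x = 0" by transfer simp
  show "x - y = x + - y" by transfer simp
  show "r *\<^sub>R (x + y) = r *\<^sub>R x + r *\<^sub>R y" by transfer (simp add: scaleR_right_distrib)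
  show "(r + q) *\<^sub>R x = r *\<^sub>R x + q *\<^sub>R x" by transfer (simp add: scaleR_left_distrib)
  show "r *\<^sub>R q *\<^sub>R x = (r * q) *\<^sub>R x" by transfer simp
  show "1 *\<^sub>R x = x" by transfer simp
  show "norm x = 0 \<longleftrightarrow> x = 0"
    by transfer (auto simp: square_summable_def suminf_eq_zero_iff fun_eq_iff)
  show "norm (x + y) \<le> norm x + norm y"
    by transfer (rule square_summable_add)
  show "norm (r *\<^sub>R x) = \<bar>r\<bar> * norm x"
    by transfer
      (simp add: square_summable_def power_mult_distrib suminf_mult real_sqrt_mult)
qed (simp_all only: dist_ell2_def sgn_ell2_def uniformity_ell2_def open_ell2_def)

end

lift_definition scaleC_ell2 :: "complex \<Rightarrow> ell2 \<Rightarrow> ell2" is "\<lambda>c x n. c * x n"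
  by (rule square_summable_bounded_mult[where M = "cmod c" for c]) auto

definition finitely_supported :: "ell2 \<Rightarrow> bool" where
  "finitely_supported f \<longleftrightarrow> finite {n. ell2_nth f n \<noteq> 0}"


section \<open>Jacobi operators and their unitary groups\<close>

fun jacobi_seq :: "(nat \<Rightarrow> real) \<Rightarrow> (nat \<Rightarrow> real) \<Rightarrow> (nat \<Rightarrow> complex) \<Rightarrow> nat \<Rightarrow> complex" where
  "jacobi_seq a b f 0 = of_real (b 0) * f 0 + of_real (a 0) * f 1"
| "jacobi_seq a b f (Suc n) =
     of_real (a n) * f n + of_real (b (Suc n)) * f (Suc n) + of_real (a (Suc n)) * f (Suc (Suc n))"

text \<open>Meaningful for bounded coefficients; see \<open>ell2_nth_jacobi_op\<close> below.\<close>

definition jacobi_op :: "(nat \<Rightarrow> real) \<Rightarrow> (nat \<Rightarrow> real) \<Rightarrow> ell2 \<Rightarrow> ell2" where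
  "jacobi_op a b f = Abs_ell2 (jacobi_seq a b (ell2_nth f))"

lemma ell2_nth_jacobi_op:
  assumes "bounded (range a)" "bounded (range b)"
  shows "ell2_nth (jacobi_op a b f) = jacobi_seq a b (ell2_nth f)"
proof -
  let ?f = "ell2_nth f"
  obtain A where A: "\<And>n. \<bar>a n\<bar> \<le> A" using assms(1) by (auto simp: bounded_iff)
  obtain B where B: "\<And>n. \<bar>b n\<bar> \<le> B" using assms(2) by (auto simp: bounded_iff)
  have f: "square_summable ?f" using ell2_nth[of f] by simp
  then have sh: "square_summable (\<lambda>n. ?f (Suc n))"
    unfolding square_summable_def by (subst summable_Suc_iff)
  have 1: "square_summable (\<lambda>n. case n of 0 \<Rightarrow> 0 | Suc m \<Rightarrow> of_real (a m) * ?f m)"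
    using square_summable_bounded_mult[OF f, of "\<lambda>n. of_real (a n)" A] A
    unfolding square_summable_def by (subst summable_Suc_iff[symmetric]) simp
  have 2: "square_summable (\<lambda>n. of_real (b n) * ?f n)"
    by (rule square_summable_bounded_mult[OF f, where M = B]) (use B in simp)
  have 3: "square_summable (\<lambda>n. of_real (a n) * ?f (Suc n))"
    by (rule square_summable_bounded_mult[OF sh, where M = A]) (use A in simp)
  have "jacobi_seq a b ?f = (\<lambda>n. (case n of 0 \<Rightarrow> 0 | Suc m \<Rightarrow> of_real (a m) * ?f m)
          + of_real (b n) * ?f n + of_real (a n) * ?f (Suc n))"
    by (rule ext, case_tac n) auto
  then have "square_summable (jacobi_seq a b ?f)"
    using square_summable_add(1)[OF square_summable_add(1)[OF 1 2] 3] by simp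
  then show ?thesis by (simp add: jacobi_op_def Abs_ell2_inverse)
qed

text \<open>The exponential of a bounded operator, by its norm-convergent power series.\<close>

definition op_exp :: "('a \<Rightarrow> 'a) \<Rightarrow> 'a \<Rightarrow> 'a::real_normed_vector" where
  "op_exp A f = (\<Sum>m. (A ^^ m) f /\<^sub>R fact m)"

definition unitary_group :: "(ell2 \<Rightarrow> ell2) \<Rightarrow> real \<Rightarrow> ell2 \<Rightarrow> ell2" where
  "unitary_group J t = op_exp (\<lambda>f. scaleC_ell2 (- \<i> * of_real t) (J f))"


section \<open>Jacobi polynomials and the unitary map \<open>\<Phi>\<close>\<close>

definition jacobi_weight :: "real \<Rightarrow> real \<Rightarrow> real \<Rightarrow> real \<Rightarrow> real" where
  "jacobi_weight k \<alpha> \<beta> x = k * (1 - x) powr \<alpha> * (1 + x) powr \<beta>"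

definition orthonormal_polys :: "(real \<Rightarrow> real) \<Rightarrow> (nat \<Rightarrow> real poly) \<Rightarrow> bool" where
  "orthonormal_polys \<tau> G \<longleftrightarrow>
     (\<forall>n. degree (G n) = n \<and> lead_coeff (G n) > 0) \<and>
     (\<forall>m n. set_integrable lborel {-1<..<1} (\<lambda>x. poly (G m) x * poly (G n) x * \<tau> x) \<and>
        (LINT x:{-1<..<1}|lborel. poly (G m) x * poly (G n) x * \<tau> x) = (if m = n then 1 else 0))"

definition recurrence_coeffs :: "(nat \<Rightarrow> real poly) \<Rightarrow> (nat \<Rightarrow> real) \<Rightarrow> (nat \<Rightarrow> real) \<Rightarrow> bool" where
  "recurrence_coeffs G a b \<longleftrightarrow>
     (\<forall>n. a n > 0) \<and>
     (\<forall>n x. (if n = 0 then 0 else a (n - 1) * poly (G (n - 1)) x)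
              + b n * poly (G n) x + a n * poly (G (Suc n)) x = x * poly (G n) x)"

definition square_integrable :: "(real \<Rightarrow> complex) \<Rightarrow> bool" where
  "square_integrable g \<longleftrightarrow> set_borel_measurable lborel {-1<..<1} g \<and>
     set_integrable lborel {-1<..<1} (\<lambda>x. (cmod (g x))\<^sup>2)"

definition L2_norm :: "(real \<Rightarrow> complex) \<Rightarrow> real" where
  "L2_norm g = sqrt (LINT x:{-1<..<1}|lborel. (cmod (g x))\<^sup>2)"

definition Phi_fin :: "(real \<Rightarrow> real) \<Rightarrow> (nat \<Rightarrow> real poly) \<Rightarrow> ell2 \<Rightarrow> real \<Rightarrow> complex" where
  "Phi_fin \<tau> G f x =
     (\<Sum>n | ell2_nth f n \<noteq> 0. of_real (sqrt (\<tau> x) * poly (G n) x) * ell2_nth f n)"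

text \<open>\<open>is_Phi \<tau> G f g\<close> says that \<open>g\<close> represents the class \<open>\<Phi> f\<close> in \<open>L\<^sup>2(-1,1)\<close>, where \<open>\<Phi>\<close> is the
  extension by continuity of \<open>Phi_fin\<close> from the (dense) finitely supported sequences.  Only the
  values of \<open>g\<close> on \<open>(-1,1)\<close> matter, up to null sets.\<close>

definition is_Phi ::
  "(real \<Rightarrow> real) \<Rightarrow> (nat \<Rightarrow> real poly) \<Rightarrow> ell2 \<Rightarrow> (real \<Rightarrow> complex) \<Rightarrow> bool" where
  "is_Phi \<tau> G f g \<longleftrightarrow> square_integrable g \<and>
     (\<forall>F. (\<forall>j. finitely_supported (F j)) \<and> F \<longlonglongrightarrow> f \<longrightarrow>
        (\<lambda>j. L2_norm (\<lambda>x. Phi_fin \<tau> G (F j) x - g x)) \<longlonglongrightarrow> 0)"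

text \<open>\<open>C\<^sub>0\<^sup>\<infinity>(S)\<close>, its elements being extended by zero to the whole line.\<close>

definition smooth_compact_support :: "real set \<Rightarrow> (real \<Rightarrow> complex) \<Rightarrow> bool" where
  "smooth_compact_support S g \<longleftrightarrow>
     (\<forall>m x. ((\<lambda>u y. vector_derivative u (at y)) ^^ m) g differentiable (at x)) \<and>
     compact (closure {x. g x \<noteq> 0}) \<and> closure {x. g x \<noteq> 0} \<subseteq> S"


section \<open>The asymptotic evolution \<open>U(t)\<close>\<close>

definition psi :: "real \<Rightarrow> real" where
  "psi \<xi> = \<xi> * arccos \<xi> - sqrt (1 - \<xi>\<^sup>2)"

text \<open>The argument \<open>s = \<plusminus>1\<close> selects \<open>h\<^sub>\<plusminus>\<close>, and \<open>\<sigma> = \<plusminus>1\<close> is the sign of the time.  For \<open>\<sigma> = 1\<close> this is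
    \<open>h\<^sub>\<plusminus>(\<xi>) = exp (\<plusminus>i\<pi>/4) exp (\<plusminus>i\<gamma> arccos \<xi>) \<xi> powr (1/2) (1 - \<xi>\<^sup>2) powr (-1/4) g(\<plusminus>sqrt (1 - \<xi>\<^sup>2))\<close>.
  For negative times the two phase factors (but not the argument of \<open>g\<close>) are conjugated: the Jacobi
  matrix and \<open>\<Phi>\<close> are real, so \<open>exp(iJt) f\<close> is the conjugate of \<open>exp(-iJt)\<close> applied to the conjugate
  of \<open>f\<close>, and this forces the leading term for \<open>-t\<close>.  The formula with the \<open>\<sigma> = 1\<close> phases is not
  an asymptotics of \<open>exp(-iJt) f\<close> as \<open>t \<rightarrow> -\<infinity>\<close>.\<close>

definition h_amp :: "real \<Rightarrow> real \<Rightarrow> real \<Rightarrow> (real \<Rightarrow> complex) \<Rightarrow> real \<Rightarrow> complex" where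
  "h_amp \<sigma> s \<gamma> g \<xi> =
     cis (\<sigma> * s * pi / 4) * cis (\<sigma> * s * \<gamma> * arccos \<xi>) *
     of_real (\<xi> powr (1/2) * (1 - \<xi>\<^sup>2) powr (-1/4)) * g (s * sqrt (1 - \<xi>\<^sup>2))"

definition U_seq :: "real \<Rightarrow> real \<Rightarrow> real \<Rightarrow> (real \<Rightarrow> complex) \<Rightarrow> nat \<Rightarrow> complex" where
  "U_seq \<alpha> \<beta> t g n =
     (if 0 < n \<and> real n < \<bar>t\<bar> then
        (let \<sigma> = sgn t; \<xi> = real n / \<bar>t\<bar>; \<gamma> = (\<alpha> + \<beta> + 1) / 2 in
           (if t > 0 then \<i> powi (- int n) else \<i> powi (int n)) *
           cis (\<sigma> * (\<alpha> - \<beta>) * pi / 4) * of_real (\<bar>t\<bar> powr (-1/2)) *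
           (cis (psi \<xi> * t) * h_amp \<sigma> 1 \<gamma> g \<xi> + cis (- psi \<xi> * t) * h_amp \<sigma> (-1) \<gamma> g \<xi>))
      else 0)"

lift_definition U_approx :: "real \<Rightarrow> real \<Rightarrow> real \<Rightarrow> (real \<Rightarrow> complex) \<Rightarrow> ell2" is U_seq
proof -
  fix \<alpha> \<beta> t :: real and g
  have "n \<in> {..nat \<lceil>\<bar>t\<bar>\<rceil>}" if "U_seq \<alpha> \<beta> t g n \<noteq> 0" for n
  proof -
    have "real n < \<bar>t\<bar>" using that unfolding U_seq_def by presburger
    then show ?thesis by simp linarith
  qed
  then have "{n. U_seq \<alpha> \<beta> t g n \<noteq> 0} \<subseteq> {..nat \<lceil>\<bar>t\<bar>\<rceil>}" by blast
  then show "square_summable (U_seq \<alpha> \<beta> t g)"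
    by (intro square_summable_finite) (rule finite_subset, auto)
qed

end

theory Submission
  imports Defs "HOL-Complex_Analysis.Complex_Analysis" "HOL-Probability.Probability" "HOL-Real_Asymp.Real_Asymp"
begin

text \<open>
  The components of \<open>e\<^sup>-\<^sup>i\<^sup>J\<^sup>t f\<close> are the integrals of \<open>e\<^sup>-\<^sup>i\<^sup>\<lambda>\<^sup>t g(\<lambda>)\<close> against \<open>\<surd>\<tau> G\<^sub>n\<close>.  Rodrigues'
  formula and Cauchy's integral over the unit circle express \<open>G\<^sub>n(0)\<close> by an integral of \<open>sin\<^sup>n\<close>, so
  Laplace's method gives the size and phase of \<open>G\<^sub>n(0)\<close>; the derivative is treated in the same way,
  being a Jacobi polynomial with parameters \<open>\<alpha> + 1, \<beta> + 1\<close>.  The Liouville-Green form of the Jacobi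
  equation in \<open>\<theta> = arccos \<lambda>\<close> transports these initial data at \<open>\<theta> = \<pi>/2\<close> to compact subsets of \<open>(-1,1)\<close>
  with error \<open>O(1/n)\<close>.  For \<open>g\<close> supported in \<open>(0,1)\<close> stationary phase then yields the pointwise limit
  of the rescaled components, and this is upgraded to norm convergence: by Bessel's inequality and the convergence of \<open>\<parallel>U(t)g\<parallel>\<close> to
  \<open>\<parallel>g\<parallel>\<close>, Fatou's lemma applied to the parallelogram identity leaves no room for a difference.
  Reflection \<open>\<lambda> \<mapsto> -\<lambda>\<close> (exchanging \<open>\<alpha>\<close> and \<open>\<beta>\<close>) covers \<open>(-1,0)\<close>, and conjugation covers \<open>t \<rightarrow> -\<infinity>\<close>.
\<close>

section \<open>The Jacobi weight and its orthogonal polynomials\<close>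

text \<open>Stationary phase needs asymptotics of \<open>G n\<close> that are uniform in the angle,
  whereas an integral representation is simple at one point only. The origin is that point: the unit
  circle about 0 runs through both branch points of (1 - z)^(n + \<alpha>) (1 + z)^(n + \<beta>),
  and on it the n-th powers reduce to 2^n sin^n t with a constant phase, leaving an amplitude free
  of n. Value and derivative there are exactly the initial data that a second-order equation asks
  for.

  Positive and negative \<lambda> are separated because on (0, pi/2) the two phases \<plusminus>n
  \<theta> - t cos \<theta> with t > 0 have together a single stationary point, sin \<theta> = n /
  t, and the second derivative t cos \<theta> does not degenerate there. Hence \<xi> = n / t is sin
  \<theta>, arccos \<xi> is pi/2 - \<theta>, and t \<open>psi\<close> is the critical value of the
  phase, shifted by n pi / 2.

  The coefficients are computed for each fixed \<xi> only, with no estimate uniform near \<xi> = 0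
  or \<xi> = 1. Comparing norms replaces such estimates: the pointwise limits already carry the full
  norm of g, so no mass is left for the uncontrolled indices.\<close>

definition jacobi_moment :: "real \<Rightarrow> real \<Rightarrow> real poly \<Rightarrow> real" where
  "jacobi_moment \<alpha> \<beta> p = (LINT x:{-1<..<1}|lborel. poly p x * jacobi_weight 1 \<alpha> \<beta> x)"

text \<open>The substitution x = 2u - 1 in Euler's Beta integral. The mass formula is what later
  makes the normalization of the Rodrigues polynomials explicit.\<close>

lemma jacobi_weight_Beta:
  assumes "\<alpha> > -1" "\<beta> > -1"
  shows "set_integrable lborel {-1<..<1} (jacobi_weight 1 \<alpha> \<beta>)"
    and "(LINT x:{-1<..<1}|lborel. jacobi_weight 1 \<alpha> \<beta> x) = 2 powr (\<alpha> + \<beta> + 1) * Beta (\<alpha> + 1) (\<beta> + 1)"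
proof -
  define f where "f = (\<lambda>t. indicator {0<..<1} t * ((1 - t) powr \<alpha> * t powr \<beta>) :: real)"
  have ioo: "set_integrable lborel {0..1} (\<lambda>t. t powr \<beta> * (1 - t) powr \<alpha>)"
    using integrable_Beta[of "\<beta> + 1" "\<alpha> + 1"] assms by simp
  have "set_integrable lborel {0<..<1} (\<lambda>t. t powr \<beta> * (1 - t) powr \<alpha>)"
    by (rule set_integrable_subset[OF ioo]) auto
  then have fi: "integrable lborel f"
    by (simp add: set_integrable_def f_def mult.commute)
  have "integral {0..1} (\<lambda>t. t powr \<beta> * (1 - t) powr \<alpha>) = Beta (\<beta> + 1) (\<alpha> + 1)"
    using has_integral_Beta_real[of "\<beta> + 1" "\<alpha> + 1"] assms by (intro integral_unique) simp
  then have "(LINT t:{0..1}|lborel. t powr \<beta> * (1 - t) powr \<alpha>) = Beta (\<beta> + 1) (\<alpha> + 1)"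
    using set_borel_integral_eq_integral(2)[OF ioo] by simp
  moreover have "(LINT t:{0..1}|lborel. t powr \<beta> * (1 - t) powr \<alpha>) = integral\<^sup>L lborel f"
    unfolding set_lebesgue_integral_def f_def
  proof (rule integral_cong_AE)
    show "AE x in lborel. indicator {0..1} x *\<^sub>R (x powr \<beta> * (1 - x) powr \<alpha>) =
      indicator {0<..<1} x * ((1 - x) powr \<alpha> * x powr \<beta>)"
      using AE_lborel_singleton[of "0::real"] AE_lborel_singleton[of "1::real"]
      by eventually_elim (auto split: split_indicator)
  qed auto
  ultimately have fI: "integral\<^sup>L lborel f = Beta (\<alpha> + 1) (\<beta> + 1)"
    by (simp add: Beta_commute)
  have eq: "indicator {-1<..<1} x *\<^sub>R jacobi_weight 1 \<alpha> \<beta> x = 2 powr (\<alpha> + \<beta>) * f (1/2 + (1/2) * x)" for x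
  proof (cases "x \<in> {-1<..<1}")
    case True
    then have "(2 * (1 - (1/2 + x/2))) powr \<alpha> = 2 powr \<alpha> * (1 - (1/2 + x/2)) powr \<alpha>"
      by (simp only: powr_mult)
    moreover have "(2 * (1/2 + x/2)) powr \<beta> = 2 powr \<beta> * (1/2 + x/2) powr \<beta>"
      by (simp only: powr_mult)
    ultimately show ?thesis using True
      by (simp add: jacobi_weight_def f_def powr_add algebra_simps)
  qed (auto simp: f_def indicator_def)
  have ii: "integrable lborel (\<lambda>x. f (1/2 + (1/2) * x))"
    by (rule lborel_integrable_real_affine[OF fi]) auto
  then show "set_integrable lborel {-1<..<1} (jacobi_weight 1 \<alpha> \<beta>)"
    unfolding set_integrable_def eq by simp
  have "integral\<^sup>L lborel f = (1/2) * (LINT x|lborel. f (1/2 + (1/2) * x))"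
    using lborel_integral_real_affine[of "1/2" f "1/2"] by simp
  then have "(LINT x|lborel. f (1/2 + (1/2) * x)) = 2 * Beta (\<alpha> + 1) (\<beta> + 1)"
    using fI by simp
  then show "(LINT x:{-1<..<1}|lborel. jacobi_weight 1 \<alpha> \<beta> x) = 2 powr (\<alpha> + \<beta> + 1) * Beta (\<alpha> + 1) (\<beta> + 1)"
    unfolding set_lebesgue_integral_def eq by (simp add: powr_add)
qed

lemma jacobi_weight_measurable [measurable]: "jacobi_weight k \<alpha> \<beta> \<in> borel_measurable borel"
  unfolding jacobi_weight_def[abs_def] by measurable

lemma poly_measurable [measurable]: "(\<lambda>x::real. poly p x) \<in> borel_measurable borel"
  by (intro borel_measurable_continuous_onI continuous_intros)

lemma poly_jacobi_integrable:
  assumes "\<alpha> > -1" "\<beta> > -1"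
  shows "set_integrable lborel {-1<..<1} (\<lambda>x. poly p x * jacobi_weight 1 \<alpha> \<beta> x)"
proof -
  have "bounded (poly p ` {-1..1})"
    by (intro compact_imp_bounded compact_continuous_image continuous_intros) auto
  then obtain B where B: "\<And>x. x \<in> {-1..1} \<Longrightarrow> \<bar>poly p x\<bar> \<le> B"
    unfolding bounded_iff by (auto simp del: atLeastAtMost_iff)
  show ?thesis
    unfolding set_integrable_def
  proof (rule Bochner_Integration.integrable_bound)
    show "integrable lborel (\<lambda>x. B * (indicator {-1<..<1} x *\<^sub>R jacobi_weight 1 \<alpha> \<beta> x))"
      using jacobi_weight_Beta(1)[OF assms] unfolding set_integrable_def by (rule integrable_mult_right)
    show "AE x in lborel. norm (indicat_real {- 1<..<1} x *\<^sub>R (poly p x * jacobi_weight 1 \<alpha> \<beta> x))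
         \<le> norm (B * (indicat_real {- 1<..<1} x *\<^sub>R jacobi_weight 1 \<alpha> \<beta> x))"
    proof (rule AE_I2)
      fix x :: real
      show "norm (indicat_real {- 1<..<1} x *\<^sub>R (poly p x * jacobi_weight 1 \<alpha> \<beta> x))
         \<le> norm (B * (indicat_real {- 1<..<1} x *\<^sub>R jacobi_weight 1 \<alpha> \<beta> x))"
        using B[of x] by (auto simp: indicator_def abs_mult intro!: mult_right_mono)
    qed
  qed auto
qed

section \<open>Moments of the weight and Jacobi's differential operator\<close>

context
  fixes \<alpha> \<beta> :: real
  assumes ab: "\<alpha> > -1" "\<beta> > -1"
begin

lemma jacobi_moment_add: "jacobi_moment \<alpha> \<beta> (p + q) = jacobi_moment \<alpha> \<beta> p + jacobi_moment \<alpha> \<beta> q"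
  unfolding jacobi_moment_def using poly_jacobi_integrable[OF ab] by (simp add: distrib_right set_integral_add)

lemma jacobi_moment_smult: "jacobi_moment \<alpha> \<beta> (smult c p) = c * jacobi_moment \<alpha> \<beta> p"
  unfolding jacobi_moment_def using poly_jacobi_integrable[OF ab] by (simp add: mult.assoc)

lemma jacobi_moment_0: "jacobi_moment \<alpha> \<beta> 0 = 0"
  by (simp add: jacobi_moment_def)

lemma jacobi_moment_minus: "jacobi_moment \<alpha> \<beta> (- p) = - jacobi_moment \<alpha> \<beta> p"
  using jacobi_moment_smult[of "-1" p] by simp

lemma jacobi_moment_diff: "jacobi_moment \<alpha> \<beta> (p - q) = jacobi_moment \<alpha> \<beta> p - jacobi_moment \<alpha> \<beta> q"
  using jacobi_moment_add[of p "-q"] jacobi_moment_minus[of q] by simp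

lemma jacobi_moment_sum: "jacobi_moment \<alpha> \<beta> (\<Sum>i\<in>A. f i) = (\<Sum>i\<in>A. jacobi_moment \<alpha> \<beta> (f i))"
  by (induction A rule: infinite_finite_induct) (auto simp: jacobi_moment_add jacobi_moment_0)

lemma jacobi_moment_1: "jacobi_moment \<alpha> \<beta> 1 = 2 powr (\<alpha> + \<beta> + 1) * Beta (\<alpha> + 1) (\<beta> + 1)"
  using jacobi_weight_Beta(2)[OF ab] by (simp add: jacobi_moment_def)

lemma jacobi_moment_shift: "jacobi_moment (\<alpha> + 1) (\<beta> + 1) p = jacobi_moment \<alpha> \<beta> ([:1, 0, -1:] * p)"
  unfolding jacobi_moment_def
proof (rule set_lebesgue_integral_cong)
  show "\<forall>x. x \<in> {- 1<..<1} \<longrightarrow>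
        poly p x * jacobi_weight 1 (\<alpha> + 1) (\<beta> + 1) x = poly ([:1, 0, - 1:] * p) x * jacobi_weight 1 \<alpha> \<beta> x"
    by (auto simp: jacobi_weight_def powr_add algebra_simps)
qed auto

text \<open>The integral over [-1,1] of the derivative of (1 - x)^(\<alpha> + 1) (1 + x)^(\<beta> +
  1) p(x): both exponents are positive, so the boundary values vanish. Every later integration by
  parts against the weight is an instance.\<close>

lemma jacobi_moment_ibp: "jacobi_moment \<alpha> \<beta> ([:1, 0, -1:] * pderiv p + [:\<beta> - \<alpha>, - (\<alpha> + \<beta> + 2):] * p) = 0"
proof -
  define q where "q = [:1, 0, -1:] * pderiv p + [:\<beta> - \<alpha>, - (\<alpha> + \<beta> + 2):] * p"
  define F where "F x = (1 - x) powr (\<alpha> + 1) * (1 + x) powr (\<beta> + 1) * poly p x" for x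
  have hi: "((\<lambda>x. poly q x * jacobi_weight 1 \<alpha> \<beta> x) has_integral (F 1 - F (-1))) {-1..1}"
  proof (rule fundamental_theorem_of_calculus_interior)
    show "continuous_on {-1..1} F"
      unfolding F_def using ab by (intro continuous_on_mult continuous_on_powr' continuous_intros) auto
    show "(F has_vector_derivative poly q x * jacobi_weight 1 \<alpha> \<beta> x) (at x)" if x: "x \<in> {-1<..<1}" for x
      unfolding F_def has_real_derivative_iff_has_vector_derivative[symmetric]
      using x
      apply -
      apply (rule derivative_eq_intros refl poly_DERIV | simp)+
      apply (simp add: q_def jacobi_weight_def powr_add powr_diff field_simps)
      done
  qed simp
  have "F 1 - F (-1) = 0" by (simp add: F_def)
  with hi have "((\<lambda>x. poly q x * jacobi_weight 1 \<alpha> \<beta> x) has_integral 0) {-1<..<1}"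
    by (simp add: has_integral_Icc_iff_Ioo)
  moreover have "jacobi_moment \<alpha> \<beta> q = integral {-1<..<1} (\<lambda>x. poly q x * jacobi_weight 1 \<alpha> \<beta> x)"
    unfolding jacobi_moment_def by (rule set_borel_integral_eq_integral[OF poly_jacobi_integrable[OF ab]])
  ultimately show ?thesis by (simp add: q_def integral_unique)
qed

text \<open>Jacobi's hypergeometric operator. Multiplied by the weight it is the derivative of (1 -
  x)^(\<alpha> + 1) (1 + x)^(\<beta> + 1) p'(x).\<close>

definition jacobi_diff_op :: "real poly \<Rightarrow> real poly" where
  "jacobi_diff_op p = [:1, 0, -1:] * pderiv (pderiv p) + [:\<beta> - \<alpha>, - (\<alpha> + \<beta> + 2):] * pderiv p"

text \<open>Integration by parts applied to q p'. The right-hand side is symmetric in p and q, so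
  this one identity gives both the self-adjointness of the operator and the orthogonality of the
  derivatives for the raised parameters.\<close>

lemma jacobi_moment_diff_op: "jacobi_moment \<alpha> \<beta> (q * jacobi_diff_op p) = - jacobi_moment (\<alpha> + 1) (\<beta> + 1) (pderiv p * pderiv q)"
proof -
  have "[:1, 0, -1:] * pderiv (q * pderiv p) + [:\<beta> - \<alpha>, - (\<alpha> + \<beta> + 2):] * (q * pderiv p) =
      q * jacobi_diff_op p + [:1, 0, -1:] * (pderiv p * pderiv q)"
    by (simp add: jacobi_diff_op_def pderiv_mult algebra_simps del: mult_pCons_left mult_pCons_right)
  then show ?thesis
    using jacobi_moment_ibp[of "q * pderiv p"] jacobi_moment_shift by (simp add: jacobi_moment_add)
qed

text \<open>The operator is triangular with respect to the degree, so its eigenvalue can be read off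
  the top coefficient. Vanishing coefficients stand in for a degree bound in order to treat the zero
  polynomial uniformly.\<close>

lemma coeff_jacobi_diff_op:
  assumes "\<forall>i>n. coeff p i = 0"
  shows "coeff (jacobi_diff_op p) n = - (real n * (n + \<alpha> + \<beta> + 1)) * coeff p n"
    and "\<forall>i>n. coeff (jacobi_diff_op p) i = 0"
proof -
  have quad: "coeff ([:1, 0, -1:] * r) i = coeff r i - (if i \<ge> 2 then coeff r (i - 2) else 0)" for r :: "real poly" and i
    by (cases i; cases "i - 1") (auto simp: numeral_2_eq_2)
  have lin: "coeff ([:c, d:] * r) i = c * coeff r i + d * (if i \<ge> 1 then coeff r (i - 1) else 0)" for r :: "real poly" and i c d
    by (cases i) auto
  show "coeff (jacobi_diff_op p) n = - (real n * (n + \<alpha> + \<beta> + 1)) * coeff p n"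
  proof -
    consider "n = 0" | "n = 1" | m where "n = Suc (Suc m)"
      by (metis One_nat_def old.nat.exhaust)
    then show ?thesis
    proof cases
      case 1 with assms show ?thesis by (simp add: jacobi_diff_op_def coeff_pderiv del: mult_pCons_left) (simp add: quad lin coeff_pderiv)
    next
      case 2 with assms show ?thesis unfolding jacobi_diff_op_def coeff_add quad lin by (simp add: coeff_pderiv algebra_simps)
    next
      case 3 with assms show ?thesis unfolding jacobi_diff_op_def coeff_add quad lin by (simp add: coeff_pderiv algebra_simps)
    qed
  qed
  show "\<forall>i>n. coeff (jacobi_diff_op p) i = 0"
    using assms unfolding jacobi_diff_op_def coeff_add quad lin by (auto simp: coeff_pderiv)
qed

end

section \<open>Orthonormal polynomials and their differential equation\<close>

definition ortho_jacobi :: "real \<Rightarrow> real \<Rightarrow> real \<Rightarrow> (nat \<Rightarrow> real poly) \<Rightarrow> bool" where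
  "ortho_jacobi k \<alpha> \<beta> G \<longleftrightarrow> (\<forall>n. degree (G n) = n \<and> lead_coeff (G n) > 0) \<and>
     (\<forall>m n. k * jacobi_moment \<alpha> \<beta> (G m * G n) = (if m = n then 1 else 0))"

lemma ortho_jacobi_iff:
  assumes "\<alpha> > -1" "\<beta> > -1"
  shows "orthonormal_polys (jacobi_weight k \<alpha> \<beta>) G \<longleftrightarrow> ortho_jacobi k \<alpha> \<beta> G"
proof -
  have w: "poly (G m) x * poly (G n) x * jacobi_weight k \<alpha> \<beta> x = k * (poly (G m * G n) x * jacobi_weight 1 \<alpha> \<beta> x)" for m n x
    by (simp add: jacobi_weight_def)
  show ?thesis
    unfolding orthonormal_polys_def ortho_jacobi_def w jacobi_moment_def
    using poly_jacobi_integrable[OF assms] by (simp del: poly_mult)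
qed

text \<open>The top coefficient is peeled off repeatedly. \<open>N\<close> counts coefficients
  instead of naming a degree, so the induction starts at the zero polynomial.\<close>

lemma poly_expand:
  fixes G :: "nat \<Rightarrow> real poly"
  assumes "\<And>n. degree (G n) = n \<and> lead_coeff (G n) > 0" "\<forall>i\<ge>N. coeff p i = 0"
  shows "\<exists>c. p = (\<Sum>m<N. smult (c m) (G m))"
  using assms(2)
proof (induction N arbitrary: p)
  case 0
  then show ?case by (auto simp: poly_eq_iff)
next
  case (Suc N)
  define c where "c = coeff p N / lead_coeff (G N)"
  have "coeff (p - smult c (G N)) i = 0" if "i \<ge> N" for i
  proof (cases "i = N")
    case True
    moreover have "coeff (G N) N \<noteq> 0" using assms(1)[of N] by auto
    ultimately show ?thesis using assms(1)[of N] by (simp add: c_def)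
  next
    case False
    then show ?thesis using that Suc.prems assms(1)[of N] by (simp add: coeff_eq_0)
  qed
  from Suc.IH[of "p - smult c (G N)"] this obtain d where d: "p - smult c (G N) = (\<Sum>m<N. smult (d m) (G m))"
    by blast
  have "p = (\<Sum>m<Suc N. smult ((d(N := c)) m) (G m))"
    using d by (simp add: algebra_simps)
  then show ?case by blast
qed

text \<open>\<open>k\<close> is kept as a free positive factor, so that the derivatives of the
  polynomials are again an instance, with the same \<open>k\<close> and both parameters raised by
  one.\<close>

locale jacobi_polys =
  fixes k \<alpha> \<beta> :: real and G :: "nat \<Rightarrow> real poly"
  assumes ab: "\<alpha> > -1" "\<beta> > -1" and k: "k > 0" and G: "ortho_jacobi k \<alpha> \<beta> G"
begin

lemma deg: "degree (G n) = n" and lc: "lead_coeff (G n) > 0" "coeff (G n) n > 0"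
  and orth: "k * jacobi_moment \<alpha> \<beta> (G m * G n) = (if m = n then 1 else 0)"
proof -
  show "degree (G n) = n" "lead_coeff (G n) > 0" "k * jacobi_moment \<alpha> \<beta> (G m * G n) = (if m = n then 1 else 0)"
    using G unfolding ortho_jacobi_def by blast+
  show "coeff (G n) n > 0" using \<open>lead_coeff (G n) > 0\<close> unfolding \<open>degree (G n) = n\<close> .
qed

lemma orth_zero:
  assumes "\<forall>i\<ge>N. coeff p i = 0" "\<And>m. m < N \<Longrightarrow> jacobi_moment \<alpha> \<beta> (p * G m) = 0"
  shows "p = 0"
proof -
  obtain c where c: "p = (\<Sum>m<N. smult (c m) (G m))"
    using poly_expand[OF _ assms(1), of G] deg lc by auto
  have "c m = 0" if "m < N" for m
  proof -
    have "k * jacobi_moment \<alpha> \<beta> (p * G m) = (\<Sum>i<N. c i * (k * jacobi_moment \<alpha> \<beta> (G i * G m)))"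
      by (subst c) (simp add: sum_distrib_right jacobi_moment_sum[OF ab] jacobi_moment_smult[OF ab] sum_distrib_left mult_ac)
    also have "\<dots> = c m" using that by (simp add: orth if_distrib cong: if_cong)
    finally show ?thesis using assms(2)[OF that] by simp
  qed
  then show ?thesis using c by simp
qed

text \<open>Adding the expected eigenvalue times \<open>G n\<close> cancels the top coefficient, so
  the sum has degree below n. It is orthogonal to every lower \<open>G m\<close>, because the
  operator can be moved onto \<open>G m\<close>, where it does not raise the degree. Hence the sum
  vanishes.\<close>

lemma jacobi_diff_op_G: "jacobi_diff_op \<alpha> \<beta> (G n) = smult (- (real n * (n + \<alpha> + \<beta> + 1))) (G n)"
proof -
  define p where "p = jacobi_diff_op \<alpha> \<beta> (G n) + smult (real n * (n + \<alpha> + \<beta> + 1)) (G n)"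
  have "\<forall>i>n. coeff (G n) i = 0" by (simp add: coeff_eq_0 deg)
  note cf = coeff_jacobi_diff_op[OF ab this]
  have "p = 0"
  proof (rule orth_zero[of n])
    show "\<forall>i\<ge>n. coeff p i = 0"
      using cf deg unfolding p_def by (auto simp: coeff_eq_0 le_less)
    fix m assume "m < n"
    have "\<forall>i>m. coeff (G m) i = 0" by (simp add: coeff_eq_0 deg)
    then have "\<forall>i\<ge>Suc m. coeff (jacobi_diff_op \<alpha> \<beta> (G m)) i = 0" using coeff_jacobi_diff_op(2)[OF ab] by (auto simp: Suc_le_eq)
    from poly_expand[OF _ this, of G] obtain c where c: "jacobi_diff_op \<alpha> \<beta> (G m) = (\<Sum>i<Suc m. smult (c i) (G i))"
      using deg lc by auto
    have z: "jacobi_moment \<alpha> \<beta> (G n * G i) = 0" if "i < n" for i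
      using orth[of n i] that k by auto
    have "jacobi_moment \<alpha> \<beta> (G m * jacobi_diff_op \<alpha> \<beta> (G n)) = jacobi_moment \<alpha> \<beta> (G n * jacobi_diff_op \<alpha> \<beta> (G m))"
      by (simp add: jacobi_moment_diff_op[OF ab] mult.commute)
    also have "\<dots> = 0"
      unfolding c sum_distrib_left jacobi_moment_sum[OF ab]
      using \<open>m < n\<close> by (intro sum.neutral) (auto simp: jacobi_moment_smult[OF ab] z)
    finally show "jacobi_moment \<alpha> \<beta> (p * G m) = 0"
      using z[OF \<open>m < n\<close>] by (simp add: p_def distrib_left jacobi_moment_add[OF ab] jacobi_moment_smult[OF ab] mult.commute[of _ "G m"])
  qed
  then show ?thesis by (simp add: p_def eq_neg_iff_add_eq_0)
qed

lemma jacobi_ode: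
  "(1 - x\<^sup>2) * poly (pderiv (pderiv (G n))) x + (\<beta> - \<alpha> - (\<alpha> + \<beta> + 2) * x) * poly (pderiv (G n)) x
     = - (real n * (n + \<alpha> + \<beta> + 1)) * poly (G n) x"
  using arg_cong[OF jacobi_diff_op_G[of n], of "\<lambda>p. poly p x"]
  by (simp add: jacobi_diff_op_def[OF ab] power2_eq_square algebra_simps)

text \<open>By the symmetric identity for the operator, the derivatives of degree n + 1 have squared
  norm equal to the eigenvalue (n + 1) (n + \<alpha> + \<beta> + 2); the factor is the inverse of
  its square root. This lets every statement about values at 0 be reused for derivatives at
  0.\<close>

lemma jacobi_deriv:
  "jacobi_polys k (\<alpha> + 1) (\<beta> + 1) (\<lambda>n. smult (1 / sqrt ((real n + 1) * (real n + \<alpha> + \<beta> + 2))) (pderiv (G (Suc n))))"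
proof
  have pos: "(real n + 1) * (real n + \<alpha> + \<beta> + 2) > 0" for n using ab by (auto intro!: mult_pos_pos)
  let ?s = "\<lambda>n. sqrt ((real n + 1) * (real n + \<alpha> + \<beta> + 2))"
  have sp: "?s n > 0" for n using pos by simp
  show "ortho_jacobi k (\<alpha> + 1) (\<beta> + 1) (\<lambda>n. smult (1 / sqrt ((real n + 1) * (real n + \<alpha> + \<beta> + 2))) (pderiv (G (Suc n))))"
    unfolding ortho_jacobi_def
  proof (intro conjI allI)
    fix n
    show d: "degree (smult (1 / sqrt ((real n + 1) * (real n + \<alpha> + \<beta> + 2))) (pderiv (G (Suc n)))) = n"
    proof -
      have "1 / ?s n \<noteq> 0" using sp[of n] by (metis divide_eq_0_iff less_irrefl zero_neq_one)
      then show ?thesis unfolding degree_smult_eq by (simp only: if_False degree_pderiv deg diff_Suc_1)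
    qed
    show "lead_coeff (smult (1 / sqrt ((real n + 1) * (real n + \<alpha> + \<beta> + 2))) (pderiv (G (Suc n)))) > 0"
      using sp[of n] lc(2)[of "Suc n"] unfolding d coeff_smult coeff_pderiv by (intro mult_pos_pos divide_pos_pos) auto
  next
    fix m n
    have "k * jacobi_moment (\<alpha> + 1) (\<beta> + 1) (pderiv (G (Suc m)) * pderiv (G (Suc n))) = - k * jacobi_moment \<alpha> \<beta> (G (Suc n) * jacobi_diff_op \<alpha> \<beta> (G (Suc m)))"
      by (simp add: jacobi_moment_diff_op[OF ab])
    also have "\<dots> = (real (Suc m) * (Suc m + \<alpha> + \<beta> + 1)) * (k * jacobi_moment \<alpha> \<beta> (G (Suc n) * G (Suc m)))"
      unfolding jacobi_diff_op_G mult_smult_right jacobi_moment_smult[OF ab] by (simp add: algebra_simps)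
    also have "\<dots> = (if m = n then ?s m * ?s n else 0)"
      unfolding orth using pos[of n] by (simp add: algebra_simps)
    finally show "k * jacobi_moment (\<alpha> + 1) (\<beta> + 1) (smult (1 / sqrt ((real m + 1) * (real m + \<alpha> + \<beta> + 2))) (pderiv (G (Suc m))) *
       smult (1 / sqrt ((real n + 1) * (real n + \<alpha> + \<beta> + 2))) (pderiv (G (Suc n)))) = (if m = n then 1 else 0)"
      using sp[of m] sp[of n] ab by (auto simp: jacobi_moment_smult field_simps)
  qed
qed (use ab k in auto)

end

section \<open>Fresnel integrals\<close>

lemma gauss_limit: "((\<lambda>Y. integral {0..Y} (\<lambda>x. exp (- x\<^sup>2 / 2))) \<longlongrightarrow> sqrt (pi / 2)) at_top"
proof -
  let ?f = "\<lambda>x::real. indicator {0..} x *\<^sub>R exp (- x\<^sup>2 / 2)"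
  have "has_bochner_integral lborel (\<lambda>x. indicator {0..} (0 + (1 / sqrt 2) * x) *\<^sub>R exp (- (0 + (1 / sqrt 2) * x)\<^sup>2))
      ((sqrt pi / 2) /\<^sub>R \<bar>1 / sqrt 2\<bar>)"
    by (rule lborel_has_bochner_integral_real_affine_iff[THEN iffD1, OF _ gaussian_moment_0]) simp
  moreover have "(indicator {0..} (0 + (1 / sqrt 2) * x) *\<^sub>R exp (- (0 + (1 / sqrt 2) * x)\<^sup>2)) = ?f x" for x :: real
    by (auto simp: indicator_def power_divide zero_le_divide_iff)
  moreover have "(sqrt pi / 2) /\<^sub>R \<bar>1 / sqrt 2\<bar> = sqrt (pi / 2)"
    by (simp add: real_sqrt_divide field_simps)
  ultimately have f: "has_bochner_integral lborel ?f (sqrt (pi / 2))" by simp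
  then have i: "integrable lborel ?f" and I: "integral\<^sup>L lborel ?f = sqrt (pi / 2)"
    by (auto simp: has_bochner_integral_iff)
  have "((\<lambda>y. LINT x|lborel. indicator {..y} x *\<^sub>R ?f x) \<longlongrightarrow> sqrt (pi / 2)) at_top"
    using tendsto_integral_at_top[of lborel ?f] i I by simp
  moreover have "(LINT x|lborel. indicator {..y} x *\<^sub>R ?f x) = integral {0..y} (\<lambda>x. exp (- x\<^sup>2 / 2))" for y
  proof -
    have "(LINT x|lborel. indicator {..y} x *\<^sub>R ?f x) = (LINT x:{0..y}|lborel. exp (- x\<^sup>2 / 2))"
      unfolding set_lebesgue_integral_def by (intro Bochner_Integration.integral_cong) (auto simp: indicator_def)
    also have "\<dots> = integral {0..y} (\<lambda>x. exp (- x\<^sup>2 / 2))"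
      by (intro set_borel_integral_eq_integral(2) borel_integrable_atLeastAtMost' continuous_intros) auto
    finally show ?thesis .
  qed
  ultimately show ?thesis by simp
qed

lemma jordan_sine:
  fixes x :: real
  assumes "0 \<le> x" "x \<le> pi / 2"
  shows "2 * x / pi \<le> sin x"
proof -
  have "concave_on {0..pi} (sin :: real \<Rightarrow> real)"
    unfolding concave_on_def
    by (rule f''_ge0_imp_convex[where f' = "\<lambda>x. - cos x" and f'' = "\<lambda>x. sin x"])
       (auto intro!: derivative_eq_intros sin_ge_zero)
  from concave_onD[OF this, of "2 * x / pi" 0 "pi / 2"] assms show ?thesis
    by (simp add: field_simps)
qed

text \<open>Rotation of the contour by -pi/4. The entire primitive E of exp(-w^2/2) expresses both
  integrals as increments: along the real ray the Gaussian one, and along w = y cis(-pi/4), where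
  w^2 = -i y^2, the Fresnel one. The two endpoints are joined by an arc of radius Y, along which E
  changes by at most pi / (2 Y).\<close>

lemma fresnel_limit:
  "((\<lambda>Y. integral {0..Y} (\<lambda>y. cis (y\<^sup>2 / 2))) \<longlongrightarrow> cis (pi / 4) * of_real (sqrt (pi / 2))) at_top"
proof -
  have "(\<lambda>w::complex. exp (- w\<^sup>2 / 2)) holomorphic_on UNIV"
    by (intro holomorphic_intros) auto
  then obtain E :: "complex \<Rightarrow> complex" where E: "\<And>w. (E has_field_derivative exp (- w\<^sup>2 / 2)) (at w)"
    using holomorphic_convex_primitive'[of UNIV "\<lambda>w::complex. exp (- w\<^sup>2 / 2)"] by auto
  have real: "integral {0..Y} (\<lambda>x. of_real (exp (- x\<^sup>2 / 2))) = E (of_real Y) - E 0" if "Y \<ge> 0" for Y :: real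
  proof (rule integral_unique)
    have "((\<lambda>x. of_real (exp (- x\<^sup>2 / 2))) has_integral (E (of_real Y) - E (of_real 0))) {0..Y}"
    proof (rule fundamental_theorem_of_calculus[OF that])
      fix x :: real
      have "((\<lambda>x. E (of_real x)) has_vector_derivative (1 * exp (- (of_real x)\<^sup>2 / 2))) (at x within {0..Y})"
        by (intro field_vector_diff_chain_within[of of_real 1, unfolded o_def] has_field_derivative_at_within[OF E] derivative_eq_intros) auto
      then show "((\<lambda>x. E (of_real x)) has_vector_derivative of_real (exp (- x\<^sup>2 / 2))) (at x within {0..Y})"
        by (simp flip: of_real_power exp_of_real)
    qed
    then show "((\<lambda>x. of_real (exp (- x\<^sup>2 / 2))) has_integral (E (of_real Y) - E 0)) {0..Y}" by simp
  qed
  have ray: "integral {0..Y} (\<lambda>y. cis (y\<^sup>2 / 2)) = cis (pi / 4) * (E (of_real Y * cis (- pi / 4)) - E 0)" if "Y \<ge> 0" for Y :: real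
  proof (rule integral_unique)
    have "((\<lambda>y. cis (y\<^sup>2 / 2)) has_integral (cis (pi / 4) * E (of_real Y * cis (- pi / 4)) - cis (pi/4) * E (of_real 0 * cis (- pi / 4)))) {0..Y}"
    proof (rule fundamental_theorem_of_calculus[OF that])
      fix x :: real
      have "((\<lambda>x. E (of_real x * cis (- pi / 4))) has_vector_derivative (cis (- pi / 4) * exp (- (of_real x * cis (- pi / 4))\<^sup>2 / 2))) (at x within {0..Y})"
      proof (rule field_vector_diff_chain_within[of "\<lambda>x. of_real x * cis (- pi / 4)", unfolded o_def])
        show "((\<lambda>x. of_real x * cis (- pi / 4)) has_vector_derivative cis (- pi / 4)) (at x within {0..Y})"
          unfolding has_vector_derivative_def
          by (auto intro!: derivative_eq_intros simp: fun_eq_iff scaleR_conv_of_real)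
      qed (rule has_field_derivative_at_within[OF E])
      then have "((\<lambda>x. cis (pi/4) * E (of_real x * cis (- pi / 4))) has_vector_derivative (cis (pi/4) * (cis (- pi / 4) * exp (- (of_real x * cis (- pi / 4))\<^sup>2 / 2)))) (at x within {0..Y})"
        by (rule has_vector_derivative_mult_right)
      moreover have "(of_real x * cis (- pi / 4))\<^sup>2 = - \<i> * (of_real x)\<^sup>2"
        by (simp add: power_mult_distrib Complex.DeMoivre)
      ultimately show "((\<lambda>x. cis (pi/4) * E (of_real x * cis (- pi / 4))) has_vector_derivative cis (x\<^sup>2 / 2)) (at x within {0..Y})"
        by (simp add: cis_conv_exp mult.assoc flip: exp_add)
    qed
    then show "((\<lambda>y. cis (y\<^sup>2 / 2)) has_integral (cis (pi / 4) * (E (of_real Y * cis (- pi / 4)) - E 0))) {0..Y}"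
      by (simp add: algebra_simps)
  qed
  have arc: "cmod (E (of_real Y) - E (of_real Y * cis (- pi / 4))) \<le> pi / (2 * Y)" if Y: "Y > 0" for Y :: real
  proof -
    define h where "h = (\<lambda>\<phi>. \<i> * of_real Y * cis \<phi> * exp (- (of_real Y * cis \<phi>)\<^sup>2 / 2))"
    \<comment> \<open>H is a primitive of the majorant of h on the arc. The majorant comes from
      replacing cos(2 \<phi>) in the exponent by its chord 1 + 4 \<phi> / pi, which is Jordan's
      inequality shifted by a quarter turn.\<close>
    define H where "H = (\<lambda>\<phi>. - (pi / (2 * Y)) * exp (- Y\<^sup>2 / 2 * (1 + 4 * \<phi> / pi)))"
    have "(h has_integral (E (of_real Y * cis 0) - E (of_real Y * cis (-pi/4)))) {-pi/4..0}"
    proof (rule fundamental_theorem_of_calculus)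
      fix \<phi> :: real
      have Yc: "((\<lambda>x. of_real Y * cis x) has_vector_derivative (of_real Y * (\<i> * cis \<phi>))) (at \<phi> within {-pi/4..0})"
        unfolding has_vector_derivative_def
        by (intro derivative_eq_intros) (auto simp: fun_eq_iff scaleR_conv_of_real)
      show "((\<lambda>\<phi>. E (of_real Y * cis \<phi>)) has_vector_derivative h \<phi>) (at \<phi> within {-pi/4..0})"
        using field_vector_diff_chain_within[OF Yc has_field_derivative_at_within[OF E]]
        unfolding h_def o_def by (simp add: mult_ac)
    qed auto
    note hi = this
    have Hi: "((\<lambda>\<phi>. Y * exp (- Y\<^sup>2 / 2 * (1 + 4 * \<phi> / pi))) has_integral (H 0 - H (-pi/4))) {-pi/4..0}"
    proof (rule fundamental_theorem_of_calculus)
      fix \<phi> :: real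
      show "(H has_vector_derivative Y * exp (- Y\<^sup>2 / 2 * (1 + 4 * \<phi> / pi))) (at \<phi> within {-pi/4..0})"
        unfolding H_def has_real_derivative_iff_has_vector_derivative[symmetric]
        by (rule derivative_eq_intros refl | simp)+ (use Y in \<open>simp add: field_simps power2_eq_square\<close>)
    qed auto
    have "norm (h \<phi>) \<le> Y * exp (- Y\<^sup>2 / 2 * (1 + 4 * \<phi> / pi))" if "\<phi> \<in> {-pi/4..0}" for \<phi>
    proof -
      have cosge: "1 + 4 * \<phi> / pi \<le> cos (2 * \<phi>)"
      proof -
        have "2 * (pi/2 + 2*\<phi>) / pi \<le> sin (pi/2 + 2*\<phi>)"
          using that by (intro jordan_sine) auto
        moreover have "sin (pi/2 + 2*\<phi>) = cos (2*\<phi>)" by (simp add: sin_add)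
        moreover have "2 * (pi/2 + 2*\<phi>) / pi = 1 + 4 * \<phi> / pi" by (simp add: field_simps)
        ultimately show ?thesis by simp
      qed
      have "Re ((of_real Y * cis \<phi>)\<^sup>2) = Y\<^sup>2 * cos (2 * \<phi>)"
        by (simp add: power_mult_distrib Complex.DeMoivre flip: of_real_power)
      then have "norm (h \<phi>) = Y * exp (- Y\<^sup>2 / 2 * cos (2 * \<phi>))"
        using Y by (simp add: h_def norm_mult)
      also have "\<dots> \<le> Y * exp (- Y\<^sup>2 / 2 * (1 + 4 * \<phi> / pi))"
        using cosge Y by (intro mult_left_mono iffD2[OF exp_le_cancel_iff] mult_left_mono_neg) auto
      finally show ?thesis .
    qed
    then have "norm (integral {-pi/4..0} h) \<le> integral {-pi/4..0} (\<lambda>\<phi>. Y * exp (- Y\<^sup>2 / 2 * (1 + 4 * \<phi> / pi)))"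
      using hi Hi by (intro integral_norm_bound_integral) (auto simp: has_integral_iff)
    also have "\<dots> = H 0 - H (-pi/4)" using Hi by (rule integral_unique)
    also have "\<dots> \<le> pi / (2 * Y)" using Y by (simp add: H_def)
    finally show ?thesis using integral_unique[OF hi] by simp
  qed
  have "((\<lambda>Y. E (of_real Y * cis (- pi / 4)) - E (of_real Y)) \<longlongrightarrow> 0) at_top"
  proof (rule Lim_null_comparison)
    show "\<forall>\<^sub>F Y in at_top. norm (E (complex_of_real Y * cis (- pi / 4)) - E (complex_of_real Y)) \<le> pi / (2 * Y)"
      using eventually_gt_at_top[of 0] by eventually_elim (use arc in \<open>simp add: norm_minus_commute\<close>)
    show "((\<lambda>Y. pi / (2 * Y)) \<longlongrightarrow> 0) at_top" by real_asymp
  qed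
  moreover have "((\<lambda>Y. E (of_real Y) - E 0) \<longlongrightarrow> of_real (sqrt (pi / 2))) at_top"
  proof (rule Lim_transform_eventually)
    show "((\<lambda>Y. complex_of_real (integral {0..Y} (\<lambda>x. exp (- x\<^sup>2 / 2)))) \<longlongrightarrow> of_real (sqrt (pi / 2))) at_top"
      by (intro tendsto_of_real gauss_limit)
    show "\<forall>\<^sub>F Y in at_top. complex_of_real (integral {0..Y} (\<lambda>x. exp (- x\<^sup>2 / 2))) = E (of_real Y) - E 0"
      using eventually_ge_at_top[of 0]
    proof eventually_elim
      case (elim Y)
      have "(\<lambda>x. exp (- x\<^sup>2 / 2)) integrable_on {0..Y}" by (intro integrable_continuous_real continuous_intros) auto
      then have "((\<lambda>x. complex_of_real (exp (- x\<^sup>2 / 2))) has_integral of_real (integral {0..Y} (\<lambda>x. exp (- x\<^sup>2 / 2)))) {0..Y}"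
        by (intro has_integral_of_real integrable_integral)
      then show ?case using real[OF elim] by (simp add: has_integral_iff)
    qed
  qed
  ultimately have "((\<lambda>Y. (E (of_real Y * cis (- pi / 4)) - E (of_real Y)) + (E (of_real Y) - E 0)) \<longlongrightarrow> 0 + of_real (sqrt (pi / 2))) at_top"
    by (rule tendsto_add)
  then have "((\<lambda>Y. cis (pi / 4) * (E (of_real Y * cis (- pi / 4)) - E 0)) \<longlongrightarrow> cis (pi / 4) * of_real (sqrt (pi / 2))) at_top"
    by (intro tendsto_intros) simp
  then show ?thesis
    by (rule Lim_transform_eventually) (use eventually_ge_at_top[of 0] in eventually_elim, simp add: ray)
qed

section \<open>An absolutely integrable form of the Fresnel integral\<close>

lemma integrable_inverse_1_plus_square': "integrable lborel (\<lambda>x::real. inverse (1 + x\<^sup>2))"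
  using integrable_inverse_1_plus_square by (simp add: set_integrable_def einterval_def)

text \<open>Majorant for the rescaled integrand of stationary phase. The bound c y^2 \<le> 1 + c^2
  y^4 reduces it to a multiple of 1 / (1 + y^2).\<close>

lemma integrable_quartic_decay:
  fixes c :: real
  assumes "c > 0"
  shows "integrable lborel (\<lambda>y::real. y\<^sup>2 / (1 + c\<^sup>2 * y ^ 4))"
proof (rule Bochner_Integration.integrable_bound)
  show "integrable lborel (\<lambda>x::real. (1 / c + 1 / c\<^sup>2) * inverse (1 + x\<^sup>2))"
    by (intro integrable_mult_right integrable_inverse_1_plus_square')
  show "AE y in lborel. norm (y\<^sup>2 / (1 + c\<^sup>2 * y ^ 4)) \<le> norm ((1 / c + 1 / c\<^sup>2) * inverse (1 + y\<^sup>2))"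
  proof (rule AE_I2)
    fix y :: real
    have pos: "1 + c\<^sup>2 * y ^ 4 > 0" by (intro add_pos_nonneg) auto
    have pos': "1 + y\<^sup>2 > 0" by (intro add_pos_nonneg) auto
    have 0: "0 \<le> (1 - c * y\<^sup>2)\<^sup>2" by simp
    have 1: "c * y\<^sup>2 \<le> 1 + c\<^sup>2 * y ^ 4"
      using 0 by (simp add: power2_diff power_mult_distrib flip: power_mult) (smt (verit) assms mult_nonneg_nonneg zero_le_power2)
    have "y\<^sup>2 * (1 + y\<^sup>2) = (c * y\<^sup>2) / c + (c\<^sup>2 * y ^ 4) / c\<^sup>2"
      using assms by (simp add: algebra_simps flip: power_add)
    also have "\<dots> \<le> (1 + c\<^sup>2 * y ^ 4) / c + (1 + c\<^sup>2 * y ^ 4) / c\<^sup>2"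
      using 1 assms by (intro add_mono divide_right_mono) auto
    also have "\<dots> = (1 / c + 1 / c\<^sup>2) * (1 + c\<^sup>2 * y ^ 4)" by (simp add: field_simps)
    finally have "y\<^sup>2 / (1 + c\<^sup>2 * y ^ 4) \<le> (1 / c + 1 / c\<^sup>2) * inverse (1 + y\<^sup>2)"
      using pos pos' by (simp add: field_simps)
    then show "norm (y\<^sup>2 / (1 + c\<^sup>2 * y ^ 4)) \<le> norm ((1 / c + 1 / c\<^sup>2) * inverse (1 + y\<^sup>2))"
      using pos pos' assms by simp
  qed
qed simp

text \<open>The limit of the integrand produced by \<open>stationary_ibp\<close> after rescaling \<open>x - \<theta>\<close> by \<open>\<surd>t\<close>: absolutely
  integrable, in contrast to \<open>cis (c y\<^sup>2 / 2)\<close>.\<close>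

definition fresnel_kernel :: "real \<Rightarrow> real \<Rightarrow> complex" where
  "fresnel_kernel c y = 2 * \<i> * of_real (c * y\<^sup>2) / (1 + \<i> * of_real (c * y\<^sup>2))\<^sup>2 * cis (c * y\<^sup>2 / 2)"

lemma one_plus_i_nz: "1 + \<i> * complex_of_real r \<noteq> 0"
  by (simp add: complex_eq_iff)

lemma norm_one_plus_i: "(cmod (1 + \<i> * complex_of_real r))\<^sup>2 = 1 + r\<^sup>2"
  by (simp add: cmod_power2)

lemma continuous_fresnel_kernel: "continuous_on S (fresnel_kernel c)"
  unfolding fresnel_kernel_def[abs_def] by (intro continuous_intros) (auto simp: one_plus_i_nz simp del: of_real_mult of_real_power)

lemma fresnel_kernel_measurable [measurable]: "fresnel_kernel c \<in> borel_measurable borel"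
  by (intro borel_measurable_continuous_onI continuous_fresnel_kernel)

text \<open>The kernel differs from cis(y^2/2) by the derivative of y cis(y^2/2) / (1 + i y^2),
  which is 0 at the origin and O(1/Y) at infinity. So the absolutely convergent integral over the
  half-line has the value of the improper Fresnel integral, and evenness doubles it.\<close>

lemma fresnel_kernel_integral1:
  "has_bochner_integral lborel (fresnel_kernel 1) (cis (pi / 4) * of_real (sqrt (2 * pi)))"
proof -
  let ?K = "fresnel_kernel 1"
  have nK: "norm (?K y) = 2 * y\<^sup>2 / (1 + y ^ 4)" for y
  proof -
    have "(cmod (1 + \<i> * of_real (1 * y\<^sup>2)))\<^sup>2 = 1 + y ^ 4"
      unfolding norm_one_plus_i by (simp flip: power_mult)
    then show ?thesis unfolding fresnel_kernel_def norm_mult norm_divide norm_power by (simp add: norm_mult norm_power)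
  qed
  have int: "integrable lborel ?K"
  proof (rule Bochner_Integration.integrable_bound)
    show "integrable lborel (\<lambda>y::real. 2 * (y\<^sup>2 / (1 + 1\<^sup>2 * y ^ 4)))"
      by (intro integrable_mult_right integrable_quartic_decay) simp
  qed (auto simp: nK)
  have FTC: "integral {0..Y} ?K = integral {0..Y} (\<lambda>y. cis (y\<^sup>2 / 2)) - of_real Y * cis (Y\<^sup>2 / 2) / (1 + \<i> * of_real (Y\<^sup>2))"
    if Y: "Y \<ge> 0" for Y
  proof -
    let ?F = "\<lambda>y. of_real y * cis (y\<^sup>2 / 2) / (1 + \<i> * of_real (y\<^sup>2))"
    have "((\<lambda>y. cis (y\<^sup>2 / 2) - ?K y) has_integral (?F Y - ?F 0)) {0..Y}"
    proof (rule fundamental_theorem_of_calculus[OF Y])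
      fix x :: real
      have nz: "1 + \<i> * (of_real x)\<^sup>2 \<noteq> 0" using one_plus_i_nz[of "x\<^sup>2"] by simp
      have c: "((\<lambda>y. cis (y\<^sup>2 / 2)) has_vector_derivative (\<i> * of_real x * cis (x\<^sup>2 / 2))) (at x within {0..Y})"
        unfolding has_vector_derivative_def
        by (auto intro!: derivative_eq_intros simp: fun_eq_iff scaleR_conv_of_real)
      have d: "((\<lambda>y. inverse (1 + \<i> * of_real (y\<^sup>2))) has_vector_derivative (- (2 * \<i> * of_real x) / (1 + \<i> * of_real (x\<^sup>2))\<^sup>2)) (at x within {0..Y})"
        unfolding has_vector_derivative_def
        by (rule derivative_eq_intros refl | simp add: nz)+ (simp add: fun_eq_iff scaleR_conv_of_real divide_inverse power2_eq_square mult_ac)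
      have e: "(complex_of_real has_vector_derivative 1) (at x within {0..Y})"
        unfolding has_vector_derivative_def
        by (auto intro!: derivative_eq_intros simp: fun_eq_iff scaleR_conv_of_real)
      have A: "((\<lambda>y. of_real y * cis (y\<^sup>2 / 2) * inverse (1 + \<i> * of_real (y\<^sup>2))) has_vector_derivative
         (of_real x * cis (x\<^sup>2/2) * (- (2 * \<i> * of_real x) / (1 + \<i> * of_real (x\<^sup>2))\<^sup>2)
          + (of_real x * (\<i> * of_real x * cis (x\<^sup>2 / 2)) + 1 * cis (x\<^sup>2/2)) * inverse (1 + \<i> * of_real (x\<^sup>2)))) (at x within {0..Y})"
        by (intro has_vector_derivative_mult c d e)
      have B: "(of_real x * cis (x\<^sup>2/2) * (- (2 * \<i> * of_real x) / (1 + \<i> * of_real (x\<^sup>2))\<^sup>2)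
          + (of_real x * (\<i> * of_real x * cis (x\<^sup>2 / 2)) + 1 * cis (x\<^sup>2/2)) * inverse (1 + \<i> * of_real (x\<^sup>2)))
         = cis (x\<^sup>2 / 2) - ?K x"
      proof -
        define z where "z = 1 + \<i> * (of_real (x\<^sup>2) :: complex)"
        define C where "C = cis (x\<^sup>2 / 2)"
        have z: "z \<noteq> 0" using nz by (simp add: z_def)
        have x2: "of_real x * (\<i> * of_real x * C) = (z - 1) * C" "of_real x * C * (2 * \<i> * of_real x) = 2 * (z - 1) * C"
          by (simp_all add: z_def power2_eq_square)
        have K: "?K x = 2 * (z - 1) / z\<^sup>2 * C"
          by (simp add: fresnel_kernel_def z_def C_def)
        have "(of_real x * C * (- (2 * \<i> * of_real x) / z\<^sup>2) + (of_real x * (\<i> * of_real x * C) + 1 * C) * inverse z)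
          = - (of_real x * C * (2 * \<i> * of_real x)) / z\<^sup>2 + (of_real x * (\<i> * of_real x * C) + C) * inverse z"
          by (simp add: algebra_simps)
        also have "\<dots> = C - 2 * (z - 1) / z\<^sup>2 * C"
          unfolding x2 using z by (simp add: field_simps)
        finally show ?thesis unfolding K by (simp only: C_def z_def)
      qed
      show "(?F has_vector_derivative (cis (x\<^sup>2 / 2) - ?K x)) (at x within {0..Y})"
        using A unfolding B by (simp only: divide_inverse)
    qed
    moreover have "integral {0..Y} (\<lambda>y. cis (y\<^sup>2 / 2) - ?K y) = integral {0..Y} (\<lambda>y. cis (y\<^sup>2 / 2)) - integral {0..Y} ?K"
      by (rule Henstock_Kurzweil_Integration.integral_diff; rule integrable_continuous_real) (auto intro!: continuous_fresnel_kernel continuous_intros)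
    ultimately show ?thesis by (simp add: integral_unique algebra_simps)
  qed
  have "((\<lambda>Y. of_real Y * cis (Y\<^sup>2 / 2) / (1 + \<i> * of_real (Y\<^sup>2))) \<longlongrightarrow> 0) at_top"
  proof (rule Lim_null_comparison)
    show "\<forall>\<^sub>F Y in at_top. cmod (of_real Y * cis (Y\<^sup>2 / 2) / (1 + \<i> * of_real (Y\<^sup>2))) \<le> 1 / Y"
      using eventually_gt_at_top[of 0]
    proof eventually_elim
      case (elim Y)
      have "Y\<^sup>2 \<le> cmod (1 + \<i> * of_real (Y\<^sup>2))"
        using abs_Im_le_cmod[of "1 + \<i> * of_real (Y\<^sup>2)"] by (simp del: of_real_power)
      then show ?case using elim by (simp add: norm_divide norm_mult divide_le_eq power2_eq_square del: of_real_mult of_real_power) (simp add: field_simps power2_eq_square)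
    qed
    show "((\<lambda>Y::real. 1 / Y) \<longlongrightarrow> 0) at_top" by real_asymp
  qed
  from tendsto_diff[OF fresnel_limit this]
  have "((\<lambda>Y. integral {0..Y} ?K) \<longlongrightarrow> cis (pi / 4) * of_real (sqrt (pi / 2))) at_top"
    by (rule Lim_transform_eventually[OF tendsto_eq_rhs])
       (auto intro: eventually_mono[OF eventually_ge_at_top[of 0]] simp: FTC)
  moreover have "((\<lambda>Y. integral {0..Y} ?K) \<longlongrightarrow> (LINT y:{0..}|lborel. ?K y)) at_top"
  proof -
    have s: "set_integrable lborel S ?K" if "S \<in> sets borel" for S
      using int that unfolding set_integrable_def by (intro integrable_mult_indicator) auto
    have "(LINT y:{0..Y}|lborel. ?K y) = integral {0..Y} ?K" for Y
      by (intro set_borel_integral_eq_integral s) auto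
    then show ?thesis
      using tendsto_set_lebesgue_integral_at_top[of 0 lborel ?K] s by auto
  qed
  ultimately have "(LINT y:{0..}|lborel. ?K y) = cis (pi / 4) * of_real (sqrt (pi / 2))"
    by (intro tendsto_unique[OF trivial_limit_at_top_linorder])
  then have "has_bochner_integral lborel (\<lambda>y. indicator {0..} y *\<^sub>R ?K y) (cis (pi / 4) * of_real (sqrt (pi / 2)))"
    using int by (auto simp: has_bochner_integral_iff set_lebesgue_integral_def intro!: integrable_mult_indicator)
  then have "has_bochner_integral lborel ?K (2 *\<^sub>R (cis (pi / 4) * of_real (sqrt (pi / 2))))"
    by (rule has_bochner_integral_even_function) (simp add: fresnel_kernel_def)
  moreover have "2 * sqrt (pi / 2) = sqrt (2 * pi)"
    by (rule real_sqrt_unique[symmetric]) (auto simp: power_mult_distrib)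
  then have "2 *\<^sub>R (cis (pi / 4) * of_real (sqrt (pi / 2))) = cis (pi / 4) * of_real (sqrt (2 * pi))"
    by (metis (no_types, lifting) mult_scaleR_right of_real_mult scaleR_conv_of_real)
  ultimately show ?thesis by simp
qed

lemma fresnel_kernel_integral:
  assumes "c > 0"
  shows "has_bochner_integral lborel (fresnel_kernel c) (cis (pi / 4) * of_real (sqrt (2 * pi / c)))"
proof -
  have "has_bochner_integral lborel (\<lambda>y. fresnel_kernel 1 (0 + sqrt c * y))
      ((cis (pi / 4) * of_real (sqrt (2 * pi))) /\<^sub>R \<bar>sqrt c\<bar>)"
    by (rule lborel_has_bochner_integral_real_affine_iff[THEN iffD1, OF _ fresnel_kernel_integral1]) (use assms in simp)
  moreover have "fresnel_kernel 1 (0 + sqrt c * y) = fresnel_kernel c y" for y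
    using assms by (simp add: fresnel_kernel_def power_mult_distrib flip: of_real_power)
  moreover have "(cis (pi / 4) * of_real (sqrt (2 * pi))) /\<^sub>R \<bar>sqrt c\<bar> = cis (pi / 4) * of_real (sqrt (2 * pi / c))"
    unfolding real_sqrt_divide using assms by (simp add: scaleR_conv_of_real field_simps)
  ultimately show ?thesis by simp
qed

lemma sin_diff_mvt:
  fixes x \<theta> A B :: real
  assumes "x \<in> {A..B}" "\<theta> \<in> {A..B}"
  obtains z where "z \<in> {A..B}" "sin x - sin \<theta> = (x - \<theta>) * cos z"
proof -
  consider "x = \<theta>" | "x < \<theta>" | "\<theta> < x" by linarith
  then show ?thesis
  proof cases
    case 1 then show ?thesis using assms that[of x] by simp
  next
    case 2
    from MVT2[OF 2, of sin cos] obtain z where "z > x" "z < \<theta>" "sin \<theta> - sin x = (\<theta> - x) * cos z" by (auto intro: DERIV_sin)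
    then show ?thesis using assms by (intro that[of z]) (auto simp: algebra_simps)
  next
    case 3
    from MVT2[OF 3, of sin cos] obtain z where "z < x" "z > \<theta>" "sin x - sin \<theta> = (x - \<theta>) * cos z" by (auto intro: DERIV_sin)
    then show ?thesis using assms by (intro that[of z]) auto
  qed
qed

section \<open>Rodrigues' formula\<close>

text \<open>\<open>(1 - x)\<^sup>a\<^sup>-\<^sup>j (1 + x)\<^sup>b\<^sup>-\<^sup>j rodrigues a b j\<close> is the \<open>j\<close>-th derivative of \<open>(1 - x)\<^sup>a (1 + x)\<^sup>b\<close>.\<close>

fun rodrigues :: "real \<Rightarrow> real \<Rightarrow> nat \<Rightarrow> real poly" where
  "rodrigues a b 0 = 1"
| "rodrigues a b (Suc j) = [:1, 0, -1:] * pderiv (rodrigues a b j)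
     + [:(b - j) - (a - j), - ((a - j) + (b - j)):] * rodrigues a b j"

lemma coeff_one_minus_square_mult:
  "coeff ([:1, 0, -1:] * r) i = coeff r i - (if i \<ge> 2 then coeff r (i - 2) else 0)" for r :: "'a :: comm_ring_1 poly"
  by (cases i; cases "i - 1") (auto simp: numeral_2_eq_2)

lemma coeff_linear_mult:
  "coeff ([:c, d:] * r) i = c * coeff r i + d * (if i \<ge> 1 then coeff r (i - 1) else 0)" for r :: "'a :: comm_ring_1 poly"
  by (cases i) auto

text \<open>In the step from j to j + 1 the derivative contributes - j to the top coefficient and
  the linear factor - (a + b - 2 j), together - (a + b - j).\<close>

lemma coeff_rodrigues:
  "(\<forall>i>j. coeff (rodrigues a b j) i = 0) \<and> coeff (rodrigues a b j) j = (-1) ^ j * (\<Prod>i<j. a + b - real i)"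
proof (induction j)
  case 0
  then show ?case by (auto simp: coeff_pCons split: nat.splits)
next
  case (Suc j)
  define r where "r = rodrigues a b j"
  have r: "\<forall>i>j. coeff r i = 0" "coeff r j = (-1) ^ j * (\<Prod>i<j. a + b - real i)"
    using Suc by (auto simp: r_def)
  have S: "rodrigues a b (Suc j) = [:1, 0, -1:] * pderiv r
     + [:(b - j) - (a - j), - ((a - j) + (b - j)):] * r" by (simp add: r_def)
  have "coeff (rodrigues a b (Suc j)) i = 0" if "i > Suc j" for i
    using r(1) that unfolding S coeff_add coeff_one_minus_square_mult coeff_linear_mult
    by (auto simp: coeff_pderiv)
  moreover have "coeff (rodrigues a b (Suc j)) (Suc j) = - (a + b - j) * coeff r j"
    using r(1) unfolding S coeff_add coeff_one_minus_square_mult coeff_linear_mult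
    by (cases j) (auto simp: coeff_pderiv algebra_simps)
  ultimately show ?case unfolding r(2) by (simp del: rodrigues.simps add: algebra_simps)
qed

text \<open>Integration by parts j times: each step lowers both exponents of the weight by one and
  puts one derivative on p. Since j \<le> n, the exponents stay above -1 and the boundary terms
  vanish.\<close>

lemma jacobi_moment_rodrigues:
  assumes "j \<le> n" "\<alpha> > -1" "\<beta> > -1"
  shows "jacobi_moment (n + \<alpha> - j) (n + \<beta> - j) (rodrigues (n + \<alpha>) (n + \<beta>) j * p) = (-1) ^ j * jacobi_moment (n + \<alpha>) (n + \<beta>) ((pderiv ^^ j) p)"
  using assms(1)
proof (induction j arbitrary: p)
  case 0
  then show ?case by simp
next
  case (Suc j)
  define a b where "a = n + \<alpha> - Suc j" and "b = n + \<beta> - Suc j"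
  have ab: "a > -1" "b > -1" using Suc.prems assms(2,3) unfolding a_def b_def
    by (smt (verit) of_nat_mono)+
  have ab1: "a + 1 = n + \<alpha> - j" "b + 1 = n + \<beta> - j" by (simp_all add: a_def b_def)
  define r where "r = rodrigues (n + \<alpha>) (n + \<beta>) j"
  have "rodrigues (n + \<alpha>) (n + \<beta>) (Suc j) = [:1, 0, -1:] * pderiv r + [:b - a, - (a + b + 2):] * r"
    by (simp add: r_def a_def b_def del: mult_pCons_left)
  then have "rodrigues (n + \<alpha>) (n + \<beta>) (Suc j) * p =
    ([:1, 0, -1:] * pderiv (r * p) + [:b - a, - (a + b + 2):] * (r * p)) - [:1, 0, -1:] * (r * pderiv p)"
    by (simp add: pderiv_mult algebra_simps del: mult_pCons_left mult_pCons_right)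
  then have "jacobi_moment a b (rodrigues (n + \<alpha>) (n + \<beta>) (Suc j) * p) = - jacobi_moment (a + 1) (b + 1) (r * pderiv p)"
    using jacobi_moment_ibp[OF ab, of "r * p"] jacobi_moment_shift[OF ab] by (simp add: jacobi_moment_diff[OF ab])
  also have "\<dots> = (-1) ^ Suc j * jacobi_moment (n + \<alpha>) (n + \<beta>) ((pderiv ^^ Suc j) p)"
    using Suc unfolding ab1 r_def by (simp add: funpow_swap1)
  finally show ?case unfolding a_def b_def .
qed

context jacobi_polys
begin

text \<open>Rodrigues' formula with its constant. The polynomial q is orthogonal to all lower
  degrees, since n derivatives annihilate them, and is therefore a multiple \<rho> of
  \<open>G n\<close>. The multiple is found from the top coefficient and from the moment against
  \<open>G n\<close>.\<close>

lemma jacobi_value_0: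
  defines "\<Lambda> n \<equiv> \<Prod>i<n. (n + \<alpha>) + (n + \<beta>) - real i"
  defines "B n \<equiv> jacobi_moment (n + \<alpha>) (n + \<beta>) 1"
  shows "poly (G n) 0 = (-1) ^ n * poly (rodrigues (n + \<alpha>) (n + \<beta>) n) 0 / sqrt (k * fact n * \<Lambda> n * B n)"
proof -
  define q where "q = rodrigues (n + \<alpha>) (n + \<beta>) n"
  define \<kappa> where "\<kappa> = coeff (G n) n"
  have \<kappa>: "\<kappa> > 0" unfolding \<kappa>_def by (rule lc)
  have qc: "\<forall>i>n. coeff q i = 0" "coeff q n = (-1) ^ n * \<Lambda> n"
    using coeff_rodrigues[of n "n + \<alpha>" "n + \<beta>"] unfolding q_def \<Lambda>_def by auto
  have nab: "n + \<alpha> > -1" "n + \<beta> > -1" using ab by auto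
  have Bpos: "B n > 0"
  proof -
    have "Gamma (n + \<alpha> + 1) > 0" "Gamma (n + \<beta> + 1) > 0" "Gamma (n + \<alpha> + 1 + (n + \<beta> + 1)) > 0"
      using ab by (auto intro!: Gamma_real_pos)
    then show ?thesis unfolding B_def jacobi_moment_1[OF nab] Beta_def by (auto intro!: mult_pos_pos divide_pos_pos)
  qed
  have qj: "jacobi_moment \<alpha> \<beta> (q * p) = (-1) ^ n * jacobi_moment (n + \<alpha>) (n + \<beta>) ((pderiv ^^ n) p)" for p
    using jacobi_moment_rodrigues[of n n \<alpha> \<beta> p] ab by (simp add: q_def)
  have small: "jacobi_moment \<alpha> \<beta> (q * G m) = 0" if "m < n" for m
  proof -
    have "(pderiv ^^ n) (G m) = 0"
      using that by (intro poly_eqI) (simp add: coeff_higher_pderiv coeff_eq_0 deg)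
    then show ?thesis unfolding qj by (simp add: jacobi_moment_def)
  qed
  have top: "jacobi_moment \<alpha> \<beta> (q * G n) = (-1) ^ n * fact n * \<kappa> * B n"
  proof -
    have "(pderiv ^^ n) (G n) = smult (fact n * \<kappa>) 1"
    proof (rule poly_eqI)
      fix i
      show "coeff ((pderiv ^^ n) (G n)) i = coeff (smult (fact n * \<kappa>) 1) i"
        by (cases i) (auto simp: coeff_higher_pderiv coeff_eq_0 deg \<kappa>_def pochhammer_fact)
    qed
    then show ?thesis unfolding qj B_def by (simp only: jacobi_moment_smult[OF nab] mult_ac)
  qed
  define \<rho> where "\<rho> = coeff q n / \<kappa>"
  have "q - smult \<rho> (G n) = 0"
  proof (rule orth_zero[of n])
    show "\<forall>i\<ge>n. coeff (q - smult \<rho> (G n)) i = 0"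
    proof safe
      fix i assume "i \<ge> n"
      show "coeff (q - smult \<rho> (G n)) i = 0"
        using qc \<kappa> deg[of n] \<open>i \<ge> n\<close> by (cases "i = n") (auto simp: \<rho>_def \<kappa>_def coeff_eq_0)
    qed
    fix m assume "m < n"
    then show "jacobi_moment \<alpha> \<beta> ((q - smult \<rho> (G n)) * G m) = 0"
      using small[of m] orth[of n m] k by (simp add: left_diff_distrib jacobi_moment_diff[OF ab] jacobi_moment_smult[OF ab])
  qed
  then have q: "q = smult \<rho> (G n)" by simp
  have "k * jacobi_moment \<alpha> \<beta> (q * G n) = \<rho>"
    unfolding q using orth[of n n] by (simp add: jacobi_moment_smult[OF ab])
  then have \<rho>1: "\<rho> = (-1) ^ n * (k * fact n * \<kappa> * B n)" unfolding top by (simp add: mult_ac)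
  have \<rho>2: "\<rho> * \<kappa> = (-1) ^ n * \<Lambda> n" using \<kappa> qc by (simp add: \<rho>_def)
  \<comment> \<open>Both equations for \<rho> contain the unknown leading coefficient \<kappa> of
    \<open>G n\<close>, one as a factor and the other as a divisor. Multiplying them eliminates it
    and leaves s^2.\<close>
  define s where "s = k * fact n * \<kappa> * B n"
  have spos: "s > 0" unfolding s_def using k \<kappa> Bpos by simp
  have \<rho>s: "\<rho> = (-1) ^ n * s" using \<rho>1 by (simp add: s_def)
  then have "s * \<kappa> = \<Lambda> n" using \<rho>2 by simp
  then have "s\<^sup>2 = k * fact n * \<Lambda> n * B n"
    unfolding s_def power2_eq_square by (simp add: algebra_simps)
  then have "sqrt (k * fact n * \<Lambda> n * B n) = s"
    using spos by (intro real_sqrt_unique) auto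
  then have "(-1) ^ n * poly q 0 / sqrt (k * fact n * \<Lambda> n * B n) = (-1) ^ n * (\<rho> * poly (G n) 0) / s"
    by (simp add: q)
  also have "\<dots> = ((-1) ^ n * (-1) ^ n) * (s * poly (G n) 0) / s" unfolding \<rho>s by (simp only: mult_ac)
  also have "\<dots> = poly (G n) 0" using spos by (simp flip: power_mult_distrib)
  finally show ?thesis unfolding q_def by simp
qed

end

section \<open>The values at the origin as integrals over the unit circle\<close>

lemma higher_deriv_rodrigues:
  fixes a b :: real and z :: complex
  assumes "z \<in> ball 0 1"
  shows "(deriv ^^ j) (\<lambda>z. (1 - z) powr of_real a * (1 + z) powr of_real b) z
    = (1 - z) powr of_real (a - j) * (1 + z) powr of_real (b - j) * poly (map_poly of_real (rodrigues a b j)) z"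
  using assms
proof (induction j arbitrary: z)
  case 0
  then show ?case by simp
next
  case (Suc j)
  define r where "r = map_poly complex_of_real (rodrigues a b j)"
  have r': "map_poly complex_of_real (rodrigues a b (Suc j)) = [:1, 0, -1:] * pderiv r
     + [:of_real ((b - j) - (a - j)), - of_real ((a - j) + (b - j)):] * r"
  proof (rule poly_eqI)
    fix i
    have cr: "coeff r m = of_real (coeff (rodrigues a b j) m)" for m by (simp add: r_def coeff_map_poly)
    have "coeff (map_poly complex_of_real (rodrigues a b (Suc j))) i = of_real (coeff (rodrigues a b (Suc j)) i)"
      by (simp add: coeff_map_poly del: rodrigues.simps)
    also have "\<dots> = coeff ([:1, 0, -1:] * pderiv r
     + [:of_real ((b - j) - (a - j)), - of_real ((a - j) + (b - j)):] * r) i"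
      unfolding rodrigues.simps coeff_add coeff_one_minus_square_mult coeff_linear_mult coeff_pderiv cr by simp
    finally show "coeff (map_poly complex_of_real (rodrigues a b (Suc j))) i = coeff ([:1, 0, -1:] * pderiv r
     + [:of_real ((b - j) - (a - j)), - of_real ((a - j) + (b - j)):] * r) i" .
  qed
  let ?g = "\<lambda>z. (1 - z) powr of_real (a - j) * (1 + z) powr of_real (b - j) * poly r z"
  \<comment> \<open>On the unit disc 1 - z and 1 + z lie in the right half-plane, off the branch cut
    of the principal power.\<close>
  have np: "1 - z \<notin> \<real>\<^sub>\<le>\<^sub>0" "1 + z \<notin> \<real>\<^sub>\<le>\<^sub>0"
  proof -
    have "\<bar>Re z\<bar> < 1" using Suc.prems abs_Re_le_cmod[of z] by simp
    then have "Re (1 - z) > 0" "Re (1 + z) > 0" by auto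
    then show "1 - z \<notin> \<real>\<^sub>\<le>\<^sub>0" "1 + z \<notin> \<real>\<^sub>\<le>\<^sub>0"
      by (auto simp: complex_nonpos_Reals_iff simp del: minus_complex.simps plus_complex.simps)
  qed
  \<comment> \<open>Both powers are written over the exponents of stage j + 1. Then U V factors out
    of the derivative, and what remains is the recursion of \<open>rodrigues\<close>.\<close>
  have pw: "w powr of_real (c - j) = w * w powr of_real (c - Suc j)" for w :: complex and c :: real
  proof -
    have "complex_of_real (c - j) = of_real (c - Suc j) + 1" by simp
    then show ?thesis by (simp only: powr_add powr_to_1 mult.commute)
  qed
  define U V where "U = (1 - z) powr of_real (a - Suc j)" and "V = (1 + z) powr of_real (b - Suc j)"
  have dU: "((\<lambda>z. (1 - z) powr of_real (a - j)) has_field_derivative (of_real (a - j) * U * -1)) (at z)"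
  proof -
    have "((\<lambda>w. w powr of_real (a - j)) has_field_derivative (of_real (a - j) * U)) (at (1 - z))"
      using has_field_derivative_powr[OF np(1), of "of_real (a - j)"] by (simp add: U_def algebra_simps)
    moreover have "((\<lambda>z. 1 - z) has_field_derivative -1) (at z)" by (auto intro!: derivative_eq_intros)
    ultimately show ?thesis by (rule DERIV_chain'[rotated])
  qed
  have dV: "((\<lambda>z. (1 + z) powr of_real (b - j)) has_field_derivative (of_real (b - j) * V * 1)) (at z)"
  proof -
    have "((\<lambda>w. w powr of_real (b - j)) has_field_derivative (of_real (b - j) * V)) (at (1 + z))"
      using has_field_derivative_powr[OF np(2), of "of_real (b - j)"] by (simp add: V_def algebra_simps)
    moreover have "((\<lambda>z. 1 + z) has_field_derivative 1) (at z)" by (auto intro!: derivative_eq_intros)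
    ultimately show ?thesis by (rule DERIV_chain'[rotated])
  qed
  have g: "(?g has_field_derivative ((((1 - z) * U) * (of_real (b - j) * V * 1) + (of_real (a - j) * U * -1) * ((1 + z) * V)) * poly r z
       + poly (pderiv r) z * (((1 - z) * U) * ((1 + z) * V)))) (at z)"
    using DERIV_mult'[OF DERIV_mult'[OF dU dV] poly_DERIV[of r z]]
    unfolding pw[of "1 - z" a] pw[of "1 + z" b] by (simp add: U_def V_def algebra_simps)
  have "(((1 - z) * U) * (of_real (b - j) * V * 1) + (of_real (a - j) * U * -1) * ((1 + z) * V)) * poly r z
       + poly (pderiv r) z * (((1 - z) * U) * ((1 + z) * V))
      = U * V * poly (map_poly of_real (rodrigues a b (Suc j))) z"
    unfolding r' by (simp add: algebra_simps)
  note g = g[unfolded this]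
  from g
  have "((deriv ^^ j) (\<lambda>z. (1 - z) powr of_real a * (1 + z) powr of_real b) has_field_derivative
      U * V * poly (map_poly of_real (rodrigues a b (Suc j))) z) (at z)"
    by (rule has_field_derivative_transform_within_open[OF _ open_ball Suc.prems])
       (simp add: Suc.IH r_def U_def V_def)
  then show ?case by (simp add: DERIV_imp_deriv U_def V_def)
qed

text \<open>For 0 < t < pi this is (1 - e^(it))^\<alpha> (1 + e^(it))^\<beta> in polar form, with
  principal powers.\<close>

definition jacobi_amp :: "real \<Rightarrow> real \<Rightarrow> real \<Rightarrow> complex" where
  "jacobi_amp \<alpha> \<beta> t = of_real ((2 * sin (t / 2)) powr \<alpha> * (2 * cos (t / 2)) powr \<beta>) * cis (\<alpha> * ((t - pi) / 2) + \<beta> * (t / 2))"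

lemma powr_polar:
  assumes "r > 0" "- pi < t" "t \<le> pi"
  shows "(of_real r * cis t) powr (of_real a :: complex) = of_real (r powr a) * cis (a * t)"
proof -
  have "of_real r * cis t = exp (of_real (ln r) + \<i> * of_real t)"
    using assms by (simp add: exp_add cis_conv_exp exp_of_real)
  moreover have "Ln (exp (of_real (ln r) + \<i> * of_real t)) = of_real (ln r) + \<i> * of_real t"
    using assms by (intro Ln_exp) auto
  ultimately have L: "Ln (of_real r * cis t) = of_real (ln r) + \<i> * of_real t" by simp
  have "of_real r * cis t \<noteq> 0" using assms by simp
  then have "(of_real r * cis t) powr (of_real a :: complex) = exp (of_real a * (of_real (ln r) + \<i> * of_real t))"
    by (simp add: powr_def L)
  also have "\<dots> = of_real (exp (a * ln r)) * cis (a * t)"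
    by (simp add: distrib_left exp_add cis_conv_exp mult_ac flip: exp_of_real)
  finally show ?thesis using assms by (simp add: powr_def)
qed

lemma one_minus_cis: "1 - cis t = of_real (2 * sin (t / 2)) * cis ((t - pi) / 2)"
proof -
  have "cis ((t - pi) / 2) = cis (t / 2) * cis (- (pi / 2))"
    by (simp only: cis_mult) (simp add: diff_divide_distrib)
  also have "cis (- (pi / 2)) = - \<i>" by (simp add: complex_eq_iff)
  finally show ?thesis
    using cos_double_sin[of "t / 2"] sin_double[of "t / 2"] by (simp add: complex_eq_iff power2_eq_square)
qed

lemma one_plus_cis: "1 + cis t = of_real (2 * cos (t / 2)) * cis (t / 2)"
  using cos_double_cos[of "t / 2"] sin_double[of "t / 2"] by (simp add: complex_eq_iff power2_eq_square)

text \<open>The half-angle moduli multiply to (2 sin t)^n, and the phases n (t - pi)/2 + n t/2 - n t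
  add up to the constant - n pi/2. At the end points, where the polar form fails, both sides are 0;
  for the right-hand side this uses n \<ge> 1.\<close>

lemma unit_circle_jacobi:
  assumes "n \<ge> 1" "\<alpha> > -1" "\<beta> > -1" "t \<in> {0..pi}"
  shows "(1 - cis t) powr of_real (n + \<alpha>) * (1 + cis t) powr of_real (n + \<beta>) * cis (- (real n * t))
    = 2 ^ n * cis (- (real n * pi / 2)) * (of_real (sin t ^ n) * jacobi_amp \<alpha> \<beta> t)"
proof -
  consider "t = 0" | "t = pi" | "0 < t" "t < pi" using assms(4) by fastforce
  then show ?thesis
  proof cases
    case 1
    then show ?thesis using assms by (simp add: zero_power)
  next
    case 2
    then show ?thesis using assms by (simp add: zero_power)
  next
    case 3
    have s: "2 * sin (t / 2) > 0" and c: "2 * cos (t / 2) > 0"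
      using 3 by (auto intro!: sin_gt_zero cos_gt_zero_pi)
    have 1: "(1 - cis t) powr of_real (n + \<alpha>) = of_real ((2 * sin (t / 2)) powr (n + \<alpha>)) * cis ((n + \<alpha>) * ((t - pi) / 2))"
      unfolding one_minus_cis by (rule powr_polar[OF s]) (use 3 in auto)
    have 2: "(1 + cis t) powr of_real (n + \<beta>) = of_real ((2 * cos (t / 2)) powr (n + \<beta>)) * cis ((n + \<beta>) * (t / 2))"
      unfolding one_plus_cis by (rule powr_polar[OF c]) (use 3 in auto)
    have p: "(2 * sin (t / 2)) powr (n + \<alpha>) = (2 * sin (t / 2)) ^ n * (2 * sin (t / 2)) powr \<alpha>"
      "(2 * cos (t / 2)) powr (n + \<beta>) = (2 * cos (t / 2)) ^ n * (2 * cos (t / 2)) powr \<beta>"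
      using s c by (simp_all add: powr_add powr_realpow)
    have "(2 * sin (t / 2)) ^ n * (2 * cos (t / 2)) ^ n = (2 * (2 * sin (t / 2) * cos (t / 2))) ^ n"
      by (simp only: power_mult_distrib[symmetric]) (simp add: mult_ac)
    also have "2 * sin (t / 2) * cos (t / 2) = sin t" using sin_double[of "t / 2"] by simp
    finally have sc: "(2 * sin (t / 2)) ^ n * (2 * cos (t / 2)) ^ n = 2 ^ n * sin t ^ n" by (simp add: power_mult_distrib)
    have ph: "cis ((n + \<alpha>) * ((t - pi) / 2)) * cis ((n + \<beta>) * (t / 2)) * cis (- (real n * t))
        = cis (- (real n * pi / 2)) * cis (\<alpha> * ((t - pi) / 2) + \<beta> * (t / 2))"
      by (simp add: cis_mult field_simps)
    have "(1 - cis t) powr of_real (n + \<alpha>) * (1 + cis t) powr of_real (n + \<beta>) * cis (- (real n * t))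
      = of_real (((2 * sin (t / 2)) ^ n * (2 * cos (t / 2)) ^ n) * ((2 * sin (t / 2)) powr \<alpha> * (2 * cos (t / 2)) powr \<beta>)) *
        (cis ((n + \<alpha>) * ((t - pi) / 2)) * cis ((n + \<beta>) * (t / 2)) * cis (- (real n * t)))"
      unfolding 1 2 p by (simp only: of_real_mult mult_ac)
    also have "\<dots> = 2 ^ n * cis (- (real n * pi / 2)) * (of_real (sin t ^ n) * jacobi_amp \<alpha> \<beta> t)"
      unfolding sc ph jacobi_amp_def by (simp add: mult_ac)
    finally show ?thesis .
  qed
qed

text \<open>Cauchy's formula for the n-th derivative at 0, on a contour through the branch points
  \<plusminus>1. This is admissible because n + \<alpha> and n + \<beta> are positive, so F is
  continuous up to the boundary of the disc.\<close>

lemma rodrigues_integral: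
  assumes n: "n \<ge> 1" and ab: "\<alpha> > -1" "\<beta> > -1"
  shows "poly (rodrigues (n + \<alpha>) (n + \<beta>) n) 0 =
    fact n * 2 ^ n / pi * Re (cis (- (real n * pi / 2)) * integral {0..pi} (\<lambda>t. of_real (sin t ^ n) * jacobi_amp \<alpha> \<beta> t))"
proof -
  define F where "F z = (1 - z) powr of_real (n + \<alpha>) * (1 + z) powr of_real (n + \<beta>)" for z :: complex
  define R where "R = poly (rodrigues (n + \<alpha>) (n + \<beta>) n) 0"
  have pos: "real n + \<alpha> > 0" "real n + \<beta> > 0" using n ab by linarith+
  have "continuous_on (cball 0 1) F"
    unfolding F_def
  proof (intro continuous_on_mult continuous_on_powr_complex continuous_intros)
    show "cball 0 1 \<subseteq> {z. 0 \<le> Re (1 - z) \<or> Im (1 - z) \<noteq> 0}" "cball 0 1 \<subseteq> {z. 0 \<le> Re (1 + z) \<or> Im (1 + z) \<noteq> 0}"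
      using abs_Re_le_cmod by (auto simp: abs_le_iff) (smt (verit) abs_Re_le_cmod)+
  qed (use pos in auto)
  moreover have "F holomorphic_on ball 0 1"
unfolding F_def
  proof (intro holomorphic_intros)
    fix z :: complex assume z: "z \<in> ball 0 1"
    have "\<bar>Re z\<bar> < 1" using z abs_Re_le_cmod[of z] by simp
    then show "1 - z \<notin> \<real>\<^sub>\<le>\<^sub>0" "1 + z \<notin> \<real>\<^sub>\<le>\<^sub>0" by (auto simp: complex_nonpos_Reals_iff)
  qed
  ultimately have "((\<lambda>u. F u / (u - 0) ^ Suc n) has_contour_integral (of_real (2 * pi) * \<i> / fact n * (deriv ^^ n) F 0)) (circlepath 0 1)"
    by (intro Cauchy_has_contour_integral_higher_derivative_circlepath) auto
  moreover have "(deriv ^^ n) F 0 = of_real R"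
    unfolding F_def using higher_deriv_rodrigues[of 0 n "n + \<alpha>" "n + \<beta>"] by (simp add: R_def poly_0_coeff_0 coeff_map_poly)
  ultimately have "((\<lambda>t. F (0 + of_real 1 * cis t) / (0 + of_real 1 * cis t - 0) ^ Suc n * of_real 1 * \<i> * cis t)
      has_integral (of_real (2 * pi) * \<i> / fact n * of_real R)) {0..2 * pi}"
    unfolding circlepath_def by (subst (asm) has_contour_integral_part_circlepath_iff) auto
  from has_integral_mult_right[OF this, of "- \<i>"]
  have "((\<lambda>t. - \<i> * (F (0 + of_real 1 * cis t) / (0 + of_real 1 * cis t - 0) ^ Suc n * of_real 1 * \<i> * cis t))
      has_integral (- \<i> * (of_real (2 * pi) * \<i> / fact n * of_real R))) {0..2 * pi}" .
  moreover have "- \<i> * (of_real (2 * pi) * \<i> / fact n * of_real R) = of_real (2 * pi / fact n * R)"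
    by (simp add: field_simps)
  moreover have "- \<i> * (F (0 + of_real 1 * cis t) / (0 + of_real 1 * cis t - 0) ^ Suc n * of_real 1 * \<i> * cis t)
      = F (cis t) * cis (- (real n * t))" for t
  proof -
    have "cis t \<noteq> 0" by simp
    then have "- \<i> * (F (cis t) / (cis t) ^ Suc n * \<i> * cis t) = F (cis t) * inverse (cis t ^ n)"
      by (simp add: field_simps)
    also have "inverse (cis t ^ n) = cis (- (real n * t))"
      by (simp add: Complex.DeMoivre)
    finally show ?thesis by simp
  qed
  ultimately have FI: "((\<lambda>t. F (cis t) * cis (- (real n * t))) has_integral of_real (2 * pi / fact n * R)) {0..2 * pi}"
    by (simp only:)
  then have hh: "((\<lambda>t. Re (F (cis t) * cis (- (real n * t)))) has_integral (2 * pi / fact n * R)) {0..2 * pi}"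
    using has_integral_Re[OF FI] by (simp only: Re_complex_of_real)
  define h where "h t = Re (F (cis t) * cis (- (real n * t)))" for t
  note hh = hh[folded h_def]
  \<comment> \<open>The parameters are real, so F commutes with conjugation, and the real part of
    the integrand takes the same values on the lower half of the circle as on the upper
    half.\<close>
  have sym: "h (2 * pi - t) = h t" for t
  proof -
    have c: "cis (2 * pi - t) = cnj (cis t)" by (simp add: complex_eq_iff)
    have "F (cnj z) = cnj (F z)" if "z = cis t" for z
    proof -
      have "Re z \<le> 1" "Re z \<ge> - 1" using that by auto
      then have "Re (1 - z) \<ge> 0" "Re (1 + z) \<ge> 0" by simp_all
      then show ?thesis unfolding F_def by (simp add: cnj_powr)
    qed
    then have "F (cis (2 * pi - t)) = cnj (F (cis t))" unfolding c by simp
    moreover have "cis (- (real n * (2 * pi - t))) = cnj (cis (- (real n * t)))"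
    proof -
      have "cis (- (real n * (2 * pi - t))) = cis (real n * t) * cis (- (2 * pi * real n))"
        by (simp add: cis_mult algebra_simps)
      also have "cis (- (2 * pi * real n)) = 1" using cis_multiple_2pi[of "- real n"] by simp
      finally show ?thesis by (simp add: cis_cnj)
    qed
    ultimately show ?thesis unfolding h_def by (simp flip: complex_cnj_mult)
  qed
  have i: "h integrable_on {0..2 * pi}" using hh by auto
  have i1: "h integrable_on {0..pi}" by (rule integrable_on_subinterval[OF i]) auto
  have im: "(\<lambda>x. (1 / - 1) *\<^sub>R x + - ((1 / - 1) *\<^sub>R (2 * pi))) ` {0..pi} = {pi..2 * pi}"
  proof -
    have "x \<in> (\<lambda>x. 2 * pi - x) ` {0..pi}" if "x \<in> {pi..2*pi}" for x
      by (rule image_eqI[of _ _ "2 * pi - x"]) (use that in auto)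
    then show ?thesis by auto
  qed
  have "((\<lambda>x. h (- 1 *\<^sub>R x + 2 * pi)) has_integral (1 / \<bar>- 1\<bar> ^ DIM(real)) *\<^sub>R integral {0..pi} h) {pi..2 * pi}"
    unfolding im[symmetric] using has_integral_affinity[of h "integral {0..pi} h" 0 pi "-1" "2 * pi"] i1 by (simp add: has_integral_integral)
  then have i2: "(h has_integral integral {0..pi} h) {pi..2 * pi}"
    by (simp add: sym add.commute)
  have "2 * pi / fact n * R = integral {0..2 * pi} h" using hh by (simp add: integral_unique)
  also have "\<dots> = integral {0..pi} h + integral {pi..2 * pi} h"
    using i by (intro Henstock_Kurzweil_Integration.integral_combine[symmetric]) auto
  also have "\<dots> = 2 * integral {0..pi} h" using i2 by (simp add: integral_unique)
  finally have R: "R = fact n / pi * integral {0..pi} h" by (simp add: field_simps)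
  have eq: "F (cis t) * cis (- (real n * t)) = 2 ^ n * cis (- (real n * pi / 2)) * (of_real (sin t ^ n) * jacobi_amp \<alpha> \<beta> t)" if "t \<in> {0..pi}" for t
    unfolding F_def by (rule unit_circle_jacobi[OF n ab that])
  have "(\<lambda>t. F (cis t) * cis (- (real n * t))) integrable_on {0..pi}"
    by (rule integrable_on_subinterval[of _ "{0..2 * pi}"]) (use FI in auto)
  then have "integral {0..pi} h = Re (integral {0..pi} (\<lambda>t. F (cis t) * cis (- (real n * t))))"
    unfolding h_def by (intro integral_unique has_integral_Re integrable_integral)
  also have "integral {0..pi} (\<lambda>t. F (cis t) * cis (- (real n * t))) = integral {0..pi} (\<lambda>t. 2 ^ n * cis (- (real n * pi / 2)) * (of_real (sin t ^ n) * jacobi_amp \<alpha> \<beta> t))"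
    by (rule Henstock_Kurzweil_Integration.integral_cong) (rule eq)
  also have "\<dots> = of_real (2 ^ n) * (cis (- (real n * pi / 2)) * integral {0..pi} (\<lambda>t. of_real (sin t ^ n) * jacobi_amp \<alpha> \<beta> t))"
    by (simp only: integral_mult_right mult.assoc of_real_power of_real_numeral)
  also have "Re \<dots> = 2 ^ n * Re (cis (- (real n * pi / 2)) * integral {0..pi} (\<lambda>t. of_real (sin t ^ n) * jacobi_amp \<alpha> \<beta> t))"
  proof -
    have "Re (of_real r * z) = r * Re z" for r z by simp
    then show ?thesis .
  qed
  finally show ?thesis unfolding R_def[symmetric] R by simp
qed

section \<open>Gamma quotients and Laplace's method for powers of the sine\<close>

lemma gamma_ratio_limit:
  fixes x :: real
  assumes "x > -1"
  shows "(\<lambda>n. Gamma (real n + x + 1) / (fact n * real n powr x)) \<longlonglongrightarrow> 1"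
proof -
  have x: "x + 1 > 0" using assms by simp
  then have nz: "x + 1 \<notin> \<int>\<^sub>\<le>\<^sub>0" by auto
  have G: "Gamma (x + 1) > 0" using x by (rule Gamma_real_pos)
  \<comment> \<open>The Pochhammer symbol in Euler's limit has n + 1 factors; the quotient (n + x +
    1) / n removes the last of them together with one power of n.\<close>
  have "(\<lambda>n. Gamma_series (x + 1) n / Gamma (x + 1) * ((real n + x + 1) / real n)) \<longlonglongrightarrow> Gamma (x + 1) / Gamma (x + 1) * 1"
  proof (intro tendsto_intros Gamma_series_LIMSEQ)
    show "(\<lambda>n. (real n + x + 1) / real n) \<longlonglongrightarrow> 1" by real_asymp
  qed (use G in auto)
  then have "(\<lambda>n. inverse (Gamma_series (x + 1) n / Gamma (x + 1) * ((real n + x + 1) / real n))) \<longlonglongrightarrow> inverse 1"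
    using G by (intro tendsto_inverse) auto
  then have "(\<lambda>n. inverse (Gamma_series (x + 1) n / Gamma (x + 1) * ((real n + x + 1) / real n))) \<longlonglongrightarrow> 1" by simp
  then show ?thesis
  proof (rule Lim_transform_eventually)
    show "\<forall>\<^sub>F n in sequentially. inverse (Gamma_series (x + 1) n / Gamma (x + 1) * ((real n + x + 1) / real n)) = Gamma (real n + x + 1) / (fact n * real n powr x)"
      using eventually_gt_at_top[of "0::nat"]
    proof eventually_elim
      case (elim n)
      have "pochhammer (x + 1) (n + 1) = Gamma (x + 1 + real (n + 1)) / Gamma (x + 1)"
        by (rule pochhammer_Gamma[OF nz])
      also have "x + 1 + real (n + 1) = (real n + x + 1) + 1" by simp
      also have "Gamma ((real n + x + 1) + 1) = (real n + x + 1) * Gamma (real n + x + 1)"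
        using x by (intro Gamma_plus1) auto
      finally have P: "pochhammer (x + 1) (n + 1) = (real n + x + 1) * Gamma (real n + x + 1) / Gamma (x + 1)" .
      have "exp ((x + 1) * of_real (ln (real n))) = real n * real n powr x"
        using elim by (simp add: distrib_right exp_add powr_def mult.commute)
      then have "Gamma_series (x + 1) n = fact n * (real n * real n powr x) * Gamma (x + 1) / ((real n + x + 1) * Gamma (real n + x + 1))"
        unfolding Gamma_series_def P by simp
      moreover have "Gamma (real n + x + 1) > 0" "real n + x + 1 > 0" using x by (auto intro!: Gamma_real_pos)
      moreover have "inverse (f * (m * p) * g / (s * h) / g * (s / m)) = h / (f * p)"
        if "f > 0" "m > 0" "p > 0" "g > 0" "s > 0" "h > 0" for f m p g s h :: real
        using that by (simp add: field_simps)
      ultimately show ?case using G elim by simp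
    qed
  qed
qed

text \<open>Jordan's inequality for the half angle in cos x = 1 - 2 sin^2(x/2). Its m-th power
  bounds cos(y / sqrt m)^m by a Gaussian in y, independently of m.\<close>

lemma cos_le_quadratic:
  fixes x :: real
  assumes "\<bar>x\<bar> \<le> pi / 2"
  shows "cos x \<le> exp (- (2 * x\<^sup>2 / pi\<^sup>2))"
proof -
  have "2 * (\<bar>x\<bar> / 2) / pi \<le> sin (\<bar>x\<bar> / 2)" using assms by (intro jordan_sine) auto
  then have "(\<bar>x\<bar> / pi)\<^sup>2 \<le> (sin (\<bar>x\<bar> / 2))\<^sup>2" by (intro power_mono) auto
  moreover have "cos x = 1 - 2 * (sin (\<bar>x\<bar> / 2))\<^sup>2"
    using cos_double_sin[of "\<bar>x\<bar> / 2"] by simp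
  ultimately have "cos x \<le> 1 + (- (2 * x\<^sup>2 / pi\<^sup>2))" by (simp add: power_divide)
  also have "\<dots> \<le> exp (- (2 * x\<^sup>2 / pi\<^sup>2))" by (rule exp_ge_add_one_self)
  finally show ?thesis .
qed

text \<open>Laplace's method at the maximum pi/2 of the sine, after rescaling t = pi/2 + y / sqrt n.
  The boundedness assumption concerns sin t f(t) because for negative \<alpha> or \<beta> the
  intended amplitude is unbounded at the end points.\<close>

lemma laplace_sin:
  fixes f :: "real \<Rightarrow> complex"
  assumes fc: "continuous_on {0<..<pi} f"
    and bound: "\<And>t. t \<in> {0<..<pi} \<Longrightarrow> cmod (of_real (sin t) * f t) \<le> C"
  shows "(\<lambda>n. of_real (sqrt (real n)) * integral {0..pi} (\<lambda>t. of_real (sin t ^ n) * f t)) \<longlonglongrightarrow> of_real (sqrt (2 * pi)) * f (pi / 2)"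
proof -
  \<comment> \<open>One of the sine factors is spent on making the amplitude bounded.\<close>
  define B where "B t = of_real (sin t) * f t" for t
  have C0: "C \<ge> 0" using order_trans[OF norm_ge_zero bound[of "pi / 2"]] by simp
  \<comment> \<open>The scale matches the exponent Suc j that is left after one sine went into B.
    The mismatch with the full exponent Suc (Suc j) is repaired at the end by a quotient of square
    roots tending to 1.\<close>
  define R where "R j = sqrt (real (Suc j))" for j
  have Rpos: "R j > 0" for j by (simp add: R_def)
  define S where "S j y = pi / 2 + (1 / R j) * y" for j y
  define K where "K j y = indicator {0<..<pi} (S j y) *\<^sub>R (of_real (sin (S j y) ^ Suc j) * B (S j y))" for j y
  have mB: "(\<lambda>t. indicator {0<..<pi} t *\<^sub>R (of_real (sin t ^ m) * B t)) \<in> borel_measurable borel" for m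
    by (rule borel_measurable_continuous_on_indicator) (auto simp: B_def intro!: continuous_intros fc)
  have int: "of_real (R j) * integral {0..pi} (\<lambda>t. of_real (sin t ^ Suc (Suc j)) * f t) = (LINT y|lborel. K j y)" for j
  proof -
    have si: "set_integrable lborel {0<..<pi} (\<lambda>t. of_real (sin t ^ Suc j) * B t)"
      unfolding set_integrable_def
    proof (rule Bochner_Integration.integrable_bound)
      show "integrable lborel (\<lambda>t::real. indicator {0<..<pi} t *\<^sub>R C)"
        by (intro integrable_scaleR_left integrable_real_indicator) (auto simp: emeasure_lborel_Ioo)
      show "AE t in lborel. norm (indicator {0<..<pi} t *\<^sub>R (of_real (sin t ^ Suc j) * B t)) \<le> norm (indicator {0<..<pi} t *\<^sub>R C)"
      proof (rule AE_I2)
        fix t :: real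
        show "norm (indicator {0<..<pi} t *\<^sub>R (of_real (sin t ^ Suc j) * B t)) \<le> norm (indicator {0<..<pi} t *\<^sub>R C)"
        proof (cases "t \<in> {0<..<pi}")
          case True
          have "\<bar>sin t\<bar> ^ Suc j * cmod (B t) \<le> 1 * C"
            using bound[OF True] by (intro mult_mono power_le_one) (auto simp: B_def)
          then show ?thesis using True C0 by (simp add: norm_mult norm_power power_abs)
        qed simp
      qed
    qed (use mB[of "Suc j"] in simp)
    have "integral {0..pi} (\<lambda>t. of_real (sin t ^ Suc (Suc j)) * f t) = integral {0<..<pi} (\<lambda>t. of_real (sin t ^ Suc j) * B t)"
      by (simp add: integral_open_interval_real B_def mult_ac)
    also have "\<dots> = (LINT t|lborel. indicator {0<..<pi} t *\<^sub>R (of_real (sin t ^ Suc j) * B t))"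
      using set_borel_integral_eq_integral(2)[OF si] by (simp add: set_lebesgue_integral_def)
    also have "\<dots> = \<bar>1 / R j\<bar> *\<^sub>R (LINT y|lborel. K j y)"
      unfolding K_def S_def using Rpos[of j] by (intro lborel_integral_real_affine) auto
    finally show ?thesis using Rpos[of j] by (simp add: scaleR_conv_of_real)
  qed
  have SA: "(\<lambda>j. S j y) \<longlonglongrightarrow> pi / 2" for y
    unfolding S_def R_def by real_asymp
  have lim: "(\<lambda>j. LINT y|lborel. K j y) \<longlonglongrightarrow> (LINT y|lborel. of_real (exp (- y\<^sup>2 / 2)) * B (pi / 2))"
  proof (rule integral_dominated_convergence)
    show "K j \<in> borel_measurable lborel" for j
    proof -
      note [measurable] = mB[of "Suc j"]
      have "(\<lambda>y. (\<lambda>t. indicator {0<..<pi} t *\<^sub>R (of_real (sin t ^ Suc j) * B t)) (S j y)) \<in> borel_measurable borel"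
        unfolding S_def by measurable
      then show ?thesis by (simp add: K_def[abs_def])
    qed
    show "integrable lborel (\<lambda>y. ((pi\<^sup>2 / 2 + 1) * C) * inverse (1 + y\<^sup>2))"
      by (intro integrable_mult_right integrable_inverse_1_plus_square')
    show "AE y in lborel. norm (K j y) \<le> ((pi\<^sup>2 / 2 + 1) * C) * inverse (1 + y\<^sup>2)" for j
    proof (rule AE_I2)
      fix y
      show "norm (K j y) \<le> ((pi\<^sup>2 / 2 + 1) * C) * inverse (1 + y\<^sup>2)"
      proof (cases "S j y \<in> {0<..<pi}")
        case True
        define x where "x = (1 / R j) * y"
        have x: "\<bar>x\<bar> \<le> pi / 2" using True unfolding S_def x_def[symmetric] by (auto simp: abs_le_iff)
        have x2: "real (Suc j) * x\<^sup>2 = y\<^sup>2" unfolding x_def R_def by (simp add: power_mult_distrib power_divide)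
        have sx: "sin (S j y) = cos x" unfolding S_def x_def by (simp add: sin_add)
        have c0: "cos x \<ge> 0" using x by (intro cos_ge_zero) auto
        have "cos x ^ Suc j \<le> exp (- (2 * x\<^sup>2 / pi\<^sup>2)) ^ Suc j"
          by (intro power_mono cos_le_quadratic x c0)
        also have "\<dots> = exp (- (2 * (real (Suc j) * x\<^sup>2) / pi\<^sup>2))"
          by (subst exp_of_nat_mult[symmetric], rule arg_cong[where f = exp]) (simp add: field_simps)
        also have "\<dots> = exp (- (2 * y\<^sup>2 / pi\<^sup>2))" unfolding x2 ..
        also have "\<dots> = inverse (exp (2 * y\<^sup>2 / pi\<^sup>2))" by (rule exp_minus)
        also have "\<dots> \<le> inverse (1 + 2 * y\<^sup>2 / pi\<^sup>2)"
          by (intro le_imp_inverse_le exp_ge_add_one_self) (auto intro: add_pos_nonneg)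
        also have "\<dots> \<le> (pi\<^sup>2 / 2 + 1) * inverse (1 + y\<^sup>2)"
        proof -
          have p: "1 + 2 * y\<^sup>2 / pi\<^sup>2 > 0" "1 + y\<^sup>2 > 0" by (auto intro: add_pos_nonneg)
          have "(pi\<^sup>2 / 2 + 1) * (1 + 2 * y\<^sup>2 / pi\<^sup>2) = 1 + y\<^sup>2 + (pi\<^sup>2 / 2 + 2 * y\<^sup>2 / pi\<^sup>2)"
            by (simp add: field_simps)
          then have "1 + y\<^sup>2 \<le> (pi\<^sup>2 / 2 + 1) * (1 + 2 * y\<^sup>2 / pi\<^sup>2)" by simp
          then show ?thesis using p by (simp add: field_simps)
        qed
        finally have "cos x ^ Suc j \<le> (pi\<^sup>2 / 2 + 1) * inverse (1 + y\<^sup>2)" .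
        then have "cos x ^ Suc j * cmod (B (S j y)) \<le> (pi\<^sup>2 / 2 + 1) * inverse (1 + y\<^sup>2) * C"
          using bound[OF True] c0 by (intro mult_mono) (auto simp: B_def)
        then show ?thesis using True c0 unfolding K_def by (simp add: sx norm_mult norm_power mult_ac)
      next
        case False
        then show ?thesis using C0 by (simp add: K_def)
      qed
    qed
    show "AE y in lborel. (\<lambda>j. K j y) \<longlonglongrightarrow> of_real (exp (- y\<^sup>2 / 2)) * B (pi / 2)"
    proof (rule AE_I2)
      fix y
      have evi: "eventually (\<lambda>j. S j y \<in> {0<..<pi}) sequentially"
        by (rule topological_tendstoD[OF SA]) auto
      have "continuous_on {0<..<pi} B" unfolding B_def by (intro continuous_intros fc)
      then have "isCont B (pi / 2)" by (simp add: continuous_on_eq_continuous_at)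
      then have BS: "(\<lambda>j. B (S j y)) \<longlonglongrightarrow> B (pi / 2)" by (rule isCont_tendsto_compose[OF _ SA])
      have c: "(\<lambda>j. cos (y / R j) ^ Suc j) \<longlonglongrightarrow> exp (- y\<^sup>2 / 2)"
      proof -
        have "(\<lambda>n::nat. cos (y / sqrt (real n)) ^ n) \<longlonglongrightarrow> exp (- (y * y / 2))"
          by real_asymp
        then have "(\<lambda>n::nat. cos (y / sqrt (real n)) ^ n) \<longlonglongrightarrow> exp (- y\<^sup>2 / 2)"
          by (simp add: power2_eq_square)
        then show ?thesis unfolding R_def by (rule LIMSEQ_Suc)
      qed
      have "(\<lambda>j. of_real (cos (y / R j) ^ Suc j) * B (S j y)) \<longlonglongrightarrow> of_real (exp (- y\<^sup>2 / 2)) * B (pi / 2)"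
        by (intro tendsto_mult tendsto_of_real c BS)
      then show "(\<lambda>j. K j y) \<longlonglongrightarrow> of_real (exp (- y\<^sup>2 / 2)) * B (pi / 2)"
      proof (rule Lim_transform_eventually)
        show "\<forall>\<^sub>F j in sequentially. of_real (cos (y / R j) ^ Suc j) * B (S j y) = K j y"
          using evi
        proof eventually_elim
          case (elim j)
          have "sin (S j y) = cos (y / R j)" unfolding S_def by (simp add: sin_add)
          then show ?case using elim by (simp add: K_def)
        qed
      qed
    qed
  qed simp
  have "(LINT y|lborel. exp (- y\<^sup>2 / 2) :: real) = sqrt (2 * pi)"
  proof -
    have "(LINT y|lborel. std_normal_density y * y ^ (2 * 0)) = 1" using integral_std_normal_moment_even[of 0] by simp
    then have "(1 / sqrt (2 * pi)) * (LINT y|lborel. exp (- y\<^sup>2 / 2) :: real) = 1"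
    proof -
      have e: "(\<lambda>y. std_normal_density y * y ^ (2 * 0)) = (\<lambda>y. (1 / sqrt (2 * pi)) * exp (- y\<^sup>2 / 2))"
        by (simp add: std_normal_density_def)
      assume "(LINT y|lborel. std_normal_density y * y ^ (2 * 0)) = 1"
      then show ?thesis unfolding e integral_mult_right_zero .
    qed
    moreover have "I = s * ((1 / s) * I)" if "s > 0" for s I :: real using that by simp
    ultimately show ?thesis by (metis mult.right_neutral real_sqrt_gt_zero mult_pos_pos pi_gt_zero zero_less_numeral)
  qed
  then have "(LINT y|lborel. complex_of_real (exp (- y\<^sup>2 / 2))) = of_real (sqrt (2 * pi))"
    by (simp only: integral_complex_of_real)
  then have L: "(LINT y|lborel. of_real (exp (- y\<^sup>2 / 2)) * B (pi / 2)) = of_real (sqrt (2 * pi)) * B (pi / 2)"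
    by (simp only: integral_mult_left_zero)
  have "B (pi / 2) = f (pi / 2)" by (simp add: B_def)
  note L = L[unfolded this]
  have l: "(\<lambda>j. of_real (R j) * integral {0..pi} (\<lambda>t. of_real (sin t ^ Suc (Suc j)) * f t)) \<longlonglongrightarrow> of_real (sqrt (2 * pi)) * f (pi / 2)"
    using lim unfolding \<open>B (pi / 2) = f (pi / 2)\<close> L int .
  have "(\<lambda>j. sqrt (real (Suc (Suc j))) / R j) \<longlonglongrightarrow> 1"
    unfolding R_def by real_asymp
  from tendsto_mult[OF tendsto_of_real[OF this] l]
  have "(\<lambda>j. of_real (sqrt (real (Suc (Suc j)))) * integral {0..pi} (\<lambda>t. of_real (sin t ^ Suc (Suc j)) * f t)) \<longlonglongrightarrow> of_real (sqrt (2 * pi)) * f (pi / 2)"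
    using Rpos by (simp add: less_imp_neq[THEN not_sym] del: power_Suc of_nat_Suc)
  then have "(\<lambda>j. of_real (sqrt (real (Suc j))) * integral {0..pi} (\<lambda>t. of_real (sin t ^ Suc j) * f t)) \<longlonglongrightarrow> of_real (sqrt (2 * pi)) * f (pi / 2)"
    by (rule LIMSEQ_imp_Suc)
  then show ?thesis by (rule LIMSEQ_imp_Suc)
qed

section \<open>Stationary phase\<close>

lemma has_vector_derivative_cis:
  assumes "(f has_real_derivative f') (at x within S)"
  shows "((\<lambda>x. cis (f x)) has_vector_derivative (\<i> * of_real f' * cis (f x))) (at x within S)"
proof -
  have "((\<lambda>x. \<i> * of_real (f x)) has_vector_derivative (\<i> * of_real f')) (at x within S)"
    using assms
    by (intro has_vector_derivative_mult_right has_vector_derivative_of_real)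
  from field_vector_diff_chain_within[OF this has_field_derivative_at_within[OF DERIV_exp]]
  show ?thesis by (simp add: cis_conv_exp o_def mult_ac)
qed

text \<open>With \<open>p\<close> the phase, \<open>D\<close> is chosen such that \<open>((x - \<theta>) cis(t p))' = D cis(t p)\<close>.  Dividing by \<open>D\<close> is
  harmless at the stationary point, unlike dividing by \<open>p'\<close>, and gains decay in \<open>t (x - \<theta>)\<^sup>2\<close>.\<close>

lemma stationary_ibp:
  fixes q q' :: "real \<Rightarrow> complex" and \<theta> t :: real
  assumes "A \<le> B"
    and q: "\<And>x. x \<in> {A..B} \<Longrightarrow> (q has_vector_derivative q' x) (at x within {A..B})"
    and q'c: "continuous_on {A..B} q'"
    and q0: "q A = 0" "q B = 0"
  defines "p \<equiv> \<lambda>x. cos \<theta> - cos x - sin \<theta> * (x - \<theta>)"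
  defines "D \<equiv> \<lambda>x. 1 + \<i> * complex_of_real (t * ((x - \<theta>) * (sin x - sin \<theta>)))"
  defines "D' \<equiv> \<lambda>x. \<i> * complex_of_real (t * ((sin x - sin \<theta>) + (x - \<theta>) * cos x))"
  shows "integral {A..B} (\<lambda>x. cis (t * p x) * q x) =
    integral {A..B} (\<lambda>x. of_real (x - \<theta>) * cis (t * p x) * (q x * D' x / (D x)\<^sup>2))
    - integral {A..B} (\<lambda>x. of_real (x - \<theta>) * cis (t * p x) * (q' x / D x))"
proof -
  have nz: "D x \<noteq> 0" for x unfolding D_def by (rule one_plus_i_nz)
  have qc: "continuous_on {A..B} q"
    using q by (meson continuous_on_eq_continuous_within has_vector_derivative_continuous)
  define F where "F x = of_real (x - \<theta>) * cis (t * p x) * (q x * inverse (D x))" for x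
  have "((\<lambda>x. cis (t * p x) * q x - of_real (x - \<theta>) * cis (t * p x) * (q x * D' x / (D x)\<^sup>2)
           + of_real (x - \<theta>) * cis (t * p x) * (q' x / D x)) has_integral (F B - F A)) {A..B}"
  proof (rule fundamental_theorem_of_calculus[OF \<open>A \<le> B\<close>])
    fix x assume x: "x \<in> {A..B}"
    have 1: "((\<lambda>x. complex_of_real (x - \<theta>)) has_vector_derivative 1) (at x within {A..B})"
      unfolding has_vector_derivative_def
      by (auto intro!: derivative_eq_intros simp: fun_eq_iff scaleR_conv_of_real)
    have pd: "((\<lambda>x. t * p x) has_real_derivative (t * (sin x - sin \<theta>))) (at x within {A..B})"
      unfolding p_def by (auto intro!: derivative_eq_intros)
    have 2: "((\<lambda>x. cis (t * p x)) has_vector_derivative (\<i> * of_real (t * (sin x - sin \<theta>)) * cis (t * p x))) (at x within {A..B})"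
      by (rule has_vector_derivative_cis[OF pd])
    have Dd: "(D has_vector_derivative D' x) (at x within {A..B})"
    proof -
      have "((\<lambda>x. t * ((x - \<theta>) * (sin x - sin \<theta>))) has_real_derivative (t * ((sin x - sin \<theta>) + (x - \<theta>) * cos x))) (at x within {A..B})"
        by (auto intro!: derivative_eq_intros simp: algebra_simps)
      from has_vector_derivative_add[OF has_vector_derivative_const has_vector_derivative_mult_right[OF has_vector_derivative_of_real[OF this], of \<i>], of 1]
      show ?thesis unfolding D_def D'_def by simp
    qed
    have 3: "((\<lambda>x. inverse (D x)) has_vector_derivative (D' x * - (inverse (D x) ^ 2))) (at x within {A..B})"
      using field_vector_diff_chain_within[OF Dd DERIV_inverse[OF nz[of x]]]
      by (simp add: o_def power2_eq_square)
    have Fd: "(F has_vector_derivative (of_real (x - \<theta>) * cis (t * p x) * (q x * (D' x * - (inverse (D x) ^ 2)) + q' x * inverse (D x))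
        + (of_real (x - \<theta>) * (\<i> * of_real (t * (sin x - sin \<theta>)) * cis (t * p x)) + 1 * cis (t * p x)) * (q x * inverse (D x)))) (at x within {A..B})"
      unfolding F_def by (intro has_vector_derivative_mult 1 2 3 q x)
    have "of_real (x - \<theta>) * (\<i> * of_real (t * (sin x - sin \<theta>)) * cis (t * p x)) + 1 * cis (t * p x) = D x * cis (t * p x)"
      by (simp add: D_def algebra_simps)
    note Fd = Fd[unfolded this]
    have "D x * cis (t * p x) * (q x * inverse (D x)) = cis (t * p x) * q x"
      using nz[of x] by simp
    note Fd = Fd[unfolded this]
    have e: "of_real (x - \<theta>) * cis (t * p x) * (q x * (D' x * - (inverse (D x) ^ 2)) + q' x * inverse (D x)) + cis (t * p x) * q x
      = cis (t * p x) * q x - of_real (x - \<theta>) * cis (t * p x) * (q x * D' x / (D x)\<^sup>2)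
           + of_real (x - \<theta>) * cis (t * p x) * (q' x / D x)"
      by (simp add: divide_inverse power_inverse algebra_simps)
    show "(F has_vector_derivative cis (t * p x) * q x - of_real (x - \<theta>) * cis (t * p x) * (q x * D' x / (D x)\<^sup>2)
           + of_real (x - \<theta>) * cis (t * p x) * (q' x / D x)) (at x within {A..B})"
      using Fd unfolding e .
  qed
  then have 0: "integral {A..B} (\<lambda>x. cis (t * p x) * q x - of_real (x - \<theta>) * cis (t * p x) * (q x * D' x / (D x)\<^sup>2)
           + of_real (x - \<theta>) * cis (t * p x) * (q' x / D x)) = 0"
    by (simp add: F_def q0 integral_unique)
  have Dc: "continuous_on {A..B} D" "continuous_on {A..B} D'" "continuous_on {A..B} p"
    unfolding D_def D'_def p_def by (intro continuous_intros)+
  have i: "(\<lambda>x. cis (t * p x) * q x) integrable_on {A..B}"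
    "(\<lambda>x. of_real (x - \<theta>) * cis (t * p x) * (q x * D' x / (D x)\<^sup>2)) integrable_on {A..B}"
    "(\<lambda>x. of_real (x - \<theta>) * cis (t * p x) * (q' x / D x)) integrable_on {A..B}"
    by (rule integrable_continuous_real; intro continuous_intros Dc qc q'c; use nz in simp)+
  have gen: "a = b - c" if "a - b + c = 0" for a b c :: complex
    using that by (simp add: algebra_simps eq_neg_iff_add_eq_0)
  show ?thesis
    by (rule gen) (use 0 in \<open>simp only: integral_add[OF integrable_diff[OF i(1,2)] i(3)] integral_diff[OF i(1,2)]\<close>)
qed

text \<open>One integration by parts after division by the phase derivative N + t sin x, which is at
  least t sin A. The constant has to be independent of N, because N will grow in proportion to
  t.\<close>

lemma nonstationary_phase:
  fixes q q' :: "real \<Rightarrow> complex"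
  assumes AB: "0 < A" "A \<le> B" "B < pi / 2"
    and q: "\<And>x. x \<in> {A..B} \<Longrightarrow> (q has_vector_derivative q' x) (at x within {A..B})"
    and q'c: "continuous_on {A..B} q'"
    and q0: "q A = 0" "q B = 0"
  obtains K where "\<And>t N. t > 0 \<Longrightarrow> N \<ge> 0 \<Longrightarrow> cmod (integral {A..B} (\<lambda>x. cis (N * x - t * cos x) * q x)) \<le> K / t"
proof -
  have qc: "continuous_on {A..B} q"
    using q by (meson continuous_on_eq_continuous_within has_vector_derivative_continuous)
  define s where "s = sin A"
  have s: "s > 0" unfolding s_def using AB by (intro sin_gt_zero) auto
  have ss: "s \<le> sin x" if "x \<in> {A..B}" for x
    unfolding s_def using that AB by (intro sin_monotone_2pi_le) auto
  have "bounded (q ` {A..B})" "bounded (q' ` {A..B})"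
    by (intro compact_imp_bounded compact_continuous_image qc q'c; simp)+
  then obtain M M' where M: "\<And>x. x \<in> {A..B} \<Longrightarrow> cmod (q x) \<le> M" and M': "\<And>x. x \<in> {A..B} \<Longrightarrow> cmod (q' x) \<le> M'"
    unfolding bounded_iff by (auto simp del: atLeastAtMost_iff)
  have M0: "M \<ge> 0" "M' \<ge> 0" using order_trans[OF norm_ge_zero M[of A]] order_trans[OF norm_ge_zero M'[of A]] AB by auto
  \<comment> \<open>M' / s accounts for the derivative of q, and M / s^2 for the derivative of the
    reciprocal phase derivative.\<close>
  define K where "K = (M' / s + M / s\<^sup>2) * (B - A)"
  show ?thesis
  proof (rule that[of K])
    fix t N :: real assume t: "t > 0" and N: "N \<ge> 0"
    define P where "P x = N + t * sin x" for x
    have P: "P x \<ge> t * s" if "x \<in> {A..B}" for x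
      unfolding P_def using ss[OF that] t N by (simp add: mult_left_mono add_increasing)
    have Ppos: "P x > 0" if "x \<in> {A..B}" for x using P[OF that] t s by (smt (verit) mult_pos_pos)
    define F where "F x = cis (N * x - t * cos x) * (q x * of_real (inverse (P x)))" for x
    define r where "r x = q' x * of_real (inverse (P x)) - q x * of_real (t * cos x * inverse (P x) ^ 2)" for x
    have "((\<lambda>x. \<i> * (cis (N * x - t * cos x) * q x) + cis (N * x - t * cos x) * r x) has_integral (F B - F A)) {A..B}"
    proof (rule fundamental_theorem_of_calculus[OF \<open>A \<le> B\<close>])
      fix x assume x: "x \<in> {A..B}"
      have pd: "((\<lambda>x. N * x - t * cos x) has_real_derivative P x) (at x within {A..B})"
        unfolding P_def by (auto intro!: derivative_eq_intros)
      have 2: "((\<lambda>x. cis (N * x - t * cos x)) has_vector_derivative (\<i> * of_real (P x) * cis (N * x - t * cos x))) (at x within {A..B})"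
        by (rule has_vector_derivative_cis[OF pd])
      have "((\<lambda>x. inverse (P x)) has_real_derivative (- (t * cos x * inverse (P x) ^ 2))) (at x within {A..B})"
        using Ppos[OF x] unfolding P_def by (auto intro!: derivative_eq_intros simp: power2_eq_square)
      then have 3: "((\<lambda>x. complex_of_real (inverse (P x))) has_vector_derivative of_real (- (t * cos x * inverse (P x) ^ 2))) (at x within {A..B})"
        by (rule has_vector_derivative_of_real)
      have "(F has_vector_derivative (cis (N * x - t * cos x) * (q x * of_real (- (t * cos x * inverse (P x) ^ 2)) + q' x * of_real (inverse (P x)))
         + \<i> * of_real (P x) * cis (N * x - t * cos x) * (q x * of_real (inverse (P x))))) (at x within {A..B})"
        unfolding F_def by (intro has_vector_derivative_mult 2 3 q x)
      moreover have "\<i> * of_real (P x) * cis (N * x - t * cos x) * (q x * of_real (inverse (P x))) = \<i> * (cis (N * x - t * cos x) * q x)"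
        using Ppos[OF x] by simp
      moreover have "cis (N * x - t * cos x) * (q x * of_real (- (t * cos x * inverse (P x) ^ 2)) + q' x * of_real (inverse (P x)))
          = cis (N * x - t * cos x) * r x"
        unfolding r_def by simp
      ultimately show "(F has_vector_derivative \<i> * (cis (N * x - t * cos x) * q x) + cis (N * x - t * cos x) * r x) (at x within {A..B})"
        by (simp only: add.commute)
    qed
    then have 0: "integral {A..B} (\<lambda>x. \<i> * (cis (N * x - t * cos x) * q x) + cis (N * x - t * cos x) * r x) = 0"
      by (simp add: F_def q0 integral_unique)
    have Pnz: "N + t * sin x \<noteq> 0" if "x \<in> {A..B}" for x
      using Ppos[OF that] by (simp add: P_def)
    have rc: "continuous_on {A..B} r"
      unfolding r_def P_def by (intro continuous_intros qc q'c ballI Pnz)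
    have i: "(\<lambda>x. cis (N * x - t * cos x) * q x) integrable_on {A..B}" "(\<lambda>x. cis (N * x - t * cos x) * r x) integrable_on {A..B}"
      by (intro integrable_continuous_real continuous_intros qc rc)+
    have "integral {A..B} (\<lambda>x. \<i> * (cis (N * x - t * cos x) * q x) + cis (N * x - t * cos x) * r x)
        = \<i> * integral {A..B} (\<lambda>x. cis (N * x - t * cos x) * q x) + integral {A..B} (\<lambda>x. cis (N * x - t * cos x) * r x)"
      by (subst integral_add) (auto intro!: i integrable_on_mult_right)
    with 0 have "\<i> * integral {A..B} (\<lambda>x. cis (N * x - t * cos x) * q x) = - integral {A..B} (\<lambda>x. cis (N * x - t * cos x) * r x)"
      by (simp add: eq_neg_iff_add_eq_0)
    then have "cmod (\<i> * integral {A..B} (\<lambda>x. cis (N * x - t * cos x) * q x)) = cmod (integral {A..B} (\<lambda>x. cis (N * x - t * cos x) * r x))"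
      by simp
    also have "\<dots> \<le> (M' / (t * s) + M * t / (t * s)\<^sup>2) * (B - A)"
    proof (rule integral_bound[OF \<open>A \<le> B\<close>])
      show "continuous_on {A..B} (\<lambda>x. cis (N * x - t * cos x) * r x)" by (intro continuous_intros rc)
      fix x assume x: "x \<in> {A..B}"
      have ip: "inverse (P x) \<le> 1 / (t * s)" "inverse (P x) \<ge> 0"
        using P[OF x] Ppos[OF x] t s by (auto simp: field_simps)
      have "cmod (q' x * of_real (inverse (P x))) \<le> M' * (1 / (t * s))"
        unfolding norm_mult norm_of_real using ip M'[OF x] M0 by (intro mult_mono) auto
      moreover have "cmod (q x * of_real (t * cos x * inverse (P x) ^ 2)) \<le> M * (t * 1 * (1 / (t * s)) ^ 2)"
        unfolding norm_mult norm_of_real abs_mult power_abs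
        using ip M[OF x] M0 t by (intro mult_mono power_mono) (auto simp: abs_cos_le_one)
      ultimately have "cmod (r x) \<le> M' * (1 / (t * s)) + M * (t * 1 * (1 / (t * s)) ^ 2)"
        unfolding r_def using norm_triangle_ineq4 order_trans add_mono by meson
      then show "cmod (cis (N * x - t * cos x) * r x) \<le> M' / (t * s) + M * t / (t * s)\<^sup>2"
        by (simp add: norm_mult power_divide)
    qed
    also have "\<dots> = K / t"
      using t s unfolding K_def by (simp add: field_simps power2_eq_square)
    finally show "cmod (integral {A..B} (\<lambda>x. cis (N * x - t * cos x) * q x)) \<le> K / t"
      by (simp add: norm_mult)
  qed
qed

text \<open>The stationary points \<theta> j move with j because the index n is the integer part of
  \<xi> t. After \<open>stationary_ibp\<close>, the term R1 rescaled by sqrt(T j) converges to the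
  Fresnel kernel times q(\<theta>0), and the term R2 with the derivative of q is negligible. B <
  pi/2 keeps the second derivative cos of the phase bounded below.\<close>

lemma stationary_phase:
  fixes q q' :: "real \<Rightarrow> complex" and T \<theta> :: "nat \<Rightarrow> real"
  assumes AB: "0 < A" "B < pi / 2"
    and q: "\<And>x. x \<in> {A..B} \<Longrightarrow> (q has_vector_derivative q' x) (at x within {A..B})"
    and q'c: "continuous_on {A..B} q'"
    and q0: "q A = 0" "q B = 0"
    and T: "filterlim T at_top sequentially" and Tpos: "\<And>j. T j > 0"
    and th: "\<And>j. \<theta> j \<in> {A..B}" and thlim: "\<theta> \<longlonglongrightarrow> \<theta>0" and th0: "\<theta>0 \<in> {A<..<B}"
  shows "(\<lambda>j. of_real (sqrt (T j)) * integral {A..B} (\<lambda>x. cis (T j * (cos (\<theta> j) - cos x - sin (\<theta> j) * (x - \<theta> j))) * q x))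
     \<longlonglongrightarrow> cis (pi / 4) * of_real (sqrt (2 * pi / cos \<theta>0)) * q \<theta>0"
proof -
  define c where "c = cos B"
  have "A \<le> B" using th0 by auto
  have c: "c > 0" unfolding c_def using AB \<open>A \<le> B\<close> by (intro cos_gt_zero_pi) auto
  have qc: "continuous_on {A..B} q"
    using q by (meson continuous_on_eq_continuous_within has_vector_derivative_continuous)
  have "bounded (q ` {A..B})" "bounded (q' ` {A..B})"
    by (intro compact_imp_bounded compact_continuous_image qc q'c; simp)+
  then obtain M M' where M: "\<And>x. x \<in> {A..B} \<Longrightarrow> cmod (q x) \<le> M" and M': "\<And>x. x \<in> {A..B} \<Longrightarrow> cmod (q' x) \<le> M'"
    unfolding bounded_iff by (auto simp del: atLeastAtMost_iff)
  have M0: "M \<ge> 0" "M' \<ge> 0" using order_trans[OF norm_ge_zero M[of A]] order_trans[OF norm_ge_zero M'[of A]] \<open>A \<le> B\<close> by auto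
  define p where "p j x = cos (\<theta> j) - cos x - sin (\<theta> j) * (x - \<theta> j)" for j x
  \<comment> \<open>(x - \<theta> j) times the derivative of the phase p. By the mean value theorem
    it lies above c (x - \<theta> j)^2, which makes D large away from the stationary point.\<close>
  define m where "m j x = (x - \<theta> j) * (sin x - sin (\<theta> j))" for j x
  define D where "D j x = 1 + \<i> * complex_of_real (T j * m j x)" for j x
  define D' where "D' j x = \<i> * complex_of_real (T j * ((sin x - sin (\<theta> j)) + (x - \<theta> j) * cos x))" for j x
  define R1 where "R1 j x = of_real (x - \<theta> j) * cis (T j * p j x) * (q x * D' j x / (D j x)\<^sup>2)" for j x
  define R2 where "R2 j x = of_real (x - \<theta> j) * cis (T j * p j x) * (q' x / D j x)" for j x
  have nz: "D j x \<noteq> 0" for j x unfolding D_def by (rule one_plus_i_nz)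
  have Dc: "continuous_on {A..B} (D j)" "continuous_on {A..B} (D' j)" "continuous_on {A..B} (p j)" for j
    unfolding D_def D'_def p_def m_def by (intro continuous_intros)+
  have Rc: "continuous_on {A..B} (R1 j)" "continuous_on {A..B} (R2 j)" for j
    unfolding R1_def R2_def by (intro continuous_intros Dc qc q'c; use nz in simp)+
  have sd: "\<bar>sin x - sin (\<theta> j)\<bar> \<le> \<bar>x - \<theta> j\<bar>" and mlow: "m j x \<ge> c * (x - \<theta> j)\<^sup>2" if x: "x \<in> {A..B}" for j x
  proof -
    obtain z where z: "z \<in> {A..B}" "sin x - sin (\<theta> j) = (x - \<theta> j) * cos z"
      using sin_diff_mvt[OF x th] .
    have cz: "cos z \<ge> c" unfolding c_def using z AB by (intro cos_monotone_0_pi_le) auto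
    show "\<bar>sin x - sin (\<theta> j)\<bar> \<le> \<bar>x - \<theta> j\<bar>"
      unfolding z(2) abs_mult by (simp add: mult_left_le)
    have "m j x = cos z * (x - \<theta> j)\<^sup>2" unfolding m_def z(2) by (simp add: power2_eq_square)
    then show "m j x \<ge> c * (x - \<theta> j)\<^sup>2" using cz by (simp add: mult_right_mono)
  qed
  have nD: "(cmod (D j x))\<^sup>2 \<ge> 1 + c\<^sup>2 * (T j)\<^sup>2 * (x - \<theta> j) ^ 4" if "x \<in> {A..B}" for j x
  proof -
    have "0 \<le> T j * (c * (x - \<theta> j)\<^sup>2)" using Tpos[of j] c by simp
    moreover have "T j * (c * (x - \<theta> j)\<^sup>2) \<le> T j * m j x" using mlow[OF that] Tpos[of j] by simp
    ultimately have "(T j * (c * (x - \<theta> j)\<^sup>2))\<^sup>2 \<le> (T j * m j x)\<^sup>2" by (intro power_mono)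
    then show ?thesis unfolding D_def norm_one_plus_i by (simp add: power_mult_distrib mult_ac flip: power_mult)
  qed
  have D1: "cmod (D j x) \<ge> 1" for j x
    using abs_Re_le_cmod[of "D j x"] by (simp add: D_def)
  have DT: "cmod (D j x) \<ge> c * T j * (x - \<theta> j)\<^sup>2" if "x \<in> {A..B}" for j x
  proof -
    have "T j * (c * (x - \<theta> j)\<^sup>2) \<le> T j * m j x" using mlow[OF that] Tpos[of j] by simp
    also have "\<dots> \<le> cmod (D j x)" using abs_Im_le_cmod[of "D j x"] by (simp add: D_def)
    finally show ?thesis by (simp add: mult_ac)
  qed
  \<comment> \<open>With y = sqrt(T j) |x - \<theta> j| the integrand is of size y / |D|. It is
    bounded because |D| \<ge> 1 and |D| \<ge> c y^2, and it tends to 0 for every x other than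
    \<theta>0, so no rescaling is required here.\<close>
  have lim2: "(\<lambda>j. of_real (sqrt (T j)) * integral {A..B} (R2 j)) \<longlonglongrightarrow> 0"
  proof -
    have sq: "cmod (of_real (sqrt (T j)) * R2 j x) \<le> M' * (sqrt (T j) * \<bar>x - \<theta> j\<bar> / cmod (D j x))" if "x \<in> {A..B}" for j x
    proof -
      have "cmod (of_real (sqrt (T j)) * R2 j x) = cmod (q' x) * (sqrt (T j) * \<bar>x - \<theta> j\<bar> / cmod (D j x))"
        using Tpos[of j] unfolding R2_def norm_mult norm_divide norm_of_real by simp
      also have "\<dots> \<le> M' * (sqrt (T j) * \<bar>x - \<theta> j\<bar> / cmod (D j x))"
        using M'[OF that] Tpos[of j] by (intro mult_right_mono) auto
      finally show ?thesis .
    qed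
    have bd: "sqrt (T j) * \<bar>x - \<theta> j\<bar> / cmod (D j x) \<le> 1 + 1 / c" if "x \<in> {A..B}" for j x
    proof -
      let ?y = "sqrt (T j) * \<bar>x - \<theta> j\<bar>"
      have "?y\<^sup>2 = T j * (x - \<theta> j)\<^sup>2" using Tpos[of j] by (simp add: power_mult_distrib)
      then have "c * ?y\<^sup>2 \<le> cmod (D j x)" using DT[OF that, of j] by (simp add: mult_ac)
      then have "?y\<^sup>2 \<le> cmod (D j x) / c" using c by (simp add: field_simps)
      moreover have "?y \<le> 1 + ?y\<^sup>2"
      proof (cases "?y \<le> 1")
        case False then have "?y * 1 \<le> ?y * ?y" by (intro mult_left_mono) auto
        then show ?thesis by (simp add: power2_eq_square)
      qed (simp add: add_increasing2)
      ultimately have "?y \<le> cmod (D j x) + cmod (D j x) / c" using D1[of j x] by linarith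
      also have "\<dots> = (1 + 1 / c) * cmod (D j x)" by (simp add: algebra_simps)
      finally show ?thesis using D1[of j x] c by (auto simp: divide_le_eq)
    qed
    have "(\<lambda>j. LINT x|lborel. indicator {A..B} x *\<^sub>R (of_real (sqrt (T j)) * R2 j x)) \<longlonglongrightarrow> (LINT x|(lborel :: real measure). (0::complex))"
    proof (rule integral_dominated_convergence[where w = "\<lambda>x. indicator {A..B} x *\<^sub>R (M' * (1 + 1 / c))"])
      show "(\<lambda>x. indicator {A..B} x *\<^sub>R (of_real (sqrt (T j)) * R2 j x)) \<in> borel_measurable lborel" for j
        using borel_measurable_continuous_on_indicator[of "{A..B}" "\<lambda>x. of_real (sqrt (T j)) * R2 j x"]
          continuous_on_mult_left[OF Rc(2), of "of_real (sqrt (T j))" j]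
        by simp
      show "integrable lborel (\<lambda>x. indicator {A..B} x *\<^sub>R (M' * (1 + 1 / c)))"
        by (intro integrable_scaleR_left integrable_real_indicator) (auto simp: emeasure_lborel_Icc_eq)
      show "AE x in lborel. norm (indicator {A..B} x *\<^sub>R (of_real (sqrt (T j)) * R2 j x)) \<le> indicator {A..B} x *\<^sub>R (M' * (1 + 1 / c))" for j
      proof (rule AE_I2)
        fix x
        show "norm (indicator {A..B} x *\<^sub>R (of_real (sqrt (T j)) * R2 j x)) \<le> indicator {A..B} x *\<^sub>R (M' * (1 + 1 / c))"
        proof (cases "x \<in> {A..B}")
          case True
          from order_trans[OF sq[OF True] mult_left_mono[OF bd[OF True] M0(2)]] show ?thesis using True by simp
        qed simp
      qed
      show "AE x in lborel. (\<lambda>j. indicator {A..B} x *\<^sub>R (of_real (sqrt (T j)) * R2 j x)) \<longlonglongrightarrow> 0"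
        using AE_lborel_singleton[of \<theta>0]
      proof eventually_elim
        case (elim x)
        show ?case
        proof (cases "x \<in> {A..B}")
          case True
          have xt: "(\<lambda>j. \<bar>x - \<theta> j\<bar>) \<longlonglongrightarrow> \<bar>x - \<theta>0\<bar>" by (intro tendsto_intros thlim)
          have sT: "filterlim (\<lambda>j. sqrt (T j)) at_top sequentially" by (rule filterlim_compose[OF sqrt_at_top T])
          have "filterlim (\<lambda>j. (\<bar>x - \<theta> j\<bar>) * sqrt (T j)) at_top sequentially"
            by (rule filterlim_tendsto_pos_mult_at_top[OF xt _ sT]) (use elim in simp)
          then have "(\<lambda>j. inverse (\<bar>x - \<theta> j\<bar> * sqrt (T j))) \<longlonglongrightarrow> 0"
            by (rule tendsto_inverse_0_at_top)
          then have lz: "(\<lambda>j. M' / c * inverse (\<bar>x - \<theta> j\<bar> * sqrt (T j))) \<longlonglongrightarrow> 0"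
            by (rule tendsto_mult_right_zero)
          have ne: "eventually (\<lambda>j. \<bar>x - \<theta> j\<bar> > 0) sequentially"
            by (rule order_tendstoD(1)[OF xt]) (use elim in simp)
          show ?thesis
          proof (rule Lim_null_comparison[OF _ lz])
            show "\<forall>\<^sub>F j in sequentially. norm (indicator {A..B} x *\<^sub>R (of_real (sqrt (T j)) * R2 j x)) \<le> M' / c * inverse (\<bar>x - \<theta> j\<bar> * sqrt (T j))"
              using ne
            proof eventually_elim
              case (elim j)
              have pos: "0 < c * T j * (x - \<theta> j)\<^sup>2" using c Tpos[of j] elim by simp
              have "sqrt (T j) * \<bar>x - \<theta> j\<bar> / cmod (D j x) \<le> sqrt (T j) * \<bar>x - \<theta> j\<bar> / (c * T j * (x - \<theta> j)\<^sup>2)"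
                using DT[OF True, of j] pos Tpos[of j] D1[of j x] by (intro divide_left_mono) (auto intro!: mult_pos_pos simp: c)
              also have "c * T j * (x - \<theta> j)\<^sup>2 = c * (sqrt (T j) * \<bar>x - \<theta> j\<bar>) * (sqrt (T j) * \<bar>x - \<theta> j\<bar>)"
                using Tpos[of j] by (simp add: power2_eq_square algebra_simps)
              also have "sqrt (T j) * \<bar>x - \<theta> j\<bar> / \<dots> = 1 / c * inverse (\<bar>x - \<theta> j\<bar> * sqrt (T j))"
              proof -
                have "u / (c * u * u) = 1 / c * inverse u" if "u > 0" for u using that c by (simp add: field_simps)
                from this[of "sqrt (T j) * \<bar>x - \<theta> j\<bar>"] show ?thesis using Tpos[of j] elim by (simp add: mult.commute)
              qed
              finally have "sqrt (T j) * \<bar>x - \<theta> j\<bar> / cmod (D j x) \<le> 1 / c * inverse (\<bar>x - \<theta> j\<bar> * sqrt (T j))" .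
              from order_trans[OF sq[OF True] mult_left_mono[OF this M0(2)]]
              show ?case using True by simp
            qed
          qed
        qed simp
      qed
    qed auto
    moreover have "(LINT x|lborel. indicator {A..B} x *\<^sub>R (of_real (sqrt (T j)) * R2 j x)) = of_real (sqrt (T j)) * integral {A..B} (R2 j)" for j
    proof -
      have "(LINT x:{A..B}|lborel. R2 j x) = integral {A..B} (R2 j)"
        by (intro set_borel_integral_eq_integral borel_integrable_atLeastAtMost' Rc)
      then show ?thesis by (simp flip: set_lebesgue_integral_def)
    qed
    ultimately show ?thesis by simp
  qed
  define S where "S j y = \<theta> j + (1 / sqrt (T j)) * y" for j y
  define K where "K j y = indicator {A..B} (S j y) *\<^sub>R R1 j (S j y)" for j y
  have int1: "of_real (sqrt (T j)) * integral {A..B} (R1 j) = (LINT y|lborel. K j y)" for j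
  proof -
    have "(LINT x:{A..B}|lborel. R1 j x) = integral {A..B} (R1 j)"
      by (intro set_borel_integral_eq_integral borel_integrable_atLeastAtMost' Rc)
    then have "integral {A..B} (R1 j) = (LINT x|lborel. indicator {A..B} x *\<^sub>R R1 j x)"
      by (simp add: set_lebesgue_integral_def)
    also have "\<dots> = \<bar>1 / sqrt (T j)\<bar> *\<^sub>R (LINT y|lborel. K j y)"
      unfolding K_def S_def using Tpos[of j] by (intro lborel_integral_real_affine) auto
    finally show ?thesis using Tpos[of j] by (simp add: scaleR_conv_of_real)
  qed
  have SA: "(\<lambda>j. S j y) \<longlonglongrightarrow> \<theta>0" for y
  proof -
    have "(\<lambda>j. inverse (sqrt (T j))) \<longlonglongrightarrow> 0"
      by (intro tendsto_inverse_0_at_top filterlim_compose[OF sqrt_at_top T])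
    then have "(\<lambda>j. \<theta> j + inverse (sqrt (T j)) * y) \<longlonglongrightarrow> \<theta>0 + 0 * y" by (intro tendsto_intros thlim)
    then show ?thesis by (simp add: S_def divide_inverse)
  qed
  \<comment> \<open>The difference of sines is turned into a product, so that the limit is taken of
    one small sine times a cosine that converges to cos \<theta>0.\<close>
  have Tm: "(\<lambda>j. T j * m j (S j y)) \<longlonglongrightarrow> cos \<theta>0 * y\<^sup>2" for y
  proof -
    have 1: "((\<lambda>t. sqrt t * (2 * sin (y / (2 * sqrt t)))) \<longlongrightarrow> y) at_top" by real_asymp
    have "(\<lambda>j. \<theta> j + y / (2 * sqrt (T j))) \<longlonglongrightarrow> \<theta>0 + 0"
      by (intro tendsto_add thlim filterlim_compose[OF _ T, of "\<lambda>t. y / (2 * sqrt t)"]) real_asymp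
    then have "(\<lambda>j. y * ((sqrt (T j) * (2 * sin (y / (2 * sqrt (T j))))) * cos (\<theta> j + y / (2 * sqrt (T j))))) \<longlonglongrightarrow> y * (y * cos \<theta>0)"
      by (intro tendsto_intros filterlim_compose[OF 1 T]) simp
    moreover have "y * ((sqrt (T j) * (2 * sin (y / (2 * sqrt (T j))))) * cos (\<theta> j + y / (2 * sqrt (T j)))) = T j * m j (S j y)" for j
    proof -
      have "sin (S j y) - sin (\<theta> j) = 2 * sin (y / (2 * sqrt (T j))) * cos (\<theta> j + y / (2 * sqrt (T j)))"
        unfolding sin_diff_sin S_def by (simp add: add_divide_distrib mult.commute)
      then show ?thesis using Tpos[of j] unfolding m_def S_def by (simp add: field_simps)
    qed
    ultimately show ?thesis by (simp add: power2_eq_square mult_ac)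
  qed
  have Tw: "T j * (S j y - \<theta> j)\<^sup>2 = y\<^sup>2" for j y
    using Tpos[of j] by (simp add: S_def power_divide power_mult_distrib)
  have Tp: "(\<lambda>j. T j * p j (S j y)) \<longlonglongrightarrow> cos \<theta>0 * y\<^sup>2 / 2" for y
  proof -
    have 1: "((\<lambda>t. t * (1 - cos (y / sqrt t))) \<longlongrightarrow> y * y / 2) at_top" by real_asymp
    have 2: "((\<lambda>t. t * (sin (y / sqrt t) - y / sqrt t)) \<longlongrightarrow> 0) at_top" by real_asymp
    have "(\<lambda>j. cos (\<theta> j) * (T j * (1 - cos (y / sqrt (T j)))) + sin (\<theta> j) * (T j * (sin (y / sqrt (T j)) - y / sqrt (T j))))
       \<longlonglongrightarrow> cos \<theta>0 * (y * y / 2) + sin \<theta>0 * 0"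
      by (intro tendsto_intros thlim filterlim_compose[OF 1 T] filterlim_compose[OF 2 T])
    moreover have "cos (\<theta> j) * (T j * (1 - cos (y / sqrt (T j)))) + sin (\<theta> j) * (T j * (sin (y / sqrt (T j)) - y / sqrt (T j))) = T j * p j (S j y)" for j
      unfolding p_def S_def by (simp add: cos_add algebra_simps)
    ultimately show ?thesis by (simp add: power2_eq_square)
  qed
  have lim1: "(\<lambda>j. LINT y|lborel. K j y) \<longlonglongrightarrow> (LINT y|lborel. fresnel_kernel (cos \<theta>0) y * q \<theta>0)"
  proof (rule integral_dominated_convergence)
    show "K j \<in> borel_measurable lborel" for j
    proof -
      have [measurable]: "(\<lambda>x. indicator {A..B} x *\<^sub>R R1 j x) \<in> borel_measurable borel"
        using borel_measurable_continuous_on_indicator[of "{A..B}" "R1 j"] Rc by auto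
      have "(\<lambda>y. (\<lambda>x. indicator {A..B} x *\<^sub>R R1 j x) (S j y)) \<in> borel_measurable borel"
        unfolding S_def by measurable
      then show ?thesis by (simp add: K_def[abs_def])
    qed
    show "(\<lambda>y. fresnel_kernel (cos \<theta>0) y * q \<theta>0) \<in> borel_measurable lborel" by simp
    show "integrable lborel (\<lambda>y. (2 * M) * (y\<^sup>2 / (1 + c\<^sup>2 * y ^ 4)))"
      by (intro integrable_mult_right integrable_quartic_decay c)
    show "AE y in lborel. norm (K j y) \<le> (2 * M) * (y\<^sup>2 / (1 + c\<^sup>2 * y ^ 4))" for j
    proof (rule AE_I2)
      fix y
      show "norm (K j y) \<le> (2 * M) * (y\<^sup>2 / (1 + c\<^sup>2 * y ^ 4))"
      proof (cases "S j y \<in> {A..B}")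
        case True
        let ?w = "S j y - \<theta> j"
        have "T j * (T j * ?w ^ 4) = (T j * ?w\<^sup>2)\<^sup>2" by (simp add: power2_eq_square power4_eq_xxxx)
        then have y4: "(T j)\<^sup>2 * ?w ^ 4 = y ^ 4" unfolding Tw by (simp add: power2_eq_square power4_eq_xxxx)
        have d: "(cmod (D j (S j y)))\<^sup>2 \<ge> 1 + c\<^sup>2 * y ^ 4"
          using nD[OF True, of j] y4 by (simp add: mult.assoc)
        have "cmod (of_real ?w * D' j (S j y)) = T j * \<bar>?w\<bar> * \<bar>(sin (S j y) - sin (\<theta> j)) + ?w * cos (S j y)\<bar>"
          using Tpos[of j] unfolding D'_def norm_mult norm_of_real abs_mult by simp
        also have "\<dots> \<le> T j * \<bar>?w\<bar> * (\<bar>?w\<bar> + \<bar>?w\<bar> * 1)"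
          using sd[OF True, of j] Tpos[of j]
          by (intro mult_left_mono order_trans[OF abs_triangle_ineq] add_mono) (auto simp: abs_mult mult_left_le)
        also have "\<dots> = 2 * y\<^sup>2" using Tw[of j y] by (simp add: power2_eq_square algebra_simps)
        finally have n: "cmod (of_real ?w * D' j (S j y)) \<le> 2 * y\<^sup>2" .
        have "norm (K j y) = cmod (q (S j y)) * (cmod (of_real ?w * D' j (S j y)) / (cmod (D j (S j y)))\<^sup>2)"
          using True unfolding K_def R1_def by (simp add: norm_mult norm_divide norm_power mult_ac)
        also have "\<dots> \<le> M * (2 * y\<^sup>2 / (1 + c\<^sup>2 * y ^ 4))"
          using n d M[OF True] M0 by (intro mult_mono frac_le) (auto intro: add_pos_nonneg)
        finally show ?thesis by (simp add: mult_ac)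
      next
        case False
        then show ?thesis using M0 by (simp add: K_def)
      qed
    qed
    show "AE y in lborel. (\<lambda>j. K j y) \<longlonglongrightarrow> fresnel_kernel (cos \<theta>0) y * q \<theta>0"
    proof (rule AE_I2)
      fix y
      have evi: "eventually (\<lambda>j. S j y \<in> {A<..<B}) sequentially"
        by (rule topological_tendstoD[OF SA]) (use th0 in auto)
      have "isCont q \<theta>0"
        using continuous_on_interior[OF qc, of \<theta>0] th0 by (simp add: interior_atLeastAtMost_real)
      then have qS: "(\<lambda>j. q (S j y)) \<longlonglongrightarrow> q \<theta>0" by (rule isCont_tendsto_compose[OF _ SA])
      have "(\<lambda>j. T j * (S j y - \<theta> j)\<^sup>2 * cos (S j y)) \<longlonglongrightarrow> y\<^sup>2 * cos \<theta>0"
        unfolding Tw by (intro tendsto_intros SA)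
      from tendsto_add[OF Tm[of y] this]
      have wD: "(\<lambda>j. \<i> * complex_of_real (T j * m j (S j y) + T j * (S j y - \<theta> j)\<^sup>2 * cos (S j y))) \<longlonglongrightarrow> \<i> * of_real (cos \<theta>0 * y\<^sup>2 + y\<^sup>2 * cos \<theta>0)"
        by (intro tendsto_mult[OF tendsto_const] tendsto_of_real)
      have "(\<lambda>j. cis (T j * p j (S j y)) * (q (S j y) * (\<i> * of_real (T j * m j (S j y) + T j * (S j y - \<theta> j)\<^sup>2 * cos (S j y))) / (D j (S j y))\<^sup>2))
        \<longlonglongrightarrow> cis (cos \<theta>0 * y\<^sup>2 / 2) * (q \<theta>0 * (\<i> * of_real (cos \<theta>0 * y\<^sup>2 + y\<^sup>2 * cos \<theta>0)) / (1 + \<i> * of_real (cos \<theta>0 * y\<^sup>2))\<^sup>2)"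
      proof (rule tendsto_mult[OF _ tendsto_divide[OF tendsto_mult[OF qS wD] tendsto_power]])
        show "(\<lambda>j. cis (T j * p j (S j y))) \<longlonglongrightarrow> cis (cos \<theta>0 * y\<^sup>2 / 2)"
          using Tp[of y] by (intro tendsto_intros)
        show "(1 + \<i> * complex_of_real (cos \<theta>0 * y\<^sup>2))\<^sup>2 \<noteq> 0" by (rule power_not_zero[OF one_plus_i_nz])
        show "(\<lambda>j. D j (S j y)) \<longlonglongrightarrow> 1 + \<i> * complex_of_real (cos \<theta>0 * y\<^sup>2)"
          unfolding D_def by (intro tendsto_add[OF tendsto_const] tendsto_mult[OF tendsto_const] tendsto_of_real Tm)
      qed
      also have "cis (cos \<theta>0 * y\<^sup>2 / 2) * (q \<theta>0 * (\<i> * of_real (cos \<theta>0 * y\<^sup>2 + y\<^sup>2 * cos \<theta>0)) / (1 + \<i> * of_real (cos \<theta>0 * y\<^sup>2))\<^sup>2)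
          = fresnel_kernel (cos \<theta>0) y * q \<theta>0"
        by (simp add: fresnel_kernel_def mult_ac)
      finally show "(\<lambda>j. K j y) \<longlonglongrightarrow> fresnel_kernel (cos \<theta>0) y * q \<theta>0"
      proof (rule Lim_transform_eventually)
        show "\<forall>\<^sub>F j in sequentially. cis (T j * p j (S j y)) * (q (S j y) * (\<i> * of_real (T j * m j (S j y) + T j * (S j y - \<theta> j)\<^sup>2 * cos (S j y))) / (D j (S j y))\<^sup>2) = K j y"
          using evi
        proof eventually_elim
          case (elim j)
          have "of_real (S j y - \<theta> j) * D' j (S j y) = \<i> * complex_of_real (T j * m j (S j y) + T j * (S j y - \<theta> j)\<^sup>2 * cos (S j y))"
            unfolding D'_def m_def power2_eq_square by (simp only: of_real_mult[symmetric] of_real_add[symmetric] mult.left_commute[of _ \<i>]) (simp only: algebra_simps)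
          then show ?case using elim unfolding K_def R1_def by (simp add: mult_ac)
        qed
      qed
    qed
  qed
  have L: "(LINT y|lborel. fresnel_kernel (cos \<theta>0) y * q \<theta>0) = cis (pi / 4) * of_real (sqrt (2 * pi / cos \<theta>0)) * q \<theta>0"
  proof -
    have "cos \<theta>0 > 0" using th0 AB by (intro cos_gt_zero_pi) auto
    from fresnel_kernel_integral[OF this] show ?thesis by (simp add: has_bochner_integral_iff)
  qed
  have "(\<lambda>j. of_real (sqrt (T j)) * integral {A..B} (R1 j)) \<longlonglongrightarrow> cis (pi / 4) * of_real (sqrt (2 * pi / cos \<theta>0)) * q \<theta>0"
    using lim1 unfolding int1 L .
  from tendsto_diff[OF this lim2]
  have "(\<lambda>j. of_real (sqrt (T j)) * (integral {A..B} (R1 j) - integral {A..B} (R2 j))) \<longlonglongrightarrow> cis (pi / 4) * of_real (sqrt (2 * pi / cos \<theta>0)) * q \<theta>0"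
    by (simp add: right_diff_distrib)
  moreover have "integral {A..B} (\<lambda>x. cis (T j * (cos (\<theta> j) - cos x - sin (\<theta> j) * (x - \<theta> j))) * q x) = integral {A..B} (R1 j) - integral {A..B} (R2 j)" for j
    unfolding R1_def R2_def D_def D'_def p_def m_def
    by (rule stationary_ibp[OF \<open>A \<le> B\<close> q q'c q0])
  ultimately show ?thesis by simp
qed

section \<open>Jacobi polynomials at the origin\<close>

lemma jacobi_amp_continuous: "continuous_on {0<..<pi} (jacobi_amp \<alpha> \<beta>)"
proof -
  have "sin (t / 2) \<noteq> 0" "cos (t / 2) \<noteq> 0" if "t \<in> {0<..<pi}" for t
    using that sin_gt_zero[of "t / 2"] cos_gt_zero_pi[of "t / 2"] by auto
  then show ?thesis unfolding jacobi_amp_def[abs_def] by (intro continuous_intros) auto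
qed

text \<open>The factor sin t = 2 sin(t/2) cos(t/2) raises both exponents by one, to the positive
  numbers \<alpha> + 1 and \<beta> + 1.\<close>

lemma jacobi_amp_bound:
  assumes ab: "\<alpha> > -1" "\<beta> > -1" and t: "t \<in> {0<..<pi}"
  shows "cmod (of_real (sin t) * jacobi_amp \<alpha> \<beta> t) \<le> 2 powr (\<alpha> + 1) * 2 powr (\<beta> + 1)"
proof -
  define s c where "s = 2 * sin (t / 2)" and "c = 2 * cos (t / 2)"
  have sc: "s > 0" "c > 0" "s \<le> 2" "c \<le> 2"
    using t sin_gt_zero[of "t / 2"] cos_gt_zero_pi[of "t / 2"] by (auto simp: s_def c_def)
  have "sin t = s * c / 2" using sin_double[of "t / 2"] by (simp add: s_def c_def)
  then have "cmod (of_real (sin t) * jacobi_amp \<alpha> \<beta> t) = (s * c / 2) * (s powr \<alpha> * c powr \<beta>)"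
    using sc by (simp add: jacobi_amp_def norm_mult s_def c_def)
  also have "\<dots> = (s powr (\<alpha> + 1) * c powr (\<beta> + 1)) / 2"
    using sc by (simp add: powr_add)
  also have "\<dots> \<le> s powr (\<alpha> + 1) * c powr (\<beta> + 1)" by simp
  also have "\<dots> \<le> 2 powr (\<alpha> + 1) * 2 powr (\<beta> + 1)"
    using sc ab by (intro mult_mono powr_mono2) auto
  finally show ?thesis .
qed

text \<open>Source of the phase (\<alpha> - \<beta>) pi/4 in U(t). The power of 2 will cancel
  against \<open>normalization_limit\<close>.\<close>

lemma jacobi_amp_half_pi:
  "jacobi_amp \<alpha> \<beta> (pi / 2) = of_real (2 powr ((\<alpha> + \<beta>) / 2)) * cis ((\<beta> - \<alpha>) * pi / 4)"
proof -
  have 1: "2 * sin (pi / 2 / 2) = 2 powr (1/2)" "2 * cos (pi / 2 / 2) = 2 powr (1/2)"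
    by (simp_all add: sin_45 cos_45 powr_half_sqrt)
  have 2: "\<alpha> * ((pi / 2 - pi) / 2) + \<beta> * (pi / 2 / 2) = (\<beta> - \<alpha>) * pi / 4" by (simp add: field_simps)
  show ?thesis unfolding jacobi_amp_def 1 2 by (simp add: powr_powr add_divide_distrib powr_add)
qed

lemma falling_prod_Gamma:
  fixes s :: real
  assumes "s + 1 - real m > 0"
  shows "(\<Prod>i<m. s - real i) * Gamma (s + 1 - real m) = Gamma (s + 1)"
  using assms
proof (induction m)
  case (Suc m)
  then have p: "s - real m > 0" by simp
  have "Gamma (s - real m + 1) = (s - real m) * Gamma (s - real m)"
    using p by (intro Gamma_plus1) auto
  then have "(s - real m) * Gamma (s + 1 - real (Suc m)) = Gamma (s + 1 - real m)"
    by (simp add: algebra_simps)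
  then show ?case using Suc.IH p by (simp add: mult.assoc)
qed simp

context jacobi_polys
begin

text \<open>\<Lambda> and B are Gamma quotients, and the Gamma functions of argument near 2n cancel.
  In V, the square of the sequence, what remains is expressed by quotients \<sigma> tending to 1, by
  one power of 2, and by (2n + \<alpha> + \<beta> + 1) / (n + \<alpha> + \<beta> + 1), which tends
  to 2.\<close>

lemma normalization_limit:
  fixes \<Lambda> B :: "nat \<Rightarrow> real"
  defines "\<Lambda> \<equiv> \<lambda>n::nat. \<Prod>i<n. (n + \<alpha>) + (n + \<beta>) - real i"
  defines "B \<equiv> \<lambda>n::nat. jacobi_moment (n + \<alpha>) (n + \<beta>) 1"
  shows "(\<lambda>n. fact n * 2 ^ n / sqrt (fact n * \<Lambda> n * B n * n)) \<longlonglongrightarrow> 2 powr (- (\<alpha> + \<beta>) / 2)"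
proof -
  define \<sigma> where "\<sigma> x n = Gamma (real n + x + 1) / (fact n * real n powr x)" for x n
  have \<sigma>: "\<sigma> x \<longlonglongrightarrow> 1" if "x > -1" for x unfolding \<sigma>_def by (rule gamma_ratio_limit[OF that])
  define V where "V n = \<sigma> (\<alpha> + \<beta> + 1) n / (\<sigma> \<alpha> n * \<sigma> \<beta> n) * ((2 * real n + \<alpha> + \<beta> + 1) / (real n + \<alpha> + \<beta> + 1)) * 2 powr (- (\<alpha> + \<beta> + 1))" for n
  have "V \<longlonglongrightarrow> 1 / (1 * 1) * 2 * 2 powr (- (\<alpha> + \<beta> + 1))"
    unfolding V_def
  proof (intro tendsto_intros \<sigma>)
    show "(\<lambda>n. (2 * real n + \<alpha> + \<beta> + 1) / (real n + \<alpha> + \<beta> + 1)) \<longlonglongrightarrow> 2" by real_asymp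
  qed (use ab in auto)
  also have "1 / (1 * 1) * 2 * 2 powr (- (\<alpha> + \<beta> + 1)) = 2 powr (- (\<alpha> + \<beta>))"
    using powr_add[of 2 1 "- (\<alpha> + \<beta> + 1)"] by simp
  finally have "(\<lambda>n. sqrt (V n)) \<longlonglongrightarrow> sqrt (2 powr (- (\<alpha> + \<beta>)))" by (rule tendsto_real_sqrt)
  also have "sqrt (2 powr (- (\<alpha> + \<beta>))) = 2 powr (- (\<alpha> + \<beta>) / 2)"
    by (simp add: powr_half_sqrt_powr)
  finally show ?thesis
  proof (rule Lim_transform_eventually)
    show "\<forall>\<^sub>F n in sequentially. sqrt (V n) = fact n * 2 ^ n / sqrt (fact n * \<Lambda> n * B n * n)"
      using eventually_gt_at_top[of "0::nat"]
    proof eventually_elim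
      case (elim n)
      have n1: "real n \<ge> 1" using elim by simp
      define g1 where "g1 = Gamma (real n + \<alpha> + \<beta> + 1)"
      define g2 where "g2 = Gamma (2 * real n + \<alpha> + \<beta> + 1)"
      define gam where "gam = Gamma (real n + \<alpha> + 1)"
      define gb where "gb = Gamma (real n + \<beta> + 1)"
      define s where "s = real n + \<alpha> + \<beta> + 1"
      define s2 where "s2 = 2 * real n + \<alpha> + \<beta> + 1"
      have pos: "s > 0" "s2 > 0" using ab n1 by (auto simp: s_def s2_def)
      have gpos: "g1 > 0" "g2 > 0" "gam > 0" "gb > 0"
        unfolding g1_def g2_def gam_def gb_def using ab n1 by (auto intro!: Gamma_real_pos)
      have "\<Lambda> n * Gamma (((n + \<alpha>) + (n + \<beta>)) + 1 - real n) = Gamma (((n + \<alpha>) + (n + \<beta>)) + 1)"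
        unfolding \<Lambda>_def by (rule falling_prod_Gamma) (use pos in \<open>simp add: s_def\<close>)
      moreover have "((n + \<alpha>) + (n + \<beta>)) + 1 - real n = real n + \<alpha> + \<beta> + 1" "((n + \<alpha>) + (n + \<beta>)) + 1 = 2 * real n + \<alpha> + \<beta> + 1" by simp_all
      ultimately have "\<Lambda> n * g1 = g2" unfolding g1_def g2_def by (simp only:)
      then have L: "\<Lambda> n = g2 / g1" using gpos by (simp add: field_simps)
      have G2: "Gamma ((n + \<alpha> + 1) + (n + \<beta> + 1)) = s2 * g2"
      proof -
        have "(n + \<alpha> + 1) + (n + \<beta> + 1) = s2 + 1" by (simp add: s2_def)
        moreover have "Gamma (s2 + 1) = s2 * Gamma s2" using pos by (intro Gamma_plus1) auto
        ultimately show ?thesis by (simp only: g2_def s2_def)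
      qed
      have nab: "n + \<alpha> > -1" "n + \<beta> > -1" using ab by auto
      have "n + \<alpha> + (n + \<beta>) + 1 = real n + real n + (\<alpha> + \<beta> + 1)" by simp
      then have "2 powr (n + \<alpha> + (n + \<beta>) + 1) = 2 ^ n * 2 ^ n * 2 powr (\<alpha> + \<beta> + 1)"
        by (simp only: powr_add) (simp add: powr_realpow)
      then have B: "B n = 2 ^ n * 2 ^ n * 2 powr (\<alpha> + \<beta> + 1) * (gam * gb / (s2 * g2))"
        unfolding B_def jacobi_moment_1[OF nab] Beta_def G2 by (simp add: gam_def gb_def)
      define p where "p = (2::real) powr (\<alpha> + \<beta> + 1)"
      have p: "p > 0" by (simp add: p_def)
      have pm: "2 powr (- (\<alpha> + \<beta> + 1)) = 1 / p" unfolding p_def by (rule powr_minus_divide)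
      define f where "f = (fact n :: real)"
      have f: "f > 0" by (simp add: f_def)
      have s1: "\<sigma> (\<alpha> + \<beta> + 1) n = s * g1 / (f * (n * (real n powr \<alpha> * real n powr \<beta>)))"
      proof -
        have "Gamma (real n + (\<alpha> + \<beta> + 1) + 1) = s * g1"
        proof -
          have "real n + (\<alpha> + \<beta> + 1) + 1 = s + 1" by (simp add: s_def)
          moreover have "Gamma (s + 1) = s * Gamma s" using pos by (intro Gamma_plus1) auto
          ultimately show ?thesis by (simp only: g1_def s_def)
        qed
        moreover have "real n powr (\<alpha> + \<beta> + 1) = n * (real n powr \<alpha> * real n powr \<beta>)"
          using elim by (simp add: powr_add)
        ultimately show ?thesis unfolding \<sigma>_def f_def by (simp only:)
      qed
      have sa: "\<sigma> \<alpha> n = gam / (f * real n powr \<alpha>)" "\<sigma> \<beta> n = gb / (f * real n powr \<beta>)"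
        by (simp_all add: \<sigma>_def gam_def gb_def f_def)
      define na nb where "na = real n powr \<alpha>" and "nb = real n powr \<beta>"
      have nn: "na > 0" "nb > 0" using elim by (auto simp: na_def nb_def)
      have V: "V n = f * g1 * s2 / (n * p * gam * gb)"
        unfolding V_def s1 sa pm na_def[symmetric] nb_def[symmetric] s_def[symmetric] s2_def[symmetric]
        using f p nn pos gpos elim by (simp add: field_simps)
      have "(f * 2 ^ n / sqrt (f * \<Lambda> n * B n * n))\<^sup>2 = (f * 2 ^ n)\<^sup>2 / (f * \<Lambda> n * B n * n)"
        unfolding L B p_def[symmetric] power_divide using f p gpos pos elim by (subst real_sqrt_pow2) auto
      also have "\<dots> = V n"
        unfolding V L B p_def[symmetric] using f p gpos pos elim by (simp add: field_simps power2_eq_square)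
      finally have sq: "(f * 2 ^ n / sqrt (f * \<Lambda> n * B n * n))\<^sup>2 = V n" .
      have "f * 2 ^ n / sqrt (f * \<Lambda> n * B n * n) \<ge> 0"
        unfolding L B using f gpos pos by (auto intro!: divide_nonneg_nonneg)
      then show ?case using sq unfolding f_def by (metis real_sqrt_unique)
    qed
  qed
qed

text \<open>Darboux's formula at the midpoint of the interval. It is stated as a difference tending
  to 0 because the oscillating main term has no limit.\<close>

lemma jacobi_at_0:
  "(\<lambda>n. sqrt k * poly (G n) 0 - sqrt (2 / pi) * cos (real n * pi / 2 + (\<beta> - \<alpha>) * pi / 4)) \<longlonglongrightarrow> 0"
proof -
  define \<Lambda> :: "nat \<Rightarrow> real" where "\<Lambda> = (\<lambda>n::nat. \<Prod>i<n. (n + \<alpha>) + (n + \<beta>) - real i)"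
  define B :: "nat \<Rightarrow> real" where "B = (\<lambda>n::nat. jacobi_moment (n + \<alpha>) (n + \<beta>) 1)"
  define W where "W n = fact n * 2 ^ n / sqrt (fact n * \<Lambda> n * B n * n)" for n
  define I where "I n = integral {0..pi} (\<lambda>t. of_real (sin t ^ n) * jacobi_amp \<alpha> \<beta> t)" for n
  define \<delta> where "\<delta> = (\<beta> - \<alpha>) * pi / 4"
  define w where "w = (2::real) powr ((\<alpha> + \<beta>) / 2)"
  have w: "w > 0" by (simp add: w_def)
  have W: "W \<longlonglongrightarrow> 1 / w"
  proof -
    have "2 powr (- (\<alpha> + \<beta>) / 2) = 1 / w"
      unfolding w_def minus_divide_left[symmetric] by (rule powr_minus_divide)
    then show ?thesis using normalization_limit unfolding W_def \<Lambda>_def B_def by simp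
  qed
  have I: "(\<lambda>n. of_real (sqrt (real n)) * I n) \<longlonglongrightarrow> of_real (sqrt (2 * pi)) * (of_real w * cis \<delta>)"
    unfolding I_def w_def \<delta>_def jacobi_amp_half_pi[symmetric]
    by (rule laplace_sin[OF jacobi_amp_continuous jacobi_amp_bound[OF ab]])
  \<comment> \<open>X has a limit; the oscillation in n is kept outside as the factor cis(n
    pi/2).\<close>
  define X where "X n = of_real (W n / pi) * (of_real (sqrt (real n)) * I n)" for n
  have "X \<longlonglongrightarrow> of_real (1 / w / pi) * (of_real (sqrt (2 * pi)) * (of_real w * cis \<delta>))"
    unfolding X_def by (intro tendsto_mult I tendsto_of_real tendsto_divide W) auto
  also have "of_real (1 / w / pi) * (of_real (sqrt (2 * pi)) * (of_real w * cis \<delta>)) = of_real (sqrt (2 / pi)) * cis \<delta>"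
  proof -
    have "1 / w / pi * (sqrt (2 * pi) * w) = sqrt (2 * pi) / pi" using w by simp
    also have "\<dots> = sqrt (2 / pi)"
      by (rule real_sqrt_unique[symmetric]) (auto simp: power_divide power2_eq_square)
    finally show ?thesis by (simp only: mult.assoc[symmetric] of_real_mult[symmetric])
  qed
  finally have X: "X \<longlonglongrightarrow> of_real (sqrt (2 / pi)) * cis \<delta>" .
  have eq: "sqrt k * poly (G n) 0 = Re (cis (real n * pi / 2) * X n)" if n: "n \<ge> 1" for n
  proof -
    \<comment> \<open>The sign (-1)^n of Rodrigues' formula reverses the rotation left over from the
      unit circle.\<close>
    have cc: "(-1) ^ n * cis (- (real n * pi / 2)) = cis (real n * pi / 2)"
    proof -
      have "(-1) ^ n = cis (real n * pi)" by (simp add: complex_eq_iff)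
      then show ?thesis by (simp add: cis_mult mult.commute)
    qed
    have "poly (G n) 0 = (-1) ^ n * (fact n * 2 ^ n / pi * Re (cis (- (real n * pi / 2)) * I n)) / sqrt (k * fact n * \<Lambda> n * B n)"
      unfolding jacobi_value_0 rodrigues_integral[OF n ab] \<Lambda>_def B_def I_def ..
    also have "\<dots> = fact n * 2 ^ n / (pi * sqrt (k * fact n * \<Lambda> n * B n)) * ((-1) ^ n * Re (cis (- (real n * pi / 2)) * I n))"
      by simp
    also have "(-1) ^ n * Re (cis (- (real n * pi / 2)) * I n) = Re (cis (real n * pi / 2) * I n)"
    proof -
      have "(-1) ^ n * Re z = Re ((-1) ^ n * z)" for z by (cases "even n") auto
      then show ?thesis unfolding cc[symmetric] by (simp only: mult.assoc)
    qed
    also have "fact n * 2 ^ n / (pi * sqrt (k * fact n * \<Lambda> n * B n)) = W n / pi * sqrt n / sqrt k"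
      using n k unfolding W_def by (simp add: real_sqrt_mult)
    finally have "sqrt k * poly (G n) 0 = (W n / pi * sqrt n) * Re (cis (real n * pi / 2) * I n)"
      using k by simp
    also have "\<dots> = Re (of_real (W n / pi * sqrt n) * (cis (real n * pi / 2) * I n))"
    proof -
      have "r * Re z = Re (of_real r * z)" for r z by simp
      then show ?thesis .
    qed
    also have "of_real (W n / pi * sqrt n) * (cis (real n * pi / 2) * I n) = cis (real n * pi / 2) * X n"
      unfolding X_def by (simp add: mult_ac)
    finally show ?thesis .
  qed
  have "(\<lambda>n. X n - of_real (sqrt (2 / pi)) * cis \<delta>) \<longlonglongrightarrow> 0" using X by (simp add: LIM_zero_iff)
  from tendsto_norm_zero[OF this] show ?thesis
  proof (rule Lim_null_comparison[rotated])
    show "\<forall>\<^sub>F n in sequentially. norm (sqrt k * poly (G n) 0 - sqrt (2 / pi) * cos (real n * pi / 2 + (\<beta> - \<alpha>) * pi / 4)) \<le> norm (X n - of_real (sqrt (2 / pi)) * cis \<delta>)"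
      using eventually_ge_at_top[of 1]
    proof eventually_elim
      case (elim n)
      have "sqrt (2 / pi) * cos (real n * pi / 2 + \<delta>) = Re (cis (real n * pi / 2) * (of_real (sqrt (2 / pi)) * cis \<delta>))"
        by (simp add: cos_add algebra_simps)
      then have "sqrt k * poly (G n) 0 - sqrt (2 / pi) * cos (real n * pi / 2 + \<delta>) = Re (cis (real n * pi / 2) * (X n - of_real (sqrt (2 / pi)) * cis \<delta>))"
        unfolding eq[OF elim] by (simp only: right_diff_distrib minus_complex.sel)
      then have "norm (sqrt k * poly (G n) 0 - sqrt (2 / pi) * cos (real n * pi / 2 + \<delta>)) \<le> cmod (cis (real n * pi / 2) * (X n - of_real (sqrt (2 / pi)) * cis \<delta>))"
        using abs_Re_le_cmod by (metis real_norm_def)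
      then show ?case by (simp add: norm_mult \<delta>_def)
    qed
  qed
qed

end

section \<open>Liouville-Green approximation\<close>

context jacobi_polys begin

text \<open>The shift that completes the square in the eigenvalue: n (n + \<alpha> + \<beta> + 1) =
  (n + gam)^2 - gam^2.\<close>

definition gam :: real where "gam = (\<alpha> + \<beta> + 1) / 2"
text \<open>Half the exponents of \<tau>(cos t) sin t in 1 - cos t and, in the next definition, in 1
  + cos t: since sin t is the square root of (1 - cos t) (1 + cos t), it adds 1/4 to each
  half.\<close>

definition exp_left :: real where "exp_left = \<alpha> / 2 + 1 / 4"
definition exp_right :: real where "exp_right = \<beta> / 2 + 1 / 4"
text \<open>On (0, pi) this is the square root of \<tau>(cos t) sin t, the factor that removes the
  first-order term from the Jacobi equation in t. The form by exp and ln makes its logarithmic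
  derivative immediate.\<close>

definition lv_weight :: "real \<Rightarrow> real" where
  "lv_weight t = sqrt k * exp (exp_left * ln (1 - cos t) + exp_right * ln (1 + cos t))"
text \<open>The logarithmic derivative of \<open>lv_weight\<close>, brought to the denominator sin
  t.\<close>

definition lv_slope :: "real \<Rightarrow> real" where
  "lv_slope t = ((exp_left - exp_right) + (exp_left + exp_right) * cos t) / sin t"
definition lv_slope' :: "real \<Rightarrow> real" where
  "lv_slope' t = - (exp_left + exp_right) - ((exp_left - exp_right) + (exp_left + exp_right) * cos t) * cos t / (sin t)\<^sup>2"
text \<open>The last two terms are the second derivative of \<open>lv_weight\<close> divided by
  \<open>lv_weight\<close>; the first one compensates the completion of the square. The result is
  independent of n.\<close>

definition lv_potential :: "real \<Rightarrow> real" where "lv_potential t = gam\<^sup>2 + (lv_slope t)\<^sup>2 + lv_slope' t"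
definition lv_sol :: "nat \<Rightarrow> real \<Rightarrow> real" where "lv_sol n t = lv_weight t * poly (G n) (cos t)"
definition lv_sol' :: "nat \<Rightarrow> real \<Rightarrow> real" where
  "lv_sol' n t = lv_weight t * (lv_slope t * poly (G n) (cos t) - sin t * poly (pderiv (G n)) (cos t))"
text \<open>\<open>lv_sol\<close> solves \<open>u'' = (lv_potential - (n + gam)\<^sup>2) u\<close>; without the potential \<open>lv_amp\<close> would be constant.\<close>

definition lv_amp :: "nat \<Rightarrow> real \<Rightarrow> complex" where
  "lv_amp n t = (of_real (lv_sol n t) - \<i> * of_real (lv_sol' n t / (n + gam))) * cis (- ((n + gam) * (t - pi / 2)))"

lemma lv_sol_deriv:
  assumes t: "0 < t" "t < pi"
  shows "(lv_sol n has_real_derivative lv_sol' n t) (at t)"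
    and "(lv_sol' n has_real_derivative (lv_potential t - (n + gam)\<^sup>2) * lv_sol n t) (at t)"
proof -
  have s: "sin t > 0" using t by (rule sin_gt_zero)
  have "cos t < cos 0" "cos pi < cos t" using t by (intro cos_monotone_0_pi; simp)+
  then have c: "1 - cos t > 0" "1 + cos t > 0" by auto
  have s2: "sin t * sin t = (1 - cos t) * (1 + cos t)"
    using sin_cos_squared_add[of t] by (simp add: power2_eq_square algebra_simps)
  have "exp_left * (sin t / (1 - cos t)) + exp_right * (- sin t / (1 + cos t)) = lv_slope t"
  proof -
    have 1: "sin t / (1 - cos t) = (1 + cos t) / sin t" "sin t / (1 + cos t) = (1 - cos t) / sin t"
      using s c s2 by (simp_all add: field_simps)
    have "exp_left * (sin t / (1 - cos t)) + exp_right * (- sin t / (1 + cos t)) = exp_left * ((1 + cos t) / sin t) - exp_right * ((1 - cos t) / sin t)"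
      unfolding 1[symmetric] by simp
    also have "\<dots> = lv_slope t" using s unfolding lv_slope_def by (simp add: field_simps)
    finally show ?thesis .
  qed
  then have dS: "(lv_weight has_real_derivative lv_slope t * lv_weight t) (at t)"
    unfolding lv_weight_def[abs_def] using c
    by (auto intro!: derivative_eq_intros simp: algebra_simps)
  have dr: "(lv_slope has_real_derivative lv_slope' t) (at t)"
    unfolding lv_slope_def[abs_def] lv_slope'_def using s
    by (auto intro!: derivative_eq_intros simp: field_simps power2_eq_square)
  have dG: "((\<lambda>t. poly p (cos t)) has_real_derivative - (sin t * poly (pderiv p) (cos t))) (at t)" for p
    by (auto intro!: derivative_eq_intros DERIV_chain'[of cos "- sin t" t _ "poly p", OF DERIV_cos poly_DERIV] simp: mult.commute)
  show "(lv_sol n has_real_derivative lv_sol' n t) (at t)"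
    unfolding lv_sol_def[abs_def] lv_sol'_def
    using DERIV_mult'[OF dS dG[of "G n"]] by (simp add: algebra_simps)
  let ?g = "poly (G n) (cos t)" and ?g' = "poly (pderiv (G n)) (cos t)" and ?g'' = "poly (pderiv (pderiv (G n))) (cos t)"
  have d1: "((\<lambda>t. lv_slope t * poly (G n) (cos t) - sin t * poly (pderiv (G n)) (cos t)) has_real_derivative
      (lv_slope t * - (sin t * ?g') + lv_slope' t * ?g) - (sin t * - (sin t * ?g'') + cos t * ?g')) (at t)"
    by (intro DERIV_diff DERIV_mult' dr dG DERIV_sin)
  have ode: "(sin t)\<^sup>2 * ?g'' = - (\<beta> - \<alpha> - (\<alpha> + \<beta> + 2) * cos t) * ?g' - (real n * (n + \<alpha> + \<beta> + 1)) * ?g"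
    using jacobi_ode[of "cos t" n] by (simp add: sin_squared_eq algebra_simps)
  have wrs: "lv_slope t * sin t = (exp_left - exp_right) + (exp_left + exp_right) * cos t" using s by (simp add: lv_slope_def)
  have N: "(n + gam)\<^sup>2 = gam\<^sup>2 + real n * (n + \<alpha> + \<beta> + 1)" by (simp add: gam_def power2_eq_square algebra_simps add_divide_distrib)
  have "(lv_weight t * ((lv_slope t * - (sin t * ?g') + lv_slope' t * ?g) - (sin t * - (sin t * ?g'') + cos t * ?g')) + lv_slope t * lv_weight t * (lv_slope t * ?g - sin t * ?g'))
    = lv_weight t * ((lv_slope t)\<^sup>2 * ?g + lv_slope' t * ?g - 2 * (lv_slope t * sin t) * ?g' - cos t * ?g' + (sin t)\<^sup>2 * ?g'')"
    by (simp add: algebra_simps power2_eq_square)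
  also have "\<dots> = (lv_potential t - (n + gam)\<^sup>2) * (lv_weight t * ?g)"
    unfolding wrs ode lv_potential_def N by (simp add: exp_left_def exp_right_def algebra_simps add_divide_distrib)
  finally show "(lv_sol' n has_real_derivative (lv_potential t - (n + gam)\<^sup>2) * lv_sol n t) (at t)"
    using DERIV_mult'[OF dS d1] unfolding lv_sol'_def[abs_def] lv_sol_def by simp
qed

lemma n_gam_pos: "n \<ge> 1 \<Longrightarrow> real n + gam > 0"
proof -
  assume "n \<ge> 1"
  then have "real n \<ge> 1" by simp
  then show ?thesis unfolding gam_def using ab by (simp add: field_simps)
qed

text \<open>Variation of constants: in the frame rotating with frequency n + gam the free motion is
  at rest, and the potential enters divided by n + gam. This division is the source of the O(1/n)
  error.\<close>

lemma lv_amp_deriv: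
  assumes t: "0 < t" "t < pi" and n: "n \<ge> 1"
  shows "(lv_amp n has_vector_derivative (- \<i> * of_real (lv_potential t * lv_sol n t / (n + gam)) * cis (- ((n + gam) * (t - pi / 2))))) (at t)"
proof -
  define N where "N = real n + gam"
  have N: "N > 0" using n_gam_pos[OF n] by (simp add: N_def)
  have du: "((\<lambda>t. complex_of_real (lv_sol n t)) has_vector_derivative of_real (lv_sol' n t)) (at t)"
    by (intro has_vector_derivative_of_real lv_sol_deriv t)
  have "((\<lambda>t. lv_sol' n t / N) has_real_derivative ((lv_potential t - N\<^sup>2) * lv_sol n t) / N) (at t)"
    unfolding N_def by (intro DERIV_cdivide lv_sol_deriv t)
  then have dv: "((\<lambda>t. \<i> * complex_of_real (lv_sol' n t / N)) has_vector_derivative \<i> * of_real (((lv_potential t - N\<^sup>2) * lv_sol n t) / N)) (at t)"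
    by (intro has_vector_derivative_mult_right has_vector_derivative_of_real)
  have dc: "((\<lambda>t. cis (- (N * (t - pi / 2)))) has_vector_derivative (- \<i> * of_real N * cis (- (N * (t - pi / 2))))) (at t)"
    unfolding has_vector_derivative_def
    by (auto intro!: derivative_eq_intros simp: fun_eq_iff scaleR_conv_of_real)
  have "(lv_amp n has_vector_derivative ((of_real (lv_sol n t) - \<i> * of_real (lv_sol' n t / N)) * (- \<i> * of_real N * cis (- (N * (t - pi / 2))))
     + (of_real (lv_sol' n t) - \<i> * of_real (((lv_potential t - N\<^sup>2) * lv_sol n t) / N)) * cis (- (N * (t - pi / 2))))) (at t)"
    unfolding lv_amp_def[abs_def] N_def[symmetric]
    by (intro has_vector_derivative_mult has_vector_derivative_diff du dv dc)
  moreover have "(of_real (lv_sol n t) - \<i> * of_real (lv_sol' n t / N)) * (- \<i> * of_real N * cis (- (N * (t - pi / 2))))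
     + (of_real (lv_sol' n t) - \<i> * of_real (((lv_potential t - N\<^sup>2) * lv_sol n t) / N)) * cis (- (N * (t - pi / 2)))
     = - \<i> * of_real (lv_potential t * lv_sol n t / N) * cis (- (N * (t - pi / 2)))"
  proof -
    have "(of_real (lv_sol n t) - \<i> * of_real (lv_sol' n t / N)) * (- \<i> * of_real N)
     + (of_real (lv_sol' n t) - \<i> * of_real (((lv_potential t - N\<^sup>2) * lv_sol n t) / N)) = - \<i> * of_real (lv_potential t * lv_sol n t / N)"
      using N by (simp add: complex_eq_iff field_simps power2_eq_square)
    then show ?thesis by (metis (no_types, lifting) distrib_right mult.assoc)
  qed
  ultimately show ?thesis unfolding N_def by simp
qed

lemma lv_sol_eq_Re: "n \<ge> 1 \<Longrightarrow> lv_sol n t = Re (lv_amp n t * cis ((n + gam) * (t - pi / 2)))"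
  by (simp add: lv_amp_def mult.assoc cis_mult)

lemma lv_sol_le_amp: "n \<ge> 1 \<Longrightarrow> \<bar>lv_sol n t\<bar> \<le> cmod (lv_amp n t)"
  unfolding lv_amp_def norm_mult using abs_Re_le_cmod[of "of_real (lv_sol n t) - \<i> * of_real (lv_sol' n t / (n + gam))"] by simp

definition lv_amp0 :: "nat \<Rightarrow> complex" where "lv_amp0 n = lv_amp n (pi / 2)"

text \<open>The real part is the value at 0, and the imaginary part comes from the derivative at 0,
  which is again a value at 0 for the raised parameters. The first gives the cosine and the second
  the sine of the same phase, so that together they form an exponential.\<close>

lemma lv_amp0_limit:
  "(\<lambda>n. lv_amp0 n * cis (- (real n * pi / 2 + (\<beta> - \<alpha>) * pi / 4))) \<longlonglongrightarrow> of_real (sqrt (2 / pi))"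
proof -
  define a where "a = sqrt (2 / pi)"
  define ph where "ph n = real n * pi / 2 + (\<beta> - \<alpha>) * pi / 4" for n
  define X where "X n = sqrt k * poly (G n) 0" for n
  define Y where "Y n = sqrt k * poly (pderiv (G n)) 0 / (n + gam)" for n
  have X: "(\<lambda>n. X n - a * cos (ph n)) \<longlonglongrightarrow> 0"
    using jacobi_at_0 unfolding X_def a_def ph_def .
  \<comment> \<open>Raising both parameters leaves \<beta> - \<alpha> unchanged, while the degree
    drops by one. The phase therefore moves by a quarter turn, and the cosine of
    \<open>jacobi_at_0\<close> becomes a sine.\<close>
  interpret d: jacobi_polys k "\<alpha> + 1" "\<beta> + 1" "\<lambda>n. smult (1 / sqrt ((real n + 1) * (real n + \<alpha> + \<beta> + 2))) (pderiv (G (Suc n)))"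
    by (rule jacobi_deriv)
  have Y: "(\<lambda>n. Y n - a * sin (ph n)) \<longlonglongrightarrow> 0"
  proof (rule LIMSEQ_imp_Suc)
    define Z where "Z m = sqrt k * (1 / sqrt ((real m + 1) * (real m + \<alpha> + \<beta> + 2)) * poly (pderiv (G (Suc m))) 0)" for m
    have Z: "(\<lambda>m. Z m - a * sin (ph (Suc m))) \<longlonglongrightarrow> 0"
    proof -
      have "cos (real m * pi / 2 + (\<beta> - \<alpha>) * pi / 4) = sin (ph (Suc m))" for m
      proof -
        have "ph (Suc m) = (real m * pi / 2 + (\<beta> - \<alpha>) * pi / 4) + pi / 2" by (simp add: ph_def algebra_simps add_divide_distrib)
        then show ?thesis by (simp only: sin_add) simp
      qed
      then show ?thesis using d.jacobi_at_0 unfolding Z_def a_def by simp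
    qed
    define qq where "qq m = sqrt ((real m + 1) * (real m + \<alpha> + \<beta> + 2)) / (real (Suc m) + gam)" for m
    have q: "qq \<longlonglongrightarrow> 1"
      unfolding qq_def by real_asymp
    have YZ: "Y (Suc m) = Z m * qq m" for m
    proof -
      have "real m + \<alpha> + \<beta> + 2 > 0" using ab by auto
      then show ?thesis unfolding Y_def Z_def qq_def using n_gam_pos[of "Suc m"] by simp
    qed
    have "(\<lambda>m. (Z m - a * sin (ph (Suc m))) * qq m
        + a * sin (ph (Suc m)) * (qq m - 1)) \<longlonglongrightarrow> 0 * 1 + 0"
    proof (intro tendsto_add tendsto_mult Z q)
      have q': "(\<lambda>m. qq m - 1) \<longlonglongrightarrow> 0"
        using tendsto_diff[OF q tendsto_const[of 1]] by simp
      show "(\<lambda>m. a * sin (ph (Suc m)) * (qq m - 1)) \<longlonglongrightarrow> 0"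
      proof (rule Lim_null_comparison[OF _ tendsto_mult_right_zero[OF tendsto_norm_zero[OF q'], of "\<bar>a\<bar>"]])
        show "\<forall>\<^sub>F m in sequentially. norm (a * sin (ph (Suc m)) * (qq m - 1))
          \<le> \<bar>a\<bar> * norm (qq m - 1)"
          by (intro always_eventually allI) (simp add: abs_mult mult_left_le mult_right_mono)
      qed
    qed
    then show "(\<lambda>n. Y (Suc n) - a * sin (ph (Suc n))) \<longlonglongrightarrow> 0"
      unfolding YZ by (simp add: algebra_simps)
  qed
  \<comment> \<open>At pi/2 the logarithmic derivative of the weight adds a multiple of the value
    itself to the derivative; after division by n + gam this contribution disappears.\<close>
  have XN: "(\<lambda>n. X n / (n + gam)) \<longlonglongrightarrow> 0"
  proof -
    have i: "(\<lambda>n. 1 / (real n + gam)) \<longlonglongrightarrow> 0" by real_asymp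
    have "(\<lambda>n. a * cos (ph n) * (1 / (real n + gam))) \<longlonglongrightarrow> 0"
    proof (rule Lim_null_comparison[OF _ tendsto_mult_right_zero[OF tendsto_norm_zero[OF i], of "\<bar>a\<bar>"]])
      show "\<forall>\<^sub>F n in sequentially. norm (a * cos (ph n) * (1 / (real n + gam))) \<le> \<bar>a\<bar> * norm (1 / (real n + gam))"
        by (intro always_eventually allI) (simp add: abs_mult mult_left_le divide_right_mono)
    qed
    from tendsto_add[OF tendsto_mult[OF X i] this] show ?thesis by (simp add: algebra_simps diff_divide_distrib)
  qed
  have C: "lv_amp0 n = of_real (X n) - \<i> * of_real ((exp_left - exp_right) * (X n / (n + gam)) - Y n)" for n
    by (simp add: lv_amp0_def lv_amp_def lv_sol_def lv_sol'_def lv_weight_def lv_slope_def X_def Y_def algebra_simps diff_divide_distrib add_divide_distrib)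
  have "(\<lambda>n. of_real (X n - a * cos (ph n)) - \<i> * of_real ((exp_left - exp_right) * (X n / (n + gam)) - (Y n - a * sin (ph n)))) \<longlonglongrightarrow> of_real 0 - \<i> * of_real ((exp_left - exp_right) * 0 - 0)"
    by (intro tendsto_intros X Y XN)
  moreover have "of_real (X n - a * cos (ph n)) - \<i> * of_real ((exp_left - exp_right) * (X n / (n + gam)) - (Y n - a * sin (ph n))) = lv_amp0 n - of_real a * cis (ph n)" for n
    unfolding C by (simp add: complex_eq_iff)
  ultimately have l: "(\<lambda>n. lv_amp0 n - of_real a * cis (ph n)) \<longlonglongrightarrow> 0" by simp
  have "(\<lambda>n. lv_amp0 n * cis (- ph n) - of_real a) \<longlonglongrightarrow> 0"
  proof (rule Lim_null_comparison[OF _ tendsto_norm_zero[OF l]])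
    have "lv_amp0 n * cis (- ph n) - of_real a = (lv_amp0 n - of_real a * cis (ph n)) * cis (- ph n)" for n
      by (simp add: left_diff_distrib mult.assoc cis_mult)
    then show "\<forall>\<^sub>F n in sequentially. norm (lv_amp0 n * cis (- ph n) - of_real a) \<le> norm (lv_amp0 n - of_real a * cis (ph n))"
      by (simp add: norm_mult)
  qed
  then show ?thesis unfolding ph_def a_def by (simp add: LIM_zero_iff)
qed

text \<open>The derivative of \<open>lv_amp\<close> is bounded by the potential times
  \<open>lv_amp\<close> over n + gam. Applied to the maximum m of its modulus on the interval, this
  reads m \<le> L + m/2 for large n, hence m \<le> 2 L, and a second use of the same estimate gives
  the O(1/n) distance from the initial value.\<close>

lemma liouville_green:
  assumes A: "0 < A" "A \<le> pi / 2"
  obtains K n0 where "\<And>n t. n \<ge> n0 \<Longrightarrow> t \<in> {A..pi / 2} \<Longrightarrow> \<bar>lv_sol n t - Re (lv_amp0 n * cis ((n + gam) * (t - pi / 2)))\<bar> \<le> K / n"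
proof -
  have tt: "0 < t" "t < pi" if "t \<in> {A..pi / 2}" for t using that A pi_gt_zero by (auto simp del: pi_gt_zero)
  have "continuous_on {A..pi / 2} lv_potential"
    unfolding lv_potential_def lv_slope_def lv_slope'_def
    by (intro continuous_intros) (use tt sin_gt_zero in \<open>fastforce simp: power2_eq_square\<close>)+
  then have "bounded (lv_potential ` {A..pi / 2})" by (intro compact_imp_bounded compact_continuous_image) auto
  then obtain M where M: "\<And>t. t \<in> {A..pi / 2} \<Longrightarrow> \<bar>lv_potential t\<bar> \<le> M"
    unfolding bounded_iff by (auto simp del: atLeastAtMost_iff)
  have M0: "M \<ge> 0" using order_trans[OF abs_ge_zero M[of A]] A by simp
  have "Bseq (\<lambda>n. lv_amp0 n * cis (- (real n * pi / 2 + (\<beta> - \<alpha>) * pi / 4)))"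
    using lv_amp0_limit by (intro convergent_imp_Bseq) (auto simp: convergent_def)
  then obtain L where L: "\<And>n. cmod (lv_amp0 n) \<le> L" "L > 0"
    by (auto simp: Bseq_def norm_mult)
  \<comment> \<open>This size gives n + gam \<ge> pi M, so that the feedback term is at most m/2,
    and also n + gam \<ge> 1.\<close>
  obtain n0 :: nat where n0: "real n0 \<ge> pi * M + \<bar>gam\<bar> + 1" using real_arch_simple by blast
  have main: "cmod (lv_amp n t - lv_amp0 n) \<le> (4 * M * L) * (1 + \<bar>gam\<bar>) / n" if n: "n \<ge> n0" and t: "t \<in> {A..pi / 2}" for n t
  proof -
    define N where "N = real n + gam"
    have rn: "real n \<ge> pi * M + \<bar>gam\<bar> + 1" using n n0 by linarith
    have n1: "n \<ge> 1"
    proof -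
      have "pi * M \<ge> 0" using M0 by simp
      then have "real n \<ge> 1" using rn by linarith
      then show ?thesis by simp
    qed
    have N: "N \<ge> pi * M" "N \<ge> 1" 
    proof -
      have "0 \<le> pi * M" using M0 by simp
      then show "N \<ge> pi * M" "N \<ge> 1" unfolding N_def using rn by linarith+
    qed
    have cd: "(lv_amp n has_vector_derivative (- \<i> * of_real (lv_potential s * lv_sol n s / N) * cis (- (N * (s - pi / 2))))) (at s within S)"
      if "s \<in> {A..pi / 2}" for s S
      unfolding N_def using lv_amp_deriv[OF tt[OF that] n1] by (rule has_vector_derivative_at_within)
    have wcc: "continuous_on {A..pi / 2} (lv_amp n)"
      using cd by (meson continuous_on_eq_continuous_within has_vector_derivative_continuous)
    obtain t0 where t0: "t0 \<in> {A..pi / 2}" "\<And>s. s \<in> {A..pi / 2} \<Longrightarrow> cmod (lv_amp n s) \<le> cmod (lv_amp n t0)"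
      using continuous_attains_sup[OF _ _ continuous_on_norm[OF wcc]] A by (auto simp del: atLeastAtMost_iff)
    define m where "m = cmod (lv_amp n t0)"
    have diff: "cmod (lv_amp0 n - lv_amp n s) \<le> M * m / N * (pi / 2)" if s: "s \<in> {A..pi / 2}" for s
    proof -
      have FI: "((\<lambda>s. - \<i> * of_real (lv_potential s * lv_sol n s / N) * cis (- (N * (s - pi / 2)))) has_integral (lv_amp n (pi / 2) - lv_amp n s)) {s..pi / 2}"
      proof (rule fundamental_theorem_of_calculus)
        fix x assume "x \<in> {s..pi / 2}"
        then show "(lv_amp n has_vector_derivative (- \<i> * of_real (lv_potential x * lv_sol n x / N) * cis (- (N * (x - pi / 2))))) (at x within {s..pi / 2})"
          using s by (intro cd) auto
      qed (use s in auto)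
      have "cmod (lv_amp n (pi / 2) - lv_amp n s) \<le> M * m / N * measure lborel {s..pi / 2}"
      proof (rule has_integral_bound_real[OF _ finite.emptyI FI])
        show "0 \<le> M * m / N" using M0 N by (simp add: m_def)
        fix r assume r: "r \<in> {s..pi / 2} - {}"
        then have r: "r \<in> {A..pi / 2}" using s by auto
        have "cmod (- \<i> * of_real (lv_potential r * lv_sol n r / N) * cis (- (N * (r - pi / 2)))) = \<bar>lv_potential r\<bar> * \<bar>lv_sol n r\<bar> / N"
          using N by (simp add: norm_mult norm_divide)
        also have "\<dots> \<le> M * m / N"
          using M[OF r] order_trans[OF lv_sol_le_amp[OF n1, of r] t0(2)[OF r]] N M0
          by (intro divide_right_mono mult_mono) (auto simp: m_def)
        finally show "cmod (- \<i> * of_real (lv_potential r * lv_sol n r / N) * cis (- (N * (r - pi / 2)))) \<le> M * m / N" .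
      qed
      also have "\<dots> = M * m / N * (pi / 2 - s)" using s by simp
      also have "\<dots> \<le> M * m / N * (pi / 2)"
        using s A M0 N by (intro mult_left_mono) (auto simp: m_def)
      finally show ?thesis by (simp add: lv_amp0_def)
    qed
    \<comment> \<open>The maximum appears on both sides; half of it is absorbed on the left.\<close>
    have "m \<le> cmod (lv_amp0 n) + cmod (lv_amp0 n - lv_amp n t0)"
      unfolding m_def using norm_triangle_ineq2[of "lv_amp n t0" "lv_amp0 n"] by (simp add: norm_minus_commute)
    also have "\<dots> \<le> L + M * m / N * (pi / 2)" using L(1)[of n] diff[OF t0(1)] by simp
    also have "M * m / N * (pi / 2) = (pi * M / N) * (m / 2)" by simp
    also have "\<dots> \<le> 1 * (m / 2)" using N by (intro mult_right_mono) (auto simp: m_def)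
    finally have m2: "m \<le> 2 * L" by simp
    have "cmod (lv_amp n t - lv_amp0 n) \<le> M * m / N * (pi / 2)" using diff[OF t] by (simp add: norm_minus_commute)
    also have "\<dots> \<le> M * (2 * L) / N * 2"
      using m2 M0 N L(2) pi_less_4 by (intro mult_mono divide_right_mono mult_left_mono) (auto simp: m_def)
    also have "\<dots> = 4 * M * L * (1 / N)" by simp
    also have "\<dots> \<le> 4 * M * L * ((1 + \<bar>gam\<bar>) / n)"
    proof (intro mult_left_mono)
      have "real n \<le> (1 + \<bar>gam\<bar>) * N"
      proof -
        have "real n = N - gam" by (simp add: N_def)
        also have "\<dots> \<le> N + \<bar>gam\<bar> * N"
          using mult_left_mono[OF N(2) abs_ge_zero[of gam]] abs_ge_minus_self[of gam] by linarith
        finally show ?thesis by (simp add: algebra_simps)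
      qed
      then show "1 / N \<le> (1 + \<bar>gam\<bar>) / n" using N n1 by (simp add: field_simps)
    qed (use M0 L in auto)
    finally show ?thesis by simp
  qed
  have n01: "n0 \<ge> 1"
  proof -
    have "pi * M \<ge> 0" using M0 by simp
    then have "real n0 \<ge> 1" using n0 by linarith
    then show ?thesis by simp
  qed
  show ?thesis
  proof (rule that)
    fix n t assume n: "n \<ge> n0" and t: "t \<in> {A..pi / 2}"
    have n1: "n \<ge> 1" using n n01 by simp
    have "lv_sol n t - Re (lv_amp0 n * cis ((n + gam) * (t - pi / 2))) = Re ((lv_amp n t - lv_amp0 n) * cis ((n + gam) * (t - pi / 2)))"
      unfolding lv_sol_eq_Re[OF n1] by (simp add: left_diff_distrib)
    then have "\<bar>lv_sol n t - Re (lv_amp0 n * cis ((n + gam) * (t - pi / 2)))\<bar> \<le> cmod ((lv_amp n t - lv_amp0 n) * cis ((n + gam) * (t - pi / 2)))"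
      using abs_Re_le_cmod by metis
    also have "\<dots> \<le> (4 * M * L) * (1 + \<bar>gam\<bar>) / n" using main[OF n t] by (simp add: norm_mult)
    finally show "\<bar>lv_sol n t - Re (lv_amp0 n * cis ((n + gam) * (t - pi / 2)))\<bar> \<le> (4 * M * L) * (1 + \<bar>gam\<bar>) / n" .
  qed
qed

end

section \<open>Expansion coefficients and the unitary group\<close>

text \<open>Support in a compact part of (-1,1) keeps away from the end points, where the weight may
  be singular. The class is stable under multiplication by continuous functions, hence under powers
  of \<lambda> and under exp(-i \<lambda> t).\<close>

definition bdd_supp :: "(real \<Rightarrow> complex) \<Rightarrow> bool" where
  "bdd_supp g \<longleftrightarrow> g \<in> borel_measurable borel \<and>
     (\<exists>M l r. -1 < l \<and> l \<le> r \<and> r < 1 \<and> (\<forall>x. cmod (g x) \<le> M) \<and> (\<forall>x. x \<notin> {l..r} \<longrightarrow> g x = 0))"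

lemma bdd_supp_mult:
  assumes g: "bdd_supp g" and h: "continuous_on UNIV h"
  shows "bdd_supp (\<lambda>x. h x * g x)"
proof -
  obtain M l r where g': "g \<in> borel_measurable borel" "-1 < l" "l \<le> r" "r < 1" "\<And>x. cmod (g x) \<le> M" "\<And>x. x \<notin> {l..r} \<Longrightarrow> g x = 0"
    using g unfolding bdd_supp_def by blast
  have "bounded (h ` {l..r})"
    by (intro compact_imp_bounded compact_continuous_image continuous_on_subset[OF h]) auto
  then obtain M' where M': "\<And>x. x \<in> {l..r} \<Longrightarrow> cmod (h x) \<le> M'"
    unfolding bounded_iff by (auto simp del: atLeastAtMost_iff)
  have M0: "M' \<ge> 0" using order_trans[OF norm_ge_zero M'[of l]] g' by simp
  have "cmod (h x * g x) \<le> M' * M" for x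
  proof (cases "x \<in> {l..r}")
    case True
    then show ?thesis unfolding norm_mult using M' g'(5) M0 by (intro mult_mono) auto
  next
    case False
    have "M \<ge> 0" using order_trans[OF norm_ge_zero g'(5)] .
    then show ?thesis using False g'(6) M0 by simp
  qed
  moreover have "(\<lambda>x. h x * g x) \<in> borel_measurable borel"
    using g'(1) borel_measurable_continuous_onI[OF h] by measurable
  ultimately show ?thesis unfolding bdd_supp_def using g' by (intro conjI exI[of _ "M' * M"] exI[of _ l] exI[of _ r]) auto
qed

lemma bdd_supp_integrable:
  assumes "bdd_supp g" shows "integrable lborel g"
proof -
  obtain M l r where g: "g \<in> borel_measurable borel" "-1 < l" "l \<le> r" "r < 1" "\<And>x. cmod (g x) \<le> M" "\<And>x. x \<notin> {l..r} \<Longrightarrow> g x = 0"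
    using assms unfolding bdd_supp_def by blast
  show ?thesis
  proof (rule Bochner_Integration.integrable_bound)
    show "integrable lborel (\<lambda>x::real. indicator {l..r} x *\<^sub>R M)"
      by (intro integrable_scaleR_left integrable_real_indicator) (auto simp: emeasure_lborel_Icc_eq)
    show "AE x in lborel. norm (g x) \<le> norm (indicator {l..r} x *\<^sub>R M)"
    proof (rule AE_I2)
      fix x show "norm (g x) \<le> norm (indicator {l..r} x *\<^sub>R M)"
        using g(5)[of x] g(6)[of x] by (cases "x \<in> {l..r}") auto
    qed
  qed (use g in simp)
qed

context jacobi_polys begin

definition phi :: "nat \<Rightarrow> real \<Rightarrow> real" where
  "phi n x = indicator {-1<..<1} x * (sqrt (jacobi_weight k \<alpha> \<beta> x) * poly (G n) x)"

text \<open>The candidate for the inverse of \<Phi>; \<open>coef_is_Phi\<close> identifies it with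
  the given sequence.\<close>

definition coef :: "(real \<Rightarrow> complex) \<Rightarrow> nat \<Rightarrow> complex" where
  "coef g n = (LINT x|lborel. g x * of_real (phi n x))"

lemma phi_measurable [measurable]: "phi n \<in> borel_measurable borel"
  unfolding phi_def[abs_def] by measurable

lemma phi_orth: "has_bochner_integral lborel (\<lambda>x. complex_of_real (phi m x * phi n x)) (if m = n then 1 else 0)"
proof -
  have o: "orthonormal_polys (jacobi_weight k \<alpha> \<beta>) G"
    using ortho_jacobi_iff[OF ab] G by simp
  have "phi m x * phi n x = indicator {-1<..<1} x *\<^sub>R (poly (G m) x * poly (G n) x * jacobi_weight k \<alpha> \<beta> x)" for x
  proof (cases "x \<in> {-1<..<1}")
    case True
    then have "jacobi_weight k \<alpha> \<beta> x \<ge> 0" using k by (simp add: jacobi_weight_def)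
    then have "sqrt (jacobi_weight k \<alpha> \<beta> x) * sqrt (jacobi_weight k \<alpha> \<beta> x) = jacobi_weight k \<alpha> \<beta> x" by simp
    then have "sqrt (jacobi_weight k \<alpha> \<beta> x) * poly (G m) x * (sqrt (jacobi_weight k \<alpha> \<beta> x) * poly (G n) x)
      = poly (G m) x * poly (G n) x * jacobi_weight k \<alpha> \<beta> x"
      by (metis (no_types, opaque_lifting) mult.assoc mult.commute)
    then show ?thesis using True by (simp add: phi_def)
  qed (simp add: phi_def)
  then have "has_bochner_integral lborel (\<lambda>x. phi m x * phi n x) (if m = n then 1 else 0)"
    using o unfolding orthonormal_polys_def set_integrable_def set_lebesgue_integral_def has_bochner_integral_iff by simp
  from has_bochner_integral_of_real[OF this] show ?thesis by (simp split: if_splits)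
qed

lemma coef_integral:
  assumes "bdd_supp g"
  shows "has_bochner_integral lborel (\<lambda>x. g x * of_real (phi n x)) (coef g n)"
proof -
  obtain M l r where g: "g \<in> borel_measurable borel" "-1 < l" "l \<le> r" "r < 1" "\<And>x. cmod (g x) \<le> M" "\<And>x. x \<notin> {l..r} \<Longrightarrow> g x = 0"
    using assms unfolding bdd_supp_def by blast
  note g(1)[measurable]
  have "continuous_on {l..r} (\<lambda>x. sqrt (jacobi_weight k \<alpha> \<beta> x) * poly (G n) x)"
    unfolding jacobi_weight_def using g by (intro continuous_intros) auto
  then have "bounded ((\<lambda>x. sqrt (jacobi_weight k \<alpha> \<beta> x) * poly (G n) x) ` {l..r})"
    by (intro compact_imp_bounded compact_continuous_image) auto
  then obtain M' where M': "\<And>x. x \<in> {l..r} \<Longrightarrow> \<bar>sqrt (jacobi_weight k \<alpha> \<beta> x) * poly (G n) x\<bar> \<le> M'"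
    unfolding bounded_iff real_norm_def by (auto simp del: atLeastAtMost_iff)
  have M0: "M' \<ge> 0" using order_trans[OF abs_ge_zero M'[of l]] g by simp
  have "integrable lborel (\<lambda>x. g x * of_real (phi n x))"
  proof (rule Bochner_Integration.integrable_bound)
    show "integrable lborel (\<lambda>x. g x * of_real M')" by (intro integrable_mult_left bdd_supp_integrable assms)
    show "AE x in lborel. norm (g x * of_real (phi n x)) \<le> norm (g x * of_real M')"
    proof (rule AE_I2)
      fix x show "norm (g x * of_real (phi n x)) \<le> norm (g x * of_real M')"
      proof (cases "x \<in> {l..r}")
        case True
        then have "\<bar>phi n x\<bar> \<le> M'" using M'[OF True] g by (auto simp: phi_def)
        then show ?thesis unfolding norm_mult norm_of_real using M0 by (intro mult_left_mono) auto
      qed (simp add: g(6))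
    qed
  qed measurable
  then show ?thesis by (simp add: has_bochner_integral_iff coef_def)
qed

text \<open>Pythagoras for an orthonormal system with arbitrary coefficients d. Taking d to be the
  expansion coefficients yields Bessel's inequality; taking d to be the entries of a truncated
  sequence identifies that sequence in \<open>coef_is_Phi\<close>.\<close>

lemma coef_distance:
  assumes g: "bdd_supp g" and "finite M"
  shows "has_bochner_integral lborel (\<lambda>x. (cmod (g x - (\<Sum>m\<in>M. d m * of_real (phi m x))))\<^sup>2)
    ((LINT x|lborel. (cmod (g x))\<^sup>2) - (\<Sum>m\<in>M. (cmod (coef g m))\<^sup>2) + (\<Sum>m\<in>M. (cmod (coef g m - d m))\<^sup>2))"
proof -
  have g2: "has_bochner_integral lborel (\<lambda>x. complex_of_real ((cmod (g x))\<^sup>2)) (of_real (LINT x|lborel. (cmod (g x))\<^sup>2))"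
  proof -
    obtain B l r where b: "g \<in> borel_measurable borel" "-1 < l" "l \<le> r" "r < 1" "\<And>x. cmod (g x) \<le> B" "\<And>x. x \<notin> {l..r} \<Longrightarrow> g x = 0"
      using g unfolding bdd_supp_def by blast
    note b(1)[measurable]
    have "integrable lborel (\<lambda>x. (cmod (g x))\<^sup>2)"
    proof (rule Bochner_Integration.integrable_bound)
      show "integrable lborel (\<lambda>x. B *\<^sub>R g x)" by (intro integrable_scaleR_right bdd_supp_integrable g)
      show "AE x in lborel. norm ((cmod (g x))\<^sup>2) \<le> norm (B *\<^sub>R g x)"
      proof (rule AE_I2)
        fix x
        have "0 \<le> B" using order_trans[OF norm_ge_zero b(5)] .
        then show "norm ((cmod (g x))\<^sup>2) \<le> norm (B *\<^sub>R g x)"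
          using b(5)[of x] by (simp add: power2_eq_square mult_right_mono)
      qed
    qed measurable
    then show ?thesis by (intro has_bochner_integral_of_real) (simp add: has_bochner_integral_iff)
  qed
  have c: "has_bochner_integral lborel (\<lambda>x. g x * of_real (phi m x)) (coef g m)" for m
    by (rule coef_integral[OF g])
  have c': "has_bochner_integral lborel (\<lambda>x. cnj (g x * of_real (phi m x))) (cnj (coef g m))" for m
    using c[of m] by (simp add: has_bochner_integral_iff del: complex_cnj_mult)
  let ?S = "\<lambda>x. \<Sum>m\<in>M. d m * of_real (phi m x)"
  have "has_bochner_integral lborel
    (\<lambda>x. of_real ((cmod (g x))\<^sup>2) - (\<Sum>m\<in>M. cnj (d m) * (g x * of_real (phi m x)))
       - (\<Sum>m\<in>M. d m * cnj (g x * of_real (phi m x)))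
       + (\<Sum>m\<in>M. \<Sum>n\<in>M. (d m * cnj (d n)) * of_real (phi m x * phi n x)))
    (of_real (LINT x|lborel. (cmod (g x))\<^sup>2) - (\<Sum>m\<in>M. cnj (d m) * coef g m)
       - (\<Sum>m\<in>M. d m * cnj (coef g m)) + (\<Sum>m\<in>M. \<Sum>n\<in>M. (d m * cnj (d n)) * (if m = n then 1 else 0)))"
    by (intro has_bochner_integral_add has_bochner_integral_diff has_bochner_integral_sum has_bochner_integral_mult_right g2 c c' phi_orth)
  moreover have "of_real ((cmod (g x))\<^sup>2) - (\<Sum>m\<in>M. cnj (d m) * (g x * of_real (phi m x)))
       - (\<Sum>m\<in>M. d m * cnj (g x * of_real (phi m x)))
       + (\<Sum>m\<in>M. \<Sum>n\<in>M. (d m * cnj (d n)) * of_real (phi m x * phi n x)) = complex_of_real ((cmod (g x - ?S x))\<^sup>2)" for x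
  proof -
    have "(\<Sum>m\<in>M. \<Sum>n\<in>M. (d m * cnj (d n)) * of_real (phi m x * phi n x)) = ?S x * cnj (?S x)"
      by (simp add: sum_product mult_ac)
    moreover have "(\<Sum>m\<in>M. cnj (d m) * (g x * of_real (phi m x))) = g x * cnj (?S x)"
      by (simp add: sum_distrib_left mult_ac)
    moreover have "(\<Sum>m\<in>M. d m * cnj (g x * of_real (phi m x))) = cnj (g x) * ?S x"
      by (simp add: sum_distrib_left mult_ac)
    ultimately show ?thesis
      by (simp only: complex_norm_square complex_cnj_diff) (simp add: algebra_simps)
  qed
  moreover have "of_real (LINT x|lborel. (cmod (g x))\<^sup>2) - (\<Sum>m\<in>M. cnj (d m) * coef g m)
       - (\<Sum>m\<in>M. d m * cnj (coef g m)) + (\<Sum>m\<in>M. \<Sum>n\<in>M. (d m * cnj (d n)) * (if m = n then 1 else 0))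
    = complex_of_real ((LINT x|lborel. (cmod (g x))\<^sup>2) - (\<Sum>m\<in>M. (cmod (coef g m))\<^sup>2) + (\<Sum>m\<in>M. (cmod (coef g m - d m))\<^sup>2))"
  proof -
    have "(\<Sum>m\<in>M. \<Sum>n\<in>M. (d m * cnj (d n)) * (if m = n then 1 else 0)) = (\<Sum>m\<in>M. d m * cnj (d m))"
      using assms(2) by (simp add: if_distrib cong: if_cong)
    moreover have "complex_of_real (\<Sum>m\<in>M. (cmod (coef g m - d m))\<^sup>2) =
        (\<Sum>m\<in>M. coef g m * cnj (coef g m)) - (\<Sum>m\<in>M. cnj (d m) * coef g m) - (\<Sum>m\<in>M. d m * cnj (coef g m)) + (\<Sum>m\<in>M. d m * cnj (d m))"
      unfolding of_real_sum complex_norm_square by (simp add: algebra_simps sum.distrib sum_subtractf)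
    moreover have "complex_of_real (\<Sum>m\<in>M. (cmod (coef g m))\<^sup>2) = (\<Sum>m\<in>M. coef g m * cnj (coef g m))"
      unfolding of_real_sum complex_norm_square ..
    ultimately show ?thesis by (simp only: of_real_add of_real_diff) simp
  qed
  ultimately have "has_bochner_integral lborel (\<lambda>x. complex_of_real ((cmod (g x - ?S x))\<^sup>2))
    (complex_of_real ((LINT x|lborel. (cmod (g x))\<^sup>2) - (\<Sum>m\<in>M. (cmod (coef g m))\<^sup>2) + (\<Sum>m\<in>M. (cmod (coef g m - d m))\<^sup>2)))"
    by (simp only:)
  from has_bochner_integral_Re[OF this] show ?thesis by (simp only: Re_complex_of_real)
qed

lemma bessel:
  assumes g: "bdd_supp g"
  shows "finite M \<Longrightarrow> (\<Sum>m\<in>M. (cmod (coef g m))\<^sup>2) \<le> (LINT x|lborel. (cmod (g x))\<^sup>2)"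
    and "square_summable (coef g)"
    and "(\<Sum>n. (cmod (coef g n))\<^sup>2) \<le> (LINT x|lborel. (cmod (g x))\<^sup>2)"
proof -
  have 1: "(\<Sum>m\<in>M. (cmod (coef g m))\<^sup>2) \<le> (LINT x|lborel. (cmod (g x))\<^sup>2)" if "finite M" for M
  proof -
    have "0 \<le> (LINT x|lborel. (cmod (g x - (\<Sum>m\<in>M. coef g m * of_real (phi m x))))\<^sup>2)"
      by (rule integral_nonneg_AE) simp
    also have "\<dots> = (LINT x|lborel. (cmod (g x))\<^sup>2) - (\<Sum>m\<in>M. (cmod (coef g m))\<^sup>2)"
      using coef_distance[OF g that, of "coef g"] by (simp add: has_bochner_integral_iff)
    finally show ?thesis by simp
  qed
  then show "finite M \<Longrightarrow> (\<Sum>m\<in>M. (cmod (coef g m))\<^sup>2) \<le> (LINT x|lborel. (cmod (g x))\<^sup>2)" .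
  show s: "square_summable (coef g)"
    unfolding square_summable_def by (rule summableI_nonneg_bounded[of _ "LINT x|lborel. (cmod (g x))\<^sup>2"]) (auto intro: 1)
  show "(\<Sum>n. (cmod (coef g n))\<^sup>2) \<le> (LINT x|lborel. (cmod (g x))\<^sup>2)"
    using s unfolding square_summable_def by (intro suminf_le_const) (auto intro: 1)
qed

lemma coef_add: "bdd_supp g \<Longrightarrow> bdd_supp h \<Longrightarrow> coef (\<lambda>x. g x + h x) n = coef g n + coef h n"
  using has_bochner_integral_add[OF coef_integral coef_integral, of g h n n]
  by (simp add: has_bochner_integral_iff coef_def distrib_right)

lemma coef_cmult: "coef (\<lambda>x. c * g x) n = c * coef g n"
  by (simp add: coef_def mult.assoc)

text \<open>The truncations of f are finitely supported and converge to f, so their images approach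
  g in norm. By \<open>coef_distance\<close> and Bessel's inequality each single coefficient is
  controlled by that distance, and it does not change once the truncation has passed n.\<close>

lemma coef_is_Phi:
  assumes g: "bdd_supp g" and P: "is_Phi (jacobi_weight k \<alpha> \<beta>) G f g"
  shows "ell2_nth f n = coef g n"
proof -
  define F where "F j = Abs_ell2 (\<lambda>n. if n < j then ell2_nth f n else 0)" for j
  have ss: "square_summable (\<lambda>n. if n < j then ell2_nth f n else 0)" for j
    by (rule square_summable_finite) (rule finite_subset[of _ "{..<j}"], auto split: if_splits)
  have F: "ell2_nth (F j) = (\<lambda>n. if n < j then ell2_nth f n else 0)" for j
    unfolding F_def using ss by (intro Abs_ell2_inverse) auto
  have fs: "finitely_supported (F j)" for j
    unfolding finitely_supported_def F by (rule finite_subset[of _ "{..<j}"]) (auto split: if_splits)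
  have sf: "summable (\<lambda>n. (cmod (ell2_nth f n))\<^sup>2)" using ell2_nth[of f] by (simp add: square_summable_def)
  have "F \<longlonglongrightarrow> f"
  proof -
    have n: "norm (F j - f) = sqrt ((\<Sum>n. (cmod (ell2_nth f n))\<^sup>2) - (\<Sum>n<j. (cmod (ell2_nth f n))\<^sup>2))" for j
    proof -
      have "(\<Sum>n. (cmod (ell2_nth f n))\<^sup>2) = (\<Sum>n. (cmod (ell2_nth f (n + j)))\<^sup>2) + (\<Sum>n<j. (cmod (ell2_nth f n))\<^sup>2)"
        by (rule suminf_split_initial_segment[OF sf])
      moreover have "(\<Sum>n. (cmod (ell2_nth (F j - f) n))\<^sup>2) = (\<Sum>n. (cmod (ell2_nth (F j - f) (n + j)))\<^sup>2) + (\<Sum>n<j. (cmod (ell2_nth (F j - f) n))\<^sup>2)"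
        by (rule suminf_split_initial_segment) (use ell2_nth[of "F j - f"] in \<open>simp add: square_summable_def\<close>)
      ultimately show ?thesis by (simp add: norm_ell2.rep_eq minus_ell2.rep_eq F)
    qed
    have "(\<lambda>j. sqrt ((\<Sum>n. (cmod (ell2_nth f n))\<^sup>2) - (\<Sum>n<j. (cmod (ell2_nth f n))\<^sup>2))) \<longlonglongrightarrow> sqrt ((\<Sum>n. (cmod (ell2_nth f n))\<^sup>2) - (\<Sum>n. (cmod (ell2_nth f n))\<^sup>2))"
      by (intro tendsto_intros summable_LIMSEQ sf)
    then have "(\<lambda>j. norm (F j - f)) \<longlonglongrightarrow> 0" unfolding n by simp
    then show ?thesis by (simp add: LIM_zero_iff tendsto_norm_zero_iff)
  qed
  then have L: "(\<lambda>j. L2_norm (\<lambda>x. Phi_fin (jacobi_weight k \<alpha> \<beta>) G (F j) x - g x)) \<longlonglongrightarrow> 0"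
    using P fs unfolding is_Phi_def by blast
  have supp: "g x = 0" if "x \<notin> {-1<..<1}" for x
    using g that unfolding bdd_supp_def by force
  have "cmod (coef g n - ell2_nth f n) \<le> L2_norm (\<lambda>x. Phi_fin (jacobi_weight k \<alpha> \<beta>) G (F j) x - g x)" if "j > n" for j
  proof -
    let ?d = "ell2_nth (F j)"
    have "(LINT x:{-1<..<1}|lborel. (cmod (Phi_fin (jacobi_weight k \<alpha> \<beta>) G (F j) x - g x))\<^sup>2)
       = (LINT x|lborel. (cmod (g x - (\<Sum>m\<in>{..<j}. ?d m * of_real (phi m x))))\<^sup>2)"
      unfolding set_lebesgue_integral_def
    proof (rule Bochner_Integration.integral_cong[OF refl])
      fix x
      show "indicator {-1<..<1} x *\<^sub>R (cmod (Phi_fin (jacobi_weight k \<alpha> \<beta>) G (F j) x - g x))\<^sup>2 = (cmod (g x - (\<Sum>m\<in>{..<j}. ?d m * of_real (phi m x))))\<^sup>2"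
      proof (cases "x \<in> {-1<..<1}")
        case True
        have "Phi_fin (jacobi_weight k \<alpha> \<beta>) G (F j) x = (\<Sum>m | ?d m \<noteq> 0. ?d m * of_real (phi m x))"
          unfolding Phi_fin_def using True by (simp add: phi_def mult.commute)
        also have "\<dots> = (\<Sum>m\<in>{..<j}. ?d m * of_real (phi m x))"
          by (rule sum.mono_neutral_left) (auto simp: F split: if_splits)
        finally show ?thesis using True by (simp add: norm_minus_commute)
      qed (simp add: supp phi_def)
    qed
    also have "\<dots> = (LINT x|lborel. (cmod (g x))\<^sup>2) - (\<Sum>m\<in>{..<j}. (cmod (coef g m))\<^sup>2) + (\<Sum>m\<in>{..<j}. (cmod (coef g m - ?d m))\<^sup>2)"
      using coef_distance[OF g, of "{..<j}" ?d] by (simp add: has_bochner_integral_iff)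
    also have "\<dots> \<ge> (\<Sum>m\<in>{..<j}. (cmod (coef g m - ?d m))\<^sup>2)" using bessel(1)[OF g, of "{..<j}"] by simp
    finally have "(\<Sum>m\<in>{..<j}. (cmod (coef g m - ?d m))\<^sup>2) \<le> (LINT x:{-1<..<1}|lborel. (cmod (Phi_fin (jacobi_weight k \<alpha> \<beta>) G (F j) x - g x))\<^sup>2)" .
    moreover have "(cmod (coef g n - ?d n))\<^sup>2 \<le> (\<Sum>m\<in>{..<j}. (cmod (coef g m - ?d m))\<^sup>2)"
      by (rule member_le_sum) (use that in auto)
    ultimately have "(cmod (coef g n - ell2_nth f n))\<^sup>2 \<le> (LINT x:{-1<..<1}|lborel. (cmod (Phi_fin (jacobi_weight k \<alpha> \<beta>) G (F j) x - g x))\<^sup>2)"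
      using that by (simp add: F)
    then show ?thesis unfolding L2_norm_def by (rule real_le_rsqrt)
  qed
  then have "cmod (coef g n - ell2_nth f n) \<le> 0"
    by (intro LIMSEQ_le_const[OF L] exI[of _ "Suc n"]) auto
  then show ?thesis by simp
qed

text \<open>The three-term recurrence under the integral: on coefficients the Jacobi matrix acts as
  multiplication by \<lambda>.\<close>

lemma coef_jacobi_seq:
  assumes g: "bdd_supp g" and rc: "recurrence_coeffs G a b"
  shows "jacobi_seq a b (coef g) n = coef (\<lambda>x. of_real x * g x) n"
proof -
  have rec: "(if n = 0 then 0 else a (n - 1) * phi (n - 1) x) + b n * phi n x + a n * phi (Suc n) x = x * phi n x" for n x
  proof -
    have "(if n = 0 then 0 else a (n - 1) * poly (G (n - 1)) x) + b n * poly (G n) x + a n * poly (G (Suc n)) x = x * poly (G n) x"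
      using rc unfolding recurrence_coeffs_def by blast
    from arg_cong[OF this, of "\<lambda>y. indicator {-1<..<1} x * sqrt (jacobi_weight k \<alpha> \<beta> x) * y"]
    show ?thesis unfolding phi_def by (cases "n = 0") (simp_all add: algebra_simps)
  qed
  note ci = coef_integral[OF g]
  show ?thesis
  proof (cases n)
    case 0
    have "has_bochner_integral lborel (\<lambda>x. of_real (b 0) * (g x * of_real (phi 0 x)) + of_real (a 0) * (g x * of_real (phi 1 x))) (of_real (b 0) * coef g 0 + of_real (a 0) * coef g 1)"
      by (intro has_bochner_integral_add has_bochner_integral_mult_right ci)
    moreover have "of_real (b 0) * (g x * of_real (phi 0 x)) + of_real (a 0) * (g x * of_real (phi 1 x)) = of_real x * g x * of_real (phi 0 x)" for x
      using arg_cong[OF rec[of 0 x], of "\<lambda>y. g x * of_real y"] by (simp add: algebra_simps)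
    ultimately show ?thesis using 0 by (simp add: has_bochner_integral_iff coef_def)
  next
    case (Suc m)
    have "has_bochner_integral lborel (\<lambda>x. of_real (a m) * (g x * of_real (phi m x)) + of_real (b (Suc m)) * (g x * of_real (phi (Suc m) x)) + of_real (a (Suc m)) * (g x * of_real (phi (Suc (Suc m)) x)))
       (of_real (a m) * coef g m + of_real (b (Suc m)) * coef g (Suc m) + of_real (a (Suc m)) * coef g (Suc (Suc m)))"
      by (intro has_bochner_integral_add has_bochner_integral_mult_right ci)
    moreover have "of_real (a m) * (g x * of_real (phi m x)) + of_real (b (Suc m)) * (g x * of_real (phi (Suc m) x)) + of_real (a (Suc m)) * (g x * of_real (phi (Suc (Suc m)) x)) = of_real x * g x * of_real (phi (Suc m) x)" for x
      using arg_cong[OF rec[of "Suc m" x], of "\<lambda>y. g x * of_real y"] by (simp add: algebra_simps)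
    ultimately show ?thesis using Suc by (simp add: has_bochner_integral_iff coef_def)
  qed
qed

text \<open>Each partial sum of the exponential series of the operator is the coefficient sequence
  of the scalar partial sum times g. Bessel's inequality turns dominated convergence of these
  functions in square mean into convergence of the operator series in norm.\<close>

lemma unitary_group_coef:
  assumes g: "bdd_supp g" and P: "is_Phi (jacobi_weight k \<alpha> \<beta>) G f g" and rc: "recurrence_coeffs G a b"
  shows "ell2_nth (unitary_group (jacobi_op a b) t f) = coef (\<lambda>x. cis (- (t * x)) * g x)"
proof -
  define A where "A h = scaleC_ell2 (- \<i> * of_real t) (jacobi_op a b h)" for h
  define z where "z x = - \<i> * of_real t * of_real x" for x :: real
  have zc: "continuous_on UNIV z" unfolding z_def by (intro continuous_intros)
  have bm: "bdd_supp (\<lambda>x. z x ^ m * g x)" for m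
    by (intro bdd_supp_mult g continuous_intros zc)
  have pow: "ell2_nth ((A ^^ m) f) = coef (\<lambda>x. z x ^ m * g x)" for m
  proof (induction m)
    case 0
    then show ?case using coef_is_Phi[OF g P] by auto
  next
    case (Suc m)
    have bx: "bdd_supp (\<lambda>x. of_real x * (z x ^ m * g x))"
      by (intro bdd_supp_mult[OF bm] continuous_intros)
    have "jacobi_seq a b (ell2_nth ((A ^^ m) f)) = coef (\<lambda>x. of_real x * (z x ^ m * g x))"
      unfolding Suc.IH using coef_jacobi_seq[OF bm rc] by blast
    \<comment> \<open>The image is itself a coefficient sequence, so Bessel's inequality supplies
      the square summability under which \<open>Abs_ell2\<close> can be inverted.\<close>
    then have "ell2_nth (jacobi_op a b ((A ^^ m) f)) = coef (\<lambda>x. of_real x * (z x ^ m * g x))"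
      unfolding jacobi_op_def using bessel(2)[OF bx] by (simp add: Abs_ell2_inverse)
    then have "ell2_nth ((A ^^ Suc m) f) = (\<lambda>n. (- \<i> * of_real t) * coef (\<lambda>x. of_real x * (z x ^ m * g x)) n)"
      by (simp add: A_def scaleC_ell2.rep_eq)
    also have "\<dots> = coef (\<lambda>x. (- \<i> * of_real t) * (of_real x * (z x ^ m * g x)))"
      by (rule ext) (simp only: coef_cmult)
    also have "(\<lambda>x. (- \<i> * of_real t) * (of_real x * (z x ^ m * g x))) = (\<lambda>x. z x ^ Suc m * g x)"
      by (rule ext) (simp add: z_def mult_ac)
    finally show ?case .
  qed
  define ee where "ee x = cis (- (t * x)) * g x" for x
  have be: "bdd_supp ee" unfolding ee_def by (intro bdd_supp_mult g continuous_intros)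
  define e where "e = Abs_ell2 (coef ee)"
  have e: "ell2_nth e = coef ee" unfolding e_def using bessel(2)[OF be] by (simp add: Abs_ell2_inverse)
  define p where "p M x = (\<Sum>m<M. z x ^ m /\<^sub>R fact m)" for M x
  have pc: "continuous_on UNIV (p M)" for M unfolding p_def by (intro continuous_intros zc)
  have bp: "bdd_supp (\<lambda>x. p M x * g x)" for M by (intro bdd_supp_mult g pc)
  have part: "ell2_nth (\<Sum>m<M. (A ^^ m) f /\<^sub>R fact m) n = coef (\<lambda>x. p M x * g x) n" for M n
  proof (induction M)
    case 0
    then show ?case by (simp add: p_def coef_def zero_ell2.rep_eq)
  next
    case (Suc M)
    have "coef (\<lambda>x. p (Suc M) x * g x) n = coef (\<lambda>x. p M x * g x + inverse (fact M) * (z x ^ M * g x)) n"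
      by (rule arg_cong2[where f = coef]) (auto simp: p_def scaleR_conv_of_real algebra_simps)
    also have "\<dots> = coef (\<lambda>x. p M x * g x) n + coef (\<lambda>x. inverse (fact M) * (z x ^ M * g x)) n"
      by (intro coef_add bp bdd_supp_mult[OF bm] continuous_intros)
    also have "\<dots> = coef (\<lambda>x. p M x * g x) n + inverse (fact M) * coef (\<lambda>x. z x ^ M * g x) n"
      by (simp only: coef_cmult)
    finally show ?case using Suc pow by (simp add: plus_ell2.rep_eq scaleR_ell2.rep_eq scaleR_conv_of_real)
  qed
  have "(\<lambda>m. (A ^^ m) f /\<^sub>R fact m) sums e"
    unfolding sums_def
  proof (rule LIM_zero_cancel, rule tendsto_norm_zero_cancel)
    obtain B l r where b: "g \<in> borel_measurable borel" "-1 < l" "l \<le> r" "r < 1" "\<And>x. cmod (g x) \<le> B" "\<And>x. x \<notin> {l..r} \<Longrightarrow> g x = 0"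
      using g unfolding bdd_supp_def by blast
    define D where "D M x = p M x * g x + (- 1) * ee x" for M x
    have bD: "bdd_supp (D M)" for M
    proof -
      have "D M x = (p M x + (-1) * cis (- (t * x))) * g x" for x by (simp add: D_def ee_def algebra_simps)
      then have "D M = (\<lambda>x. (p M x + (-1) * cis (- (t * x))) * g x)" by blast
      then show ?thesis by (auto intro!: bdd_supp_mult g continuous_intros pc)
    qed
    have bnd: "norm ((\<Sum>m<M. (A ^^ m) f /\<^sub>R fact m) - e) \<le> sqrt (LINT x|lborel. (cmod (D M x))\<^sup>2)" for M
    proof -
      have "ell2_nth ((\<Sum>m<M. (A ^^ m) f /\<^sub>R fact m) - e) n = coef (D M) n" for n
      proof -
        have b1: "bdd_supp (\<lambda>x. (- 1) * ee x)" by (intro bdd_supp_mult be continuous_intros)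
        show ?thesis unfolding minus_ell2.rep_eq part e D_def coef_add[OF bp b1] coef_cmult by simp
      qed
      then have "norm ((\<Sum>m<M. (A ^^ m) f /\<^sub>R fact m) - e) = sqrt (\<Sum>n. (cmod (coef (D M) n))\<^sup>2)"
        by (simp add: norm_ell2.rep_eq)
      also have "\<dots> \<le> sqrt (LINT x|lborel. (cmod (D M x))\<^sup>2)" using bessel(3)[OF bD] by simp
      finally show ?thesis .
    qed
    have lim: "(\<lambda>M. sqrt (LINT x|lborel. (cmod (D M x))\<^sup>2)) \<longlonglongrightarrow> sqrt (LINT x|(lborel :: real measure). 0)"
    proof (rule tendsto_real_sqrt, rule integral_dominated_convergence)
      show "(\<lambda>x. (cmod (D M x))\<^sup>2) \<in> borel_measurable lborel" for M
      proof -
        have [measurable]: "D M \<in> borel_measurable borel" using bD[of M] unfolding bdd_supp_def by blast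
        show ?thesis by measurable
      qed
      \<comment> \<open>On the support |\<lambda>| < 1, so every partial sum is bounded by exp |t|;
        the added 1 is for the limit.\<close>
      show "integrable lborel (\<lambda>x::real. indicator {l..r} x *\<^sub>R ((exp \<bar>t\<bar> + 1) * B)\<^sup>2)"
        by (intro integrable_scaleR_left integrable_real_indicator) (auto simp: emeasure_lborel_Icc_eq)
      show "AE x in lborel. (\<lambda>M. (cmod (D M x))\<^sup>2) \<longlonglongrightarrow> 0"
      proof (rule AE_I2)
        fix x
        have "(\<lambda>M. p M x) \<longlonglongrightarrow> exp (z x)"
          using exp_converges[of "z x"] unfolding sums_def p_def .
        moreover have "exp (z x) = cis (- (t * x))" by (simp add: z_def cis_conv_exp mult_ac)
        ultimately have "(\<lambda>M. (cmod (p M x * g x + (- 1) * ee x))\<^sup>2) \<longlonglongrightarrow> (cmod (cis (- (t * x)) * g x + (- 1) * ee x))\<^sup>2"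
          by (intro tendsto_intros) simp
        then show "(\<lambda>M. (cmod (D M x))\<^sup>2) \<longlonglongrightarrow> 0" by (simp add: D_def ee_def)
      qed
      show "AE x in lborel. norm ((cmod (D M x))\<^sup>2) \<le> indicator {l..r} x *\<^sub>R ((exp \<bar>t\<bar> + 1) * B)\<^sup>2" for M
      proof (rule AE_I2)
        fix x
        show "norm ((cmod (D M x))\<^sup>2) \<le> indicator {l..r} x *\<^sub>R ((exp \<bar>t\<bar> + 1) * B)\<^sup>2"
        proof (cases "x \<in> {l..r}")
          case True
          have "cmod (z x) \<le> \<bar>t\<bar>" using True b by (auto simp: z_def norm_mult abs_mult intro!: mult_left_le)
          have "cmod (p M x) \<le> (\<Sum>m<M. norm (z x ^ m /\<^sub>R fact m))" unfolding p_def by (rule norm_sum)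
          also have "\<dots> = (\<Sum>m<M. cmod (z x) ^ m /\<^sub>R fact m)" by (simp add: norm_power)
          also have "\<dots> \<le> exp (cmod (z x))"
            unfolding exp_def by (intro sum_le_suminf summable_exp_generic) auto
          also have "\<dots> \<le> exp \<bar>t\<bar>" using \<open>cmod (z x) \<le> \<bar>t\<bar>\<close> by simp
          finally have pb: "cmod (p M x) \<le> exp \<bar>t\<bar>" .
          have "cmod (D M x) = cmod (p M x - cis (- (t * x))) * cmod (g x)"
            by (simp add: D_def ee_def norm_mult[symmetric] algebra_simps)
          also have "\<dots> \<le> (exp \<bar>t\<bar> + 1) * B"
            using b(5)[of x] pb norm_triangle_ineq4[of "p M x" "cis (- (t * x))"] by (intro mult_mono) auto
          finally have "(cmod (D M x))\<^sup>2 \<le> ((exp \<bar>t\<bar> + 1) * B)\<^sup>2" by (intro power_mono) auto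
          then show ?thesis using True by simp
        qed (simp add: D_def ee_def b(6))
      qed
    qed simp
    show "(\<lambda>M. norm ((\<Sum>m<M. (A ^^ m) f /\<^sub>R fact m) - e)) \<longlonglongrightarrow> 0"
    proof (rule Lim_null_comparison)
      show "\<forall>\<^sub>F M in sequentially. norm (norm ((\<Sum>m<M. (A ^^ m) f /\<^sub>R fact m) - e)) \<le> sqrt (LINT x|lborel. (cmod (D M x))\<^sup>2)"
        using bnd by simp
      show "(\<lambda>M. sqrt (LINT x|lborel. (cmod (D M x))\<^sup>2)) \<longlonglongrightarrow> 0" using lim by simp
    qed
  qed
  then have "unitary_group (jacobi_op a b) t f = e"
    unfolding unitary_group_def op_exp_def A_def by (rule sums_unique[symmetric])
  moreover have "ee = (\<lambda>x. cis (- (t * x)) * g x)" by (rule ext) (rule ee_def)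
  ultimately show ?thesis using e by simp
qed

end

section \<open>Asymptotics of the coefficients\<close>

text \<open>A sum over n becomes the integral of a step function of \<xi> with mesh 1/T. In this
  form Fatou's lemma and dominated convergence apply with \<xi> fixed while T grows.\<close>

lemma nn_integral_floor:
  fixes F :: "nat \<Rightarrow> ennreal" and T :: real
  assumes "T > 0"
  shows "(\<integral>\<^sup>+ x. F (nat \<lfloor>x * T\<rfloor>) * indicator {0..} x \<partial>lborel) = (\<Sum>n. F n * ennreal (1 / T))"
proof -
  have p: "F (nat \<lfloor>x * T\<rfloor>) * indicator {0..} x = (\<Sum>n. F n * indicator {real n / T..<(real n + 1) / T} x)" for x :: real
  proof (cases "x \<ge> 0")
    case True
    define m where "m = nat \<lfloor>x * T\<rfloor>"
    have m: "real m = of_int \<lfloor>x * T\<rfloor>" unfolding m_def using True assms by simp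
    have iff: "x \<in> {real n / T..<(real n + 1) / T} \<longleftrightarrow> n = m" for n
    proof -
      have "x \<in> {real n / T..<(real n + 1) / T} \<longleftrightarrow> real n \<le> x * T \<and> x * T < real n + 1"
        using assms by (simp add: field_simps)
      also have "\<dots> \<longleftrightarrow> \<lfloor>x * T\<rfloor> = int n" by (simp add: floor_eq_iff)
      also have "\<dots> \<longleftrightarrow> n = m" unfolding m_def using True assms by auto
      finally show ?thesis .
    qed
    have "(\<Sum>n. F n * indicator {real n / T..<(real n + 1) / T} x) = (\<Sum>n\<in>{m}. F n * indicator {real n / T..<(real n + 1) / T} x)"
      by (rule suminf_finite) (use iff in \<open>auto simp: indicator_def\<close>)
    also have "\<dots> = F m" using iff[of m] by simp
    finally show ?thesis using True by (simp add: m_def)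
  next
    case False
    have "x \<notin> {real n / T..<(real n + 1) / T}" for n
      using False assms by (auto simp: not_le intro: less_le_trans)
    then show ?thesis using False by simp
  qed
  have "(\<integral>\<^sup>+ x. F (nat \<lfloor>x * T\<rfloor>) * indicator {0..} x \<partial>lborel) = (\<Sum>n. \<integral>\<^sup>+ x. F n * indicator {real n / T..<(real n + 1) / T} x \<partial>lborel)"
    unfolding p by (rule nn_integral_suminf) auto
  also have "\<dots> = (\<Sum>n. F n * ennreal (1 / T))"
  proof (rule suminf_cong)
    fix n
    have "real n / T \<le> (real n + 1) / T" using assms by (simp add: divide_right_mono)
    then show "(\<integral>\<^sup>+ x. F n * indicator {real n / T..<(real n + 1) / T} x \<partial>lborel) = F n * ennreal (1 / T)"
      by (subst nn_integral_cmult_indicator) (auto simp: add_divide_distrib)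
  qed
  finally show ?thesis .
qed

lemma floor_ratio_limit:
  assumes T: "filterlim T at_top sequentially" and x: "x \<ge> 0"
  shows "(\<lambda>j. real (nat \<lfloor>x * T j\<rfloor>) / T j) \<longlonglongrightarrow> x"
proof (rule LIM_zero_cancel)
  show "(\<lambda>j. real (nat \<lfloor>x * T j\<rfloor>) / T j - x) \<longlonglongrightarrow> 0"
  proof (rule Lim_null_comparison)
    show "(\<lambda>j. 1 / T j) \<longlonglongrightarrow> 0"
      using tendsto_inverse_0_at_top[OF T] by (simp add: divide_inverse)
    show "\<forall>\<^sub>F j in sequentially. norm (real (nat \<lfloor>x * T j\<rfloor>) / T j - x) \<le> 1 / T j"
      using filterlim_at_top_dense[THEN iffD1, OF T, rule_format, of 0]
    proof eventually_elim
      case (elim j)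
      have "real (nat \<lfloor>x * T j\<rfloor>) = of_int \<lfloor>x * T j\<rfloor>" using x elim by simp
      then have "\<bar>real (nat \<lfloor>x * T j\<rfloor>) - x * T j\<bar> \<le> 1" by linarith
      then have "\<bar>real (nat \<lfloor>x * T j\<rfloor>) - x * T j\<bar> / T j \<le> 1 / T j" using elim by (intro divide_right_mono) auto
      moreover have "real (nat \<lfloor>x * T j\<rfloor>) / T j - x = (real (nat \<lfloor>x * T j\<rfloor>) - x * T j) / T j"
        using elim by (simp add: field_simps)
      ultimately show ?case using elim by simp
    qed
  qed
qed

lemma powi_minus_i: "\<i> powi (- int n) = cis (- (real n * pi / 2))"
proof -
  have "cis (pi / 2) ^ n = cis (real n * (pi / 2))" by (rule Complex.DeMoivre)
  then have "\<i> ^ n = cis (real n * pi / 2)" by simp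
  then have "inverse (\<i> ^ n) = cis (- (real n * pi / 2))" by (simp only: cis_inverse)
  then show ?thesis by (simp only: power_int_minus power_int_of_nat)
qed

context jacobi_polys begin

definition evolved_coef :: "real \<Rightarrow> (real \<Rightarrow> complex) \<Rightarrow> nat \<Rightarrow> complex" where
  "evolved_coef t g = coef (\<lambda>x. cis (- (t * x)) * g x)"

text \<open>Of the Jacobian sin x of \<lambda> = cos x, one square root completes
  \<open>lv_weight\<close>; the other stays with the packet, as in
  \<open>packet_theta\<close>.\<close>

lemma sin_phi_cos:
  assumes "0 < x" "x < pi"
  shows "sin x * phi n (cos x) = sqrt (sin x) * lv_sol n x"
proof -
  have s: "sin x > 0" using assms by (rule sin_gt_zero)
  have "cos x < cos 0" "cos pi < cos x" using assms by (intro cos_monotone_0_pi; simp)+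
  then have c: "1 - cos x > 0" "1 + cos x > 0" by auto
  have "sqrt (jacobi_weight k \<alpha> \<beta> (cos x)) * sqrt (sin x) = lv_weight x"
  proof -
    have s2: "sin x = (1 - cos x) powr (1/2) * (1 + cos x) powr (1/2)"
    proof -
      have "(sin x)\<^sup>2 = (1 - cos x) * (1 + cos x)"
        using sin_cos_squared_add[of x] by (simp add: power2_eq_square algebra_simps)
      then have "sin x = sqrt ((1 - cos x) * (1 + cos x))" using s by (metis real_sqrt_unique less_imp_le)
      then show ?thesis using c by (simp add: powr_half_sqrt real_sqrt_mult)
    qed
    have "jacobi_weight k \<alpha> \<beta> (cos x) * sin x = k * ((1 - cos x) powr (\<alpha> + 1/2) * (1 + cos x) powr (\<beta> + 1/2))"
      unfolding jacobi_weight_def s2 by (simp add: powr_add)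
    also have "(1 - cos x) powr (\<alpha> + 1/2) * (1 + cos x) powr (\<beta> + 1/2) = (exp (exp_left * ln (1 - cos x) + exp_right * ln (1 + cos x)))\<^sup>2"
      using c unfolding exp_left_def exp_right_def by (simp add: powr_def exp_double[symmetric] exp_add[symmetric] algebra_simps)
    finally have "jacobi_weight k \<alpha> \<beta> (cos x) * sin x = k * (exp (exp_left * ln (1 - cos x) + exp_right * ln (1 + cos x)))\<^sup>2" .
    then have "sqrt (jacobi_weight k \<alpha> \<beta> (cos x) * sin x) = sqrt k * exp (exp_left * ln (1 - cos x) + exp_right * ln (1 + cos x))"
      by (simp add: real_sqrt_mult)
    then show ?thesis unfolding lv_weight_def by (simp add: real_sqrt_mult)
  qed
  note lv_weight = this
  have "sin x * phi n (cos x) = sqrt (sin x) * (sqrt (jacobi_weight k \<alpha> \<beta> (cos x)) * sqrt (sin x)) * poly (G n) (cos x)"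
    using s c by (simp add: phi_def)
  also have "\<dots> = sqrt (sin x) * lv_sol n x" unfolding lv_weight lv_sol_def by simp
  finally show ?thesis .
qed

end

text \<open>Support in [l, r] with 0 < l keeps the angle in a compact part of (0, pi/2), away from
  the point pi/2 where stationary points degenerate. One continuous derivative is what a single
  integration by parts consumes.\<close>

locale jacobi_packet = jacobi_polys k \<alpha> \<beta> G
  for k \<alpha> \<beta> :: real and G :: "nat \<Rightarrow> real poly" +
  fixes g g' :: "real \<Rightarrow> complex" and l r :: real
  assumes gd: "\<And>x. (g has_vector_derivative g' x) (at x)" and g'c: "continuous_on UNIV g'"
    and lr: "0 < l" "l \<le> r" "r < 1" and supp: "\<And>x. x \<notin> {l..r} \<Longrightarrow> g x = 0"
begin

lemma gcont: "continuous_on S g"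
  using gd by (meson continuous_at_imp_continuous_on has_vector_derivative_continuous)

lemma g_bdd_supp: "bdd_supp g"
proof -
  have "bounded (g ` {l..r})" by (intro compact_imp_bounded compact_continuous_image gcont) auto
  then obtain M where M: "\<And>x. x \<in> {l..r} \<Longrightarrow> cmod (g x) \<le> M"
    unfolding bounded_iff by (auto simp del: atLeastAtMost_iff)
  have "M \<ge> 0" using order_trans[OF norm_ge_zero M[of l]] lr by simp
  then have "cmod (g x) \<le> M" for x using M[of x] supp[of x] by (cases "x \<in> {l..r}") auto
  then show ?thesis unfolding bdd_supp_def using lr supp gcont
    by (intro conjI borel_measurable_continuous_onI exI[of _ M] exI[of _ l] exI[of _ r]) auto
qed

definition packet_theta :: "real \<Rightarrow> complex" where "packet_theta x = g (cos x) * of_real (sqrt (sin x))"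
definition packet_theta' :: "real \<Rightarrow> complex" where
  "packet_theta' x = g (cos x) * of_real (cos x / (2 * sqrt (sin x))) + (of_real (- sin x) * g' (cos x)) * of_real (sqrt (sin x))"

lemma packet_theta_deriv:
  assumes "0 < x" "x < pi"
  shows "(packet_theta has_vector_derivative packet_theta' x) (at x)"
proof -
  have s: "sin x > 0" using assms by (rule sin_gt_zero)
  have 1: "((\<lambda>x. g (cos x)) has_vector_derivative (of_real (- sin x) * g' (cos x))) (at x)"
    using vector_diff_chain_at[of cos "- sin x" x g "g' (cos x)"] gd
    by (simp add: o_def scaleR_conv_of_real has_real_derivative_iff_has_vector_derivative[symmetric] DERIV_cos)
  have "((\<lambda>x. sqrt (sin x)) has_real_derivative (cos x / (2 * sqrt (sin x)))) (at x)"
  proof (rule DERIV_cong[OF DERIV_chain'[OF DERIV_sin DERIV_real_sqrt[OF s]]])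
    show "inverse (sqrt (sin x)) / 2 * cos x = cos x / (2 * sqrt (sin x))" using s by (simp add: field_simps)
  qed
  then have 2: "((\<lambda>x. complex_of_real (sqrt (sin x))) has_vector_derivative of_real (cos x / (2 * sqrt (sin x)))) (at x)"
    by (rule has_vector_derivative_of_real)
  show ?thesis unfolding packet_theta_def[abs_def] packet_theta'_def by (rule has_vector_derivative_mult[OF 1 2])
qed

lemma packet_theta'_cont:
  assumes "0 < A" "B < pi"
  shows "continuous_on {A..B} packet_theta'"
proof -
  have s: "sin x \<noteq> 0" if "x \<in> {A..B}" for x using that assms sin_gt_zero[of x] by auto
  have "continuous_on {A..B} (\<lambda>x. g (cos x))" "continuous_on {A..B} (\<lambda>x. g' (cos x))"
    by (rule continuous_on_compose2[OF gcont[of UNIV] continuous_on_cos[OF continuous_on_id]], simp,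
        rule continuous_on_compose2[OF g'c continuous_on_cos[OF continuous_on_id]], simp)
  then show ?thesis unfolding packet_theta'_def[abs_def] by (intro continuous_intros) (use s in auto)
qed

lemma evolved_coef_theta:
  assumes AB: "0 < A" "A \<le> B" "B < pi" and c: "cos B < l" "r < cos A"
  shows "evolved_coef t g n = integral {A..B} (\<lambda>x. cis (- (t * cos x)) * packet_theta x * of_real (lv_sol n x))"
proof -
  define F where "F x = cis (- (t * x)) * g x * of_real (phi n x)" for x
  have cAB: "-1 < cos B" "cos A < 1" "cos B \<le> cos A"
  proof -
    show "-1 < cos B" using AB cos_monotone_0_pi[of B pi] by auto
    show "cos A < 1" using AB cos_monotone_0_pi[of 0 A] by auto
    show "cos B \<le> cos A" using c lr by simp
  qed
  have Fc: "continuous_on {cos B..cos A} F"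
  proof -
    have "continuous_on {cos B..cos A} (\<lambda>x. cis (- (t * x)) * g x * of_real (sqrt (jacobi_weight k \<alpha> \<beta> x) * poly (G n) x))"
      unfolding jacobi_weight_def using cAB by (intro continuous_intros gcont) auto
    moreover have "F x = cis (- (t * x)) * g x * of_real (sqrt (jacobi_weight k \<alpha> \<beta> x) * poly (G n) x)" if "x \<in> {cos B..cos A}" for x
      using that cAB by (simp add: F_def phi_def)
    ultimately show ?thesis by (metis (no_types, lifting) continuous_on_cong)
  qed
  have "evolved_coef t g n = (LINT x:{cos B..cos A}|lborel. F x)"
    unfolding evolved_coef_def coef_def set_lebesgue_integral_def
  proof (rule Bochner_Integration.integral_cong[OF refl])
    fix x
    show "cis (- (t * x)) * g x * complex_of_real (phi n x) = indicator {cos B..cos A} x *\<^sub>R F x"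
      using supp[of x] c by (cases "x \<in> {cos B..cos A}") (auto simp: F_def)
  qed
  also have "\<dots> = integral {cos B..cos A} F"
    by (intro set_borel_integral_eq_integral borel_integrable_atLeastAtMost' Fc)
  finally have E: "evolved_coef t g n = integral {cos B..cos A} F" .
  have cosAB: "cos x \<in> {cos B..cos A}" if "x \<in> {A..B}" for x
    using that AB by (auto intro!: cos_monotone_0_pi_le)
  \<comment> \<open>The cosine is decreasing, so the general substitution rule yields a difference
    of two integrals; the one over the reversed interval is 0.\<close>
  have "((\<lambda>x. (- sin x) *\<^sub>R F (cos x)) has_integral (integral {cos A..cos B} F - integral {cos B..cos A} F)) {A..B}"
    by (rule has_integral_substitution_general[where s = "{}" and c = "cos B" and d = "cos A"])
       (use AB cosAB Fc in \<open>auto intro!: continuous_intros derivative_eq_intros\<close>)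
  moreover have "integral {cos A..cos B} F = 0"
    using cAB(3) by (cases "cos A = cos B") auto
  ultimately have "((\<lambda>x. (- sin x) *\<^sub>R F (cos x)) has_integral (- evolved_coef t g n)) {A..B}" using E by simp
  from has_integral_neg[OF this]
  have "((\<lambda>x. - ((- sin x) *\<^sub>R F (cos x))) has_integral evolved_coef t g n) {A..B}" by simp
  then have "evolved_coef t g n = integral {A..B} (\<lambda>x. - ((- sin x) *\<^sub>R F (cos x)))" by (simp add: integral_unique)
  also have "\<dots> = integral {A..B} (\<lambda>x. cis (- (t * cos x)) * packet_theta x * of_real (lv_sol n x))"
  proof (rule Henstock_Kurzweil_Integration.integral_cong)
    fix x assume x: "x \<in> {A..B}"
    have "- ((- sin x) *\<^sub>R F (cos x)) = cis (- (t * cos x)) * g (cos x) * of_real (sin x * phi n (cos x))"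
      by (simp add: F_def scaleR_conv_of_real mult_ac)
    also have "\<dots> = cis (- (t * cos x)) * packet_theta x * of_real (lv_sol n x)"
      using sin_phi_cos[of x n] x AB by (simp add: packet_theta_def mult_ac)
    finally show "- ((- sin x) *\<^sub>R F (cos x)) = cis (- (t * cos x)) * packet_theta x * of_real (lv_sol n x)" .
  qed
  finally show ?thesis .
qed

text \<open>The sum, not the difference: its norm turns out to be the largest possible one, which by the
  parallelogram identity forces the difference to vanish.\<close>

lemma coefficient_asymptotics:
  assumes T: "filterlim T at_top sequentially" and Tpos: "\<And>j. T j > 0"
    and xi: "0 < \<xi>" "\<xi> < 1" and gnz: "g (sqrt (1 - \<xi>\<^sup>2)) \<noteq> 0"
  defines "N \<equiv> \<lambda>j. nat \<lfloor>\<xi> * T j\<rfloor>"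
  shows "(\<lambda>j. T j * (cmod (evolved_coef (T j) g (N j) + U_seq \<alpha> \<beta> (T j) g (N j)))\<^sup>2)
      \<longlonglongrightarrow> 4 * (cmod (h_amp 1 1 gam g \<xi>))\<^sup>2"
proof -
  define s where "s = sqrt (1 - \<xi>\<^sup>2)"
  \<comment> \<open>The stationary point, the solution of sin \<theta> = \<xi>. Its cosine s is the
    spectral value at which g is evaluated.\<close>
  define \<theta>0 where "\<theta>0 = arcsin \<xi>"
  have sl: "l \<le> s" "s \<le> r" using supp[of s] gnz unfolding s_def by force+
  have spos: "s > 0" using sl lr by simp
  \<comment> \<open>cos A is the midpoint of r and 1, and cos B the midpoint of 0 and l. Thus the
    packet vanishes at A and B, and B < pi/2.\<close>
  define A B where "A = arccos ((1 + r) / 2)" and "B = arccos (l / 2)"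
  have cA: "cos A = (1 + r) / 2" and cB: "cos B = l / 2"
    unfolding A_def B_def using lr by (auto intro!: cos_arccos)
  have s\<theta>: "sin \<theta>0 = \<xi>" unfolding \<theta>0_def using xi by (intro sin_arcsin) auto
  have c\<theta>: "cos \<theta>0 = s" unfolding \<theta>0_def s_def using xi by (intro cos_arcsin) auto
  have \<theta>b: "0 < \<theta>0" "\<theta>0 < pi / 2"
    unfolding \<theta>0_def using arcsin_less_arcsin[of 0 \<xi>] arcsin_less_arcsin[of \<xi> 1] xi by auto
  have \<theta>s: "\<theta>0 = arccos s"
  proof -
    have "\<theta>0 \<le> pi" using \<theta>b pi_gt_zero by linarith
    then show ?thesis using arccos_cos[of \<theta>0] \<theta>b c\<theta> by simp
  qed
  have A0: "0 < A" using arccos_less_arccos[of "(1 + r) / 2" 1] lr unfolding A_def by auto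
  have AT: "A < \<theta>0" unfolding A_def \<theta>s using sl lr by (intro arccos_less_arccos) auto
  have TB: "\<theta>0 < B" unfolding B_def \<theta>s using sl lr by (intro arccos_less_arccos) auto
  have B2: "B < pi / 2" using arccos_less_arccos[of 0 "l / 2"] lr unfolding B_def by auto
  have Bpi: "B < pi" using B2 pi_gt_zero by linarith
  have AB: "A \<le> B" using AT TB by simp
  have lc: "cos B < l" "r < cos A" using cA cB lr by auto
  define \<xi>j where "\<xi>j j = real (N j) / T j" for j
  have xl: "\<xi>j \<longlonglongrightarrow> \<xi>" unfolding \<xi>j_def N_def by (rule floor_ratio_limit[OF T]) (use xi in simp)
  have ev1: "eventually (\<lambda>j. \<xi>j j \<in> {0<..<1}) sequentially"
    by (rule topological_tendstoD[OF xl]) (use xi in auto)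
  have "(\<lambda>j. arcsin (\<xi>j j)) \<longlonglongrightarrow> \<theta>0"
    unfolding \<theta>0_def using isCont_arcsin[of \<xi>] xi by (intro isCont_tendsto_compose[OF _ xl]) auto
  note al = this
  have ev2: "eventually (\<lambda>j. arcsin (\<xi>j j) \<in> {A<..<B}) sequentially"
    by (rule topological_tendstoD[OF al]) (use AT TB in auto)
  \<comment> \<open>\<open>stationary_phase\<close> wants every \<theta> j in the interval; the
    default \<theta>0 serves for the finitely many indices at which the arcsine lies
    outside.\<close>
  define \<theta> where "\<theta> j = (if arcsin (\<xi>j j) \<in> {A<..<B} then arcsin (\<xi>j j) else \<theta>0)" for j
  have \<theta>in: "\<theta> j \<in> {A..B}" for j unfolding \<theta>_def using AT TB by auto
  have \<theta>l: "\<theta> \<longlonglongrightarrow> \<theta>0"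
    by (rule Lim_transform_eventually[OF al]) (use ev2 in \<open>eventually_elim, simp add: \<theta>_def\<close>)
  define good where "good j \<longleftrightarrow> \<xi>j j \<in> {0<..<1} \<and> arcsin (\<xi>j j) \<in> {A<..<B}" for j
  have evg: "eventually good sequentially" using ev1 ev2 unfolding good_def by eventually_elim simp
  have sg: "sin (\<theta> j) = \<xi>j j" "cos (\<theta> j) = sqrt (1 - (\<xi>j j)\<^sup>2)" "arccos (\<xi>j j) = pi / 2 - \<theta> j" "T j * sin (\<theta> j) = real (N j)" if "good j" for j
  proof -
    have 1: "\<theta> j = arcsin (\<xi>j j)" "0 < \<xi>j j" "\<xi>j j < 1" using that by (auto simp: good_def \<theta>_def)
    show s1: "sin (\<theta> j) = \<xi>j j" unfolding 1(1) using 1 by (intro sin_arcsin) auto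
    show "cos (\<theta> j) = sqrt (1 - (\<xi>j j)\<^sup>2)" unfolding 1(1) using 1 by (intro cos_arcsin) auto
    show "arccos (\<xi>j j) = pi / 2 - \<theta> j" unfolding 1(1) using 1 by (simp add: arccos_arcsin_eq)
    show "T j * sin (\<theta> j) = real (N j)" unfolding s1 \<xi>j_def using Tpos[of j] by simp
  qed
  have xx: "0 < x" "x < pi" if "x \<in> {A..B}" for x using that A0 Bpi by auto
  have q0: "packet_theta A = 0" "packet_theta B = 0" using lc by (auto simp: packet_theta_def supp)
  have qd: "(packet_theta has_vector_derivative packet_theta' x) (at x within S)" if "x \<in> {A..B}" for x S
    using packet_theta_deriv[OF xx[OF that]] by (rule has_vector_derivative_at_within)
  have qc: "continuous_on {A..B} packet_theta" using qd by (meson continuous_on_eq_continuous_within has_vector_derivative_continuous)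
  have q'c: "continuous_on {A..B} packet_theta'" by (rule packet_theta'_cont[OF A0 Bpi])
  \<comment> \<open>The gam part of the frequency is moved into the amplitude, so that the phase is
    stationary exactly where sin x = N j / T j.\<close>
  define qt where "qt x = cis (- (gam * x)) * packet_theta x" for x
  define qt' where "qt' x = cis (- (gam * x)) * packet_theta' x + (\<i> * of_real (- gam) * cis (- (gam * x))) * packet_theta x" for x
  have td: "(qt has_vector_derivative qt' x) (at x within {A..B})" if "x \<in> {A..B}" for x
    unfolding qt_def[abs_def] qt'_def
    by (rule has_vector_derivative_mult[OF has_vector_derivative_cis qd[OF that]]) (auto intro!: derivative_eq_intros)
  have tc': "continuous_on {A..B} qt'" unfolding qt'_def[abs_def] by (intro continuous_intros qc q'c)
  have tc: "continuous_on {A..B} qt" unfolding qt_def[abs_def] by (intro continuous_intros qc)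
  have t0: "qt A = 0" "qt B = 0" using q0 by (auto simp: qt_def)
  \<comment> \<open>The cosine in the Liouville-Green form splits into two exponentials. The phase
    of I1 has derivative N j + gam + T j sin x and no stationary point; I2 carries the stationary
    one, normalized to vanish there.\<close>
  define I1 where "I1 j = integral {A..B} (\<lambda>x. cis ((N j + gam) * x - T j * cos x) * packet_theta x)" for j
  define I2 where "I2 j = integral {A..B} (\<lambda>x. cis (T j * (cos (\<theta> j) - cos x - sin (\<theta> j) * (x - \<theta> j))) * qt x)" for j
  define err where "err n x = lv_sol n x - Re (lv_amp0 n * cis ((n + gam) * (x - pi / 2)))" for n x
  define R where "R j = integral {A..B} (\<lambda>x. cis (- (T j * cos x)) * packet_theta x * of_real (err (N j) x))" for j
  have I2: "(\<lambda>j. of_real (sqrt (T j)) * I2 j) \<longlonglongrightarrow> cis (pi / 4) * of_real (sqrt (2 * pi / s)) * qt \<theta>0"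
    unfolding I2_def c\<theta>[symmetric]
    by (rule stationary_phase[OF A0 B2 td tc' t0 T Tpos \<theta>in \<theta>l]) (use AT TB in auto)
  obtain K1 where K1: "\<And>t n. t > 0 \<Longrightarrow> n \<ge> 0 \<Longrightarrow> cmod (integral {A..B} (\<lambda>x. cis (n * x - t * cos x) * packet_theta x)) \<le> K1 / t"
    using nonstationary_phase[OF A0 AB B2 qd q'c q0] by metis
  have "A \<le> pi / 2" using AT \<theta>b by simp
  obtain K2 n0 where K2: "\<And>n t. n \<ge> n0 \<Longrightarrow> t \<in> {A..pi / 2} \<Longrightarrow> \<bar>err n t\<bar> \<le> K2 / n"
  proof (rule liouville_green[OF A0 \<open>A \<le> pi / 2\<close>])
    fix K n0
    assume "\<And>n t. n \<ge> n0 \<Longrightarrow> t \<in> {A..pi / 2} \<Longrightarrow> \<bar>lv_sol n t - Re (lv_amp0 n * cis ((n + gam) * (t - pi / 2)))\<bar> \<le> K / n"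
    then show thesis by (intro that[of n0 K]) (simp add: err_def)
  qed
  have wuc: "continuous_on {A..B} (lv_sol n)" for n
    using lv_sol_deriv(1)[OF xx] by (meson DERIV_isCont continuous_at_imp_continuous_on)
  have errc: "continuous_on {A..B} (err n)" for n unfolding err_def[abs_def] by (intro continuous_intros wuc)
  have "bounded (packet_theta ` {A..B})" by (intro compact_imp_bounded compact_continuous_image qc) auto
  then obtain M where M: "\<And>x. x \<in> {A..B} \<Longrightarrow> cmod (packet_theta x) \<le> M"
    unfolding bounded_iff by (auto simp del: atLeastAtMost_iff)
  have M0: "M \<ge> 0" using order_trans[OF norm_ge_zero M[of A]] AB by simp
  define ph where "ph n = real n * pi / 2 + (\<beta> - \<alpha>) * pi / 4" for n
  have Cl: "(\<lambda>n. lv_amp0 n * cis (- ph n)) \<longlonglongrightarrow> of_real (sqrt (2 / pi))"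
    using lv_amp0_limit unfolding ph_def .
  have sT: "filterlim (\<lambda>j. sqrt (T j)) at_top sequentially" by (rule filterlim_compose[OF sqrt_at_top T])
  have isT: "(\<lambda>j. 1 / sqrt (T j)) \<longlonglongrightarrow> 0" using tendsto_inverse_0_at_top[OF sT] by (simp add: divide_inverse)
  have Ninf: "filterlim N at_top sequentially"
  proof -
    have "filterlim (\<lambda>j. \<xi>j j * T j) at_top sequentially"
      by (rule filterlim_tendsto_pos_mult_at_top[OF xl _ T]) (use xi in simp)
    moreover have "\<xi>j j * T j = real (N j)" for j using Tpos[of j] by (simp add: \<xi>j_def)
    ultimately show ?thesis by (simp add: filterlim_sequentially_iff_filterlim_real)
  qed
  have CN: "(\<lambda>j. lv_amp0 (N j) * cis (- ph (N j))) \<longlonglongrightarrow> of_real (sqrt (2 / pi))"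
    by (rule filterlim_compose[OF Cl Ninf])
  \<comment> \<open>The common oscillating phase of both sequences, namely i^(-n) exp(i (\<alpha> -
    \<beta>) pi/4) exp(i psi t). Neither sequence converges before it is divided out.\<close>
  define P where "P j = cis (- ((\<beta> - \<alpha>) * pi / 4) - N j * \<theta> j - T j * cos (\<theta> j))" for j
  define a1 where "a1 j = (1/2) * lv_amp0 (N j) * cis (- ((N j + gam) * (pi / 2))) * I1 j" for j
  define b1 where "b1 j = (1/2) * cnj (lv_amp0 (N j)) * cis ((N j + gam) * (pi / 2)) * cis (- (T j * cos (\<theta> j) + N j * \<theta> j)) * I2 j" for j
  have E: "evolved_coef (T j) g (N j) = a1 j + b1 j + R j" if gj: "good j" for j
  proof -
    define N' where "N' = real (N j) + gam"
    have pw: "cis (- (T j * cos x)) * packet_theta x * of_real (lv_sol (N j) x)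
       = ((1/2) * lv_amp0 (N j) * cis (- (N' * (pi / 2)))) * (cis (N' * x - T j * cos x) * packet_theta x)
       + ((1/2) * cnj (lv_amp0 (N j)) * cis (N' * (pi / 2)) * cis (- (T j * cos (\<theta> j) + N j * \<theta> j))) * (cis (T j * (cos (\<theta> j) - cos x - sin (\<theta> j) * (x - \<theta> j))) * qt x)
       + cis (- (T j * cos x)) * packet_theta x * of_real (err (N j) x)" for x
    proof -
      have re: "complex_of_real (Re y) = (1/2) * y + (1/2) * cnj y" for y
        by (simp add: complex_eq_iff)
      have 1: "cis (- (N' * (pi / 2))) * cis (N' * x - T j * cos x) = cis (- (T j * cos x)) * cis (N' * (x - pi / 2))"
        by (simp add: cis_mult algebra_simps)
      have "T j * (cos (\<theta> j) - cos x - sin (\<theta> j) * (x - \<theta> j)) = T j * cos (\<theta> j) - T j * cos x - (T j * sin (\<theta> j)) * (x - \<theta> j)"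
        by (simp add: algebra_simps)
      then have ex: "T j * (cos (\<theta> j) - cos x - sin (\<theta> j) * (x - \<theta> j)) = T j * cos (\<theta> j) - T j * cos x - real (N j) * (x - \<theta> j)"
        unfolding sg(4)[OF gj] .
      have 2: "cis (N' * (pi / 2)) * cis (- (T j * cos (\<theta> j) + N j * \<theta> j)) * (cis (T j * (cos (\<theta> j) - cos x - sin (\<theta> j) * (x - \<theta> j))) * cis (- (gam * x)))
        = cis (- (T j * cos x)) * cnj (cis (N' * (x - pi / 2)))"
        unfolding ex by (simp add: cis_mult cis_cnj N'_def algebra_simps)
      have "lv_sol (N j) x = Re (lv_amp0 (N j) * cis (N' * (x - pi / 2))) + err (N j) x" by (simp add: err_def N'_def)
      then have "cis (- (T j * cos x)) * packet_theta x * of_real (lv_sol (N j) x) =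
          (1/2) * lv_amp0 (N j) * (cis (- (T j * cos x)) * cis (N' * (x - pi / 2))) * packet_theta x
        + (1/2) * cnj (lv_amp0 (N j)) * (cis (- (T j * cos x)) * cnj (cis (N' * (x - pi / 2)))) * packet_theta x
        + cis (- (T j * cos x)) * packet_theta x * of_real (err (N j) x)"
        by (simp only: of_real_add re complex_cnj_mult) (simp only: ring_distribs mult_ac)
      then show ?thesis unfolding 1[symmetric] 2[symmetric] qt_def by (simp only: mult_ac)
    qed
    have i1: "(\<lambda>x. cis (N' * x - T j * cos x) * packet_theta x) integrable_on {A..B}"
      and i2: "(\<lambda>x. cis (T j * (cos (\<theta> j) - cos x - sin (\<theta> j) * (x - \<theta> j))) * qt x) integrable_on {A..B}"
      and i3: "(\<lambda>x. cis (- (T j * cos x)) * packet_theta x * of_real (err (N j) x)) integrable_on {A..B}"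
      by (intro integrable_continuous_real continuous_intros qc tc errc)+
    show ?thesis
      unfolding evolved_coef_theta[OF A0 AB Bpi lc] pw a1_def b1_def R_def I1_def I2_def N'_def[symmetric]
      using i1 i2 i3
      by (simp add: Henstock_Kurzweil_Integration.integral_add integrable_add integrable_on_mult_right integral_mult_right)
  qed
  have la: "(\<lambda>j. of_real (sqrt (T j)) * a1 j) \<longlonglongrightarrow> 0"
  proof -
    have "(\<lambda>j. (1/2) * cmod (lv_amp0 (N j) * cis (- ph (N j))) * (K1 * (1 / sqrt (T j)))) \<longlonglongrightarrow> (1/2) * cmod (of_real (sqrt (2 / pi))) * (K1 * 0)"
      by (intro tendsto_intros CN isT)
    then have z: "(\<lambda>j. (1/2) * cmod (lv_amp0 (N j) * cis (- ph (N j))) * (K1 * (1 / sqrt (T j)))) \<longlonglongrightarrow> 0" by simp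
    show ?thesis
    proof (rule Lim_null_comparison[OF _ z])
      \<comment> \<open>\<open>K1\<close> asks for a nonnegative frequency N j + gam, and
        \<open>gam\<close> may be negative.\<close>
      have ev: "eventually (\<lambda>j. real (N j) \<ge> \<bar>gam\<bar>) sequentially"
      proof -
        obtain m :: nat where m: "real m \<ge> \<bar>gam\<bar>" using real_arch_simple by blast
        show ?thesis using filterlim_at_top[THEN iffD1, OF Ninf, rule_format, of m]
          by eventually_elim (meson m of_nat_mono order_trans)
      qed
      show "\<forall>\<^sub>F j in sequentially. norm (of_real (sqrt (T j)) * a1 j) \<le> (1/2) * cmod (lv_amp0 (N j) * cis (- ph (N j))) * (K1 * (1 / sqrt (T j)))"
        using ev
      proof eventually_elim
        case (elim j)
        have "cmod (I1 j) \<le> K1 / T j" unfolding I1_def using elim by (intro K1 Tpos) auto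
        then have "sqrt (T j) * cmod (I1 j) \<le> sqrt (T j) * (K1 / T j)" using Tpos[of j] by (intro mult_left_mono) auto
        also have "\<dots> = K1 * (1 / sqrt (T j))" using Tpos[of j] by (simp add: field_simps)
        finally have "(1/2) * cmod (lv_amp0 (N j)) * (sqrt (T j) * cmod (I1 j)) \<le> (1/2) * cmod (lv_amp0 (N j)) * (K1 * (1 / sqrt (T j)))"
          by (intro mult_left_mono) auto
        then show ?case using Tpos[of j] by (simp add: a1_def norm_mult norm_divide mult_ac)
      qed
    qed
  qed
  have lR: "(\<lambda>j. of_real (sqrt (T j)) * R j) \<longlonglongrightarrow> 0"
  proof -
    have "(\<lambda>j. M * K2 * (B - A) / \<xi>j j * (1 / sqrt (T j))) \<longlonglongrightarrow> M * K2 * (B - A) / \<xi> * 0"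
      by (intro tendsto_intros xl isT) (use xi in auto)
    then have z: "(\<lambda>j. M * K2 * (B - A) / \<xi>j j * (1 / sqrt (T j))) \<longlonglongrightarrow> 0" by simp
    show ?thesis
    proof (rule Lim_null_comparison[OF _ z])
      show "\<forall>\<^sub>F j in sequentially. norm (of_real (sqrt (T j)) * R j) \<le> M * K2 * (B - A) / \<xi>j j * (1 / sqrt (T j))"
        using filterlim_at_top[THEN iffD1, OF Ninf, rule_format, of n0] evg
      proof eventually_elim
        case (elim j)
        have xp: "\<xi>j j > 0" using elim by (simp add: good_def)
        have "cmod (R j) \<le> M * (K2 / N j) * (B - A)"
          unfolding R_def
        proof (rule integral_bound[OF AB])
          show "continuous_on {A..B} (\<lambda>x. cis (- (T j * cos x)) * packet_theta x * of_real (err (N j) x))"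
            by (intro continuous_intros qc errc)
          fix x assume x: "x \<in> {A..B}"
          have "\<bar>err (N j) x\<bar> \<le> K2 / N j" using x B2 elim by (intro K2) auto
          then show "cmod (cis (- (T j * cos x)) * packet_theta x * of_real (err (N j) x)) \<le> M * (K2 / N j)"
            unfolding norm_mult norm_of_real norm_cis mult_1 using M[OF x] M0 by (intro mult_mono) auto
        qed
        then have "sqrt (T j) * cmod (R j) \<le> sqrt (T j) * (M * (K2 / N j) * (B - A))"
          using Tpos[of j] by (intro mult_left_mono) auto
        also have "real (N j) = \<xi>j j * (sqrt (T j) * sqrt (T j))" using Tpos[of j] by (simp add: \<xi>j_def)
        also have "sqrt (T j) * (M * (K2 / (\<xi>j j * (sqrt (T j) * sqrt (T j)))) * (B - A)) = M * K2 * (B - A) / \<xi>j j * (1 / sqrt (T j))"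
        proof -
          have gen: "u * (M * (K2 / (x * (u * u))) * w) = M * K2 * w / x * (1 / u)" if "u > 0" "x > 0" for u x w :: real
            using that by (simp add: field_simps)
          show ?thesis by (rule gen) (use xp Tpos[of j] in auto)
        qed
        finally show ?case using Tpos[of j] by (simp add: norm_mult)
      qed
    qed
  qed
  define H where "H = h_amp 1 1 gam g \<xi>"
  have lb: "(\<lambda>j. cnj (P j) * (of_real (sqrt (T j)) * b1 j)) \<longlonglongrightarrow> H"
  proof -
    have eqP: "cnj (P j) * (of_real (sqrt (T j)) * b1 j) = (1/2) * cnj (lv_amp0 (N j) * cis (- ph (N j))) * cis (gam * pi / 2) * (of_real (sqrt (T j)) * I2 j)" for j
    proof -
      have "cnj (P j) * (cis ((N j + gam) * (pi / 2)) * cis (- (T j * cos (\<theta> j) + N j * \<theta> j))) = cnj (cis (- ph (N j))) * cis (gam * pi / 2)"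
        by (simp add: P_def ph_def cis_mult cis_cnj algebra_simps add_divide_distrib diff_divide_distrib)
      note ph_eq = this
      have "cnj (P j) * (of_real (sqrt (T j)) * b1 j) = (1/2) * cnj (lv_amp0 (N j)) *
          (cnj (P j) * (cis ((N j + gam) * (pi / 2)) * cis (- (T j * cos (\<theta> j) + N j * \<theta> j)))) * (of_real (sqrt (T j)) * I2 j)"
        unfolding b1_def by (simp only: mult_ac)
      then show ?thesis unfolding ph_eq complex_cnj_mult by (simp only: mult_ac)
    qed
    have lim: "(\<lambda>j. (1/2) * cnj (lv_amp0 (N j) * cis (- ph (N j))) * cis (gam * pi / 2) * (of_real (sqrt (T j)) * I2 j))
       \<longlonglongrightarrow> (1/2) * cnj (of_real (sqrt (2 / pi))) * cis (gam * pi / 2) * (cis (pi / 4) * of_real (sqrt (2 * pi / s)) * qt \<theta>0)"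
      by (intro tendsto_mult tendsto_const tendsto_cnj CN I2)
    have val: "(1/2) * cnj (of_real (sqrt (2 / pi))) * cis (gam * pi / 2) * (cis (pi / 4) * of_real (sqrt (2 * pi / s)) * qt \<theta>0) = H"
    proof -
      \<comment> \<open>The four factors are the 1/2 from the real part, the size of the Jacobi
        polynomials at the origin, the Fresnel integral with second derivative s, and the square
        root of the Jacobian. Together they give the amplitude in h.\<close>
      have r: "(1/2) * sqrt (2 / pi) * sqrt (2 * pi / s) * sqrt (sin \<theta>0) = \<xi> powr (1/2) * (1 - \<xi>\<^sup>2) powr (- 1/4)"
      proof -
        have "sqrt (2 / pi) * sqrt (2 * pi / s) = sqrt (4 / s)" by (simp add: real_sqrt_mult[symmetric])
        also have "\<dots> = 2 / sqrt s" by (simp add: real_sqrt_divide)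
        finally have 1: "(1/2) * (sqrt (2 / pi) * sqrt (2 * pi / s)) = 1 / sqrt s" by simp
        have p: "1 - \<xi>\<^sup>2 > 0" using spos unfolding s_def by simp
        have "1 / sqrt s = (1 - \<xi>\<^sup>2) powr (- 1/4)"
          unfolding s_def using p by (simp add: powr_half_sqrt[symmetric] powr_powr powr_minus_divide)
        then show ?thesis using 1 xi unfolding s\<theta> by (simp add: powr_half_sqrt)
      qed
      have c: "cis (gam * pi / 2) * cis (- (gam * \<theta>0)) = cis (gam * arccos \<xi>)"
        using xi unfolding \<theta>0_def by (simp add: cis_mult arccos_arcsin_eq algebra_simps)
      have "(1/2) * cnj (of_real (sqrt (2 / pi))) * cis (gam * pi / 2) * (cis (pi / 4) * of_real (sqrt (2 * pi / s)) * qt \<theta>0)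
        = cis (pi / 4) * (cis (gam * pi / 2) * cis (- (gam * \<theta>0))) * of_real ((1/2) * sqrt (2 / pi) * sqrt (2 * pi / s) * sqrt (sin \<theta>0)) * g (cos \<theta>0)"
        unfolding qt_def packet_theta_def by simp
      also have "\<dots> = H" unfolding r c c\<theta> unfolding H_def h_amp_def s_def by simp
      finally show ?thesis .
    qed
    show ?thesis using lim unfolding eqP val .
  qed
  have lE: "(\<lambda>j. cnj (P j) * (of_real (sqrt (T j)) * evolved_coef (T j) g (N j))) \<longlonglongrightarrow> H"
  proof (rule Lim_transform_eventually)
    have n0: "(\<lambda>j. cnj (P j) * y j) \<longlonglongrightarrow> 0" if "y \<longlonglongrightarrow> 0" for y
      by (rule Lim_null_comparison[OF _ tendsto_norm_zero[OF that]]) (simp add: P_def norm_mult)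
    have "(\<lambda>j. cnj (P j) * (of_real (sqrt (T j)) * a1 j) + cnj (P j) * (of_real (sqrt (T j)) * b1 j) + cnj (P j) * (of_real (sqrt (T j)) * R j)) \<longlonglongrightarrow> 0 + H + 0"
      by (intro tendsto_add n0 la lR lb)
    then show "(\<lambda>j. cnj (P j) * (of_real (sqrt (T j)) * a1 j) + cnj (P j) * (of_real (sqrt (T j)) * b1 j) + cnj (P j) * (of_real (sqrt (T j)) * R j)) \<longlonglongrightarrow> H" by simp
    show "\<forall>\<^sub>F j in sequentially. cnj (P j) * (of_real (sqrt (T j)) * a1 j) + cnj (P j) * (of_real (sqrt (T j)) * b1 j) + cnj (P j) * (of_real (sqrt (T j)) * R j)
       = cnj (P j) * (of_real (sqrt (T j)) * evolved_coef (T j) g (N j))"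
      using evg by eventually_elim (simp only: E ring_distribs)
  qed
  have lU: "(\<lambda>j. cnj (P j) * (of_real (sqrt (T j)) * U_seq \<alpha> \<beta> (T j) g (N j))) \<longlonglongrightarrow> H"
  proof (rule Lim_transform_eventually)
    have p: "1 - \<xi>\<^sup>2 \<noteq> 0" using spos unfolding s_def by auto
    have "isCont g (sqrt (1 - \<xi>\<^sup>2))" using gd has_vector_derivative_continuous by blast
    then have "(\<lambda>j. g (1 * sqrt (1 - (\<xi>j j)\<^sup>2))) \<longlonglongrightarrow> g (1 * sqrt (1 - \<xi>\<^sup>2))"
      by (intro isCont_tendsto_compose[of _ g]) (auto intro!: tendsto_intros xl)
    moreover have "(\<lambda>j. arccos (\<xi>j j)) \<longlonglongrightarrow> arccos \<xi>"
      using isCont_arccos[of \<xi>] xi by (intro isCont_tendsto_compose[OF _ xl]) auto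
    ultimately show "(\<lambda>j. h_amp 1 1 gam g (\<xi>j j)) \<longlonglongrightarrow> H"
      unfolding H_def h_amp_def using p xi by (intro tendsto_intros xl) auto
    show "\<forall>\<^sub>F j in sequentially. h_amp 1 1 gam g (\<xi>j j) = cnj (P j) * (of_real (sqrt (T j)) * U_seq \<alpha> \<beta> (T j) g (N j))"
      using evg
    proof eventually_elim
      case (elim j)
      have "0 < \<xi>j j" "\<xi>j j < 1" using elim by (auto simp: good_def)
      then have nn: "0 < N j" "real (N j) < \<bar>T j\<bar>" using Tpos[of j] by (auto simp: \<xi>j_def zero_less_divide_iff)
      \<comment> \<open>g vanishes on the negative axis, so only h with the upper sign is
        present.\<close>
      have neg: "h_amp 1 (- 1) gam g (\<xi>j j) = 0"
      proof -
        have "(\<xi>j j)\<^sup>2 < 1" using \<open>0 < \<xi>j j\<close> \<open>\<xi>j j < 1\<close> by (simp add: power_less_one_iff)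
        then have "sqrt (1 - (\<xi>j j)\<^sup>2) > 0" by simp
        then have "- 1 * sqrt (1 - (\<xi>j j)\<^sup>2) \<notin> {l..r}" using lr unfolding atLeastAtMost_iff by linarith
        then show ?thesis by (simp add: h_amp_def supp)
      qed
      have "psi (\<xi>j j) * T j = N j * arccos (\<xi>j j) - T j * cos (\<theta> j)"
        unfolding psi_def sg(2)[OF elim] using Tpos[of j] by (simp add: \<xi>j_def algebra_simps)
      then have ps: "psi (\<xi>j j) * T j = N j * (pi / 2) - N j * \<theta> j - T j * cos (\<theta> j)"
        unfolding sg(3)[OF elim] by (simp add: algebra_simps)
      have "U_seq \<alpha> \<beta> (T j) g (N j) = cis (- (real (N j) * pi / 2)) * cis ((\<alpha> - \<beta>) * pi / 4) * of_real (T j powr (- 1/2)) *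
          (cis (psi (\<xi>j j) * T j) * h_amp 1 1 gam g (\<xi>j j) + cis (- psi (\<xi>j j) * T j) * h_amp 1 (- 1) gam g (\<xi>j j))"
        unfolding U_seq_def Let_def gam_def powi_minus_i[symmetric] using nn Tpos[of j] by (simp add: \<xi>j_def)
      also have "\<dots> = (cis (- (real (N j) * pi / 2)) * cis ((\<alpha> - \<beta>) * pi / 4) * cis (psi (\<xi>j j) * T j)) * of_real (T j powr (- 1/2)) * h_amp 1 1 gam g (\<xi>j j)"
        unfolding neg by simp
      also have "cis (- (real (N j) * pi / 2)) * cis ((\<alpha> - \<beta>) * pi / 4) * cis (psi (\<xi>j j) * T j) = P j"
        unfolding ps P_def cis_mult by (rule arg_cong[where f = cis]) (simp add: field_simps)
      finally have "cnj (P j) * (of_real (sqrt (T j)) * U_seq \<alpha> \<beta> (T j) g (N j))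
        = (cnj (P j) * P j) * (of_real (sqrt (T j) * T j powr (- 1/2))) * h_amp 1 1 gam g (\<xi>j j)" by simp
      also have "cnj (P j) * P j = 1" by (simp add: P_def cis_cnj cis_mult)
      also have "sqrt (T j) * T j powr (- 1/2) = 1"
        using Tpos[of j] by (simp add: powr_minus_divide powr_half_sqrt)
      finally show ?case by simp
    qed
  qed
  have "(\<lambda>j. (cmod (cnj (P j) * (of_real (sqrt (T j)) * evolved_coef (T j) g (N j)) + cnj (P j) * (of_real (sqrt (T j)) * U_seq \<alpha> \<beta> (T j) g (N j))))\<^sup>2) \<longlonglongrightarrow> (cmod (H + H))\<^sup>2"
    by (intro tendsto_intros lE lU)
  moreover have "(cmod (cnj (P j) * (of_real (sqrt (T j)) * evolved_coef (T j) g (N j)) + cnj (P j) * (of_real (sqrt (T j)) * U_seq \<alpha> \<beta> (T j) g (N j))))\<^sup>2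
      = T j * (cmod (evolved_coef (T j) g (N j) + U_seq \<alpha> \<beta> (T j) g (N j)))\<^sup>2" for j
  proof -
    have "cnj (P j) * (of_real (sqrt (T j)) * evolved_coef (T j) g (N j)) + cnj (P j) * (of_real (sqrt (T j)) * U_seq \<alpha> \<beta> (T j) g (N j))
      = cnj (P j) * (of_real (sqrt (T j)) * (evolved_coef (T j) g (N j) + U_seq \<alpha> \<beta> (T j) g (N j)))" by (simp only: ring_distribs)
    then show ?thesis using Tpos[of j] by (simp add: norm_mult power_mult_distrib P_def)
  qed
  moreover have "(cmod (H + H))\<^sup>2 = 4 * (cmod H)\<^sup>2"
  proof -
    have "H + H = 2 * H" by simp
    then show ?thesis by (simp add: norm_mult power_mult_distrib)
  qed
  ultimately show ?thesis unfolding H_def by simp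
qed

end

section \<open>Convergence in norm\<close>

context jacobi_packet begin

text \<open>The density of |U(t) g|^2 in the variable \<xi> = n / t.\<close>

definition U_density :: "real \<Rightarrow> real" where
  "U_density \<xi> = (if 0 < \<xi> \<and> \<xi> < 1 then (cmod (h_amp 1 1 gam g \<xi>))\<^sup>2 else 0)"

lemma U_density_eq:
  assumes "0 < \<xi>" "\<xi> < 1"
  shows "U_density \<xi> = \<xi> / sqrt (1 - \<xi>\<^sup>2) * (cmod (g (sqrt (1 - \<xi>\<^sup>2))))\<^sup>2"
proof -
  have "\<xi>\<^sup>2 < 1" using assms by (simp add: power_less_one_iff)
  then have p: "1 - \<xi>\<^sup>2 > 0" by simp
  have "(\<xi> powr (1/2))\<^sup>2 = \<xi>" using assms by (simp add: powr_half_sqrt)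
  moreover have "((1 - \<xi>\<^sup>2) powr (- 1/4))\<^sup>2 = 1 / sqrt (1 - \<xi>\<^sup>2)"
  proof -
    have "((1 - \<xi>\<^sup>2) powr (- 1/4))\<^sup>2 = (1 - \<xi>\<^sup>2) powr (- (1/2))"
      by (simp add: power2_eq_square powr_add[symmetric])
    then show ?thesis using p by (simp add: powr_minus_divide powr_half_sqrt)
  qed
  ultimately show ?thesis
    using assms by (simp add: U_density_def h_amp_def norm_mult power_mult_distrib)
qed

lemma U_density_nonneg: "U_density \<xi> \<ge> 0"
  by (simp add: U_density_def)

lemma U_density_cont: "continuous_on {0<..<1} U_density"
proof -
  have "continuous_on {0<..<1} (\<lambda>\<xi>. \<xi> / sqrt (1 - \<xi>\<^sup>2) * (cmod (g (sqrt (1 - \<xi>\<^sup>2))))\<^sup>2)"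
  proof (intro continuous_intros)
    show "continuous_on {0<..<1} (\<lambda>\<xi>. g (sqrt (1 - \<xi>\<^sup>2)))"
      by (rule continuous_on_compose2[OF gcont[of UNIV]]) (auto intro!: continuous_intros)
    show "\<forall>x\<in>{0<..<1}. sqrt (1 - x\<^sup>2) \<noteq> 0" by (auto simp: power2_eq_1_iff)
  qed
  then show ?thesis by (rule continuous_on_eq) (simp add: U_density_eq)
qed

lemma U_density_measurable [measurable]: "U_density \<in> borel_measurable borel"
proof -
  have "(\<lambda>x. indicator {0<..<1} x *\<^sub>R U_density x) \<in> borel_measurable borel"
    by (rule borel_measurable_continuous_on_indicator[OF _ U_density_cont]) simp
  moreover have "(\<lambda>x. indicator {0<..<1} x *\<^sub>R U_density x) = U_density" by (auto simp: U_density_def indicator_def fun_eq_iff)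
  ultimately show ?thesis by simp
qed

text \<open>The substitution x = sqrt(1 - \<xi>^2), under which \<xi> / sqrt(1 - \<xi>^2) is the
  absolute value of dx / d\<xi>. This is what fixes the powers of \<xi> and 1 - \<xi>^2 in h: they
  make U(t) asymptotically norm preserving.\<close>

lemma U_density_integral: "(\<integral>\<^sup>+ \<xi>. ennreal (U_density \<xi>) \<partial>lborel) = ennreal (LINT x|lborel. (cmod (g x))\<^sup>2)"
proof -
  define a b where "a = sqrt (1 - r\<^sup>2)" and "b = sqrt (1 - l\<^sup>2)"
  have r2: "r\<^sup>2 < 1" "l\<^sup>2 < 1" "l\<^sup>2 > 0" "r\<^sup>2 > 0" using lr by (auto simp: power_less_one_iff)
  have lr2: "l\<^sup>2 \<le> r\<^sup>2" using lr by (intro power_mono) auto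
  have ab': "0 < a" "a \<le> b" "b < 1" unfolding a_def b_def using r2 lr2 by auto
  have ma: "sqrt (1 - a\<^sup>2) = r" "sqrt (1 - b\<^sup>2) = l" unfolding a_def b_def using r2 lr by auto
  define f where "f x = (cmod (g x))\<^sup>2" for x
  have fc: "continuous_on S f" for S unfolding f_def by (intro continuous_intros gcont)
  have rng: "sqrt (1 - x\<^sup>2) \<in> {l..r}" if "x \<in> {a..b}" for x
  proof -
    have "a\<^sup>2 \<le> x\<^sup>2" "x\<^sup>2 \<le> b\<^sup>2" using that ab' by (auto intro!: power_mono)
    then have "sqrt (1 - b\<^sup>2) \<le> sqrt (1 - x\<^sup>2)" "sqrt (1 - x\<^sup>2) \<le> sqrt (1 - a\<^sup>2)" by auto
    then show ?thesis unfolding ma by simp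
  qed
  have pos: "1 - x\<^sup>2 > 0" if "x \<in> {a..b}" for x
    using rng[OF that] lr by (smt (verit) atLeastAtMost_iff real_sqrt_gt_0_iff)
  have "((\<lambda>x. (- x / sqrt (1 - x\<^sup>2)) *\<^sub>R f (sqrt (1 - x\<^sup>2))) has_integral (integral {sqrt (1 - a\<^sup>2)..sqrt (1 - b\<^sup>2)} f - integral {sqrt (1 - b\<^sup>2)..sqrt (1 - a\<^sup>2)} f)) {a..b}"
  proof (rule has_integral_substitution_general[where s = "{}" and c = l and d = r])
    fix x assume "x \<in> {a..b} - {}"
    then have p: "1 - x\<^sup>2 > 0" using pos by auto
    have "((\<lambda>x. 1 - x\<^sup>2) has_real_derivative (- (2 * x))) (at x within {a..b})"
      by (auto intro!: derivative_eq_intros)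
    from DERIV_chain'[OF this DERIV_real_sqrt[OF p]]
    show "((\<lambda>x. sqrt (1 - x\<^sup>2)) has_real_derivative - x / sqrt (1 - x\<^sup>2)) (at x within {a..b})"
    proof (rule DERIV_cong)
      have "sqrt (1 - x\<^sup>2) > 0" using p by simp
      then show "inverse (sqrt (1 - x\<^sup>2)) / 2 * - (2 * x) = - x / sqrt (1 - x\<^sup>2)" by (simp add: field_simps)
    qed
  qed (use ab' rng fc in \<open>auto intro!: continuous_intros\<close>)
  moreover have "integral {r..l} f = 0" using lr by (cases "l = r") auto
  ultimately have "((\<lambda>x. (- x / sqrt (1 - x\<^sup>2)) *\<^sub>R f (sqrt (1 - x\<^sup>2))) has_integral (- integral {l..r} f)) {a..b}"
    unfolding ma by simp
  from has_integral_neg[OF this]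
  have "((\<lambda>x. - ((- x / sqrt (1 - x\<^sup>2)) *\<^sub>R f (sqrt (1 - x\<^sup>2)))) has_integral integral {l..r} f) {a..b}" by simp
  then have hi: "(U_density has_integral integral {l..r} f) {a..b}"
    by (rule has_integral_eq[rotated]) (use ab' in \<open>auto simp: U_density_eq f_def\<close>)
  have wz: "U_density \<xi> = 0" if "\<xi> \<notin> {a..b}" for \<xi>
  proof (cases "0 < \<xi> \<and> \<xi> < 1")
    case True
    then have x: "0 < \<xi>" "\<xi> < 1" by auto
    have "sqrt (1 - \<xi>\<^sup>2) \<notin> {l..r}"
    proof
      assume "sqrt (1 - \<xi>\<^sup>2) \<in> {l..r}"
      then have y: "l \<le> sqrt (1 - \<xi>\<^sup>2)" "sqrt (1 - \<xi>\<^sup>2) \<le> r" by auto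
      have x1: "\<xi>\<^sup>2 < 1" using x by (simp add: power_less_one_iff)
      have "l\<^sup>2 \<le> (sqrt (1 - \<xi>\<^sup>2))\<^sup>2" by (rule power_mono[OF y(1)]) (use lr in simp)
      moreover have "(sqrt (1 - \<xi>\<^sup>2))\<^sup>2 \<le> r\<^sup>2" by (rule power_mono[OF y(2)]) (use x1 in simp)
      ultimately have "1 - r\<^sup>2 \<le> \<xi>\<^sup>2" "\<xi>\<^sup>2 \<le> 1 - l\<^sup>2" using x1 by auto
      then have "sqrt (1 - r\<^sup>2) \<le> sqrt (\<xi>\<^sup>2)" "sqrt (\<xi>\<^sup>2) \<le> sqrt (1 - l\<^sup>2)" by (simp_all del: real_sqrt_abs)
      then have "a \<le> \<xi>" "\<xi> \<le> b" unfolding a_def b_def using x by (simp_all add: real_sqrt_abs)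
      with that show False by auto
    qed
    then show ?thesis using x supp by (simp add: U_density_eq)
  next
    case False
    then show ?thesis unfolding U_density_def by (simp only: if_False)
  qed
  have "(U_density has_integral integral {l..r} f) UNIV"
    by (rule has_integral_on_superset[OF hi]) (auto intro: wz)
  then have "(\<integral>\<^sup>+ \<xi>. ennreal (U_density \<xi>) \<partial>lborel) = ennreal (integral {l..r} f)"
    by (rule nn_integral_has_integral_lborel[OF U_density_measurable U_density_nonneg])
  also have "integral {l..r} f = (LINT x|lborel. f x)"
  proof -
    have A: "(LINT x:{l..r}|lborel. f x) = integral {l..r} f"
      by (intro set_borel_integral_eq_integral borel_integrable_atLeastAtMost' fc)
    have B: "indicator {l..r} x *\<^sub>R f x = f x" for x by (cases "x \<in> {l..r}") (auto simp: f_def supp)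
    show ?thesis using A unfolding set_lebesgue_integral_def B by simp
  qed
  finally show ?thesis unfolding f_def .
qed

text \<open>An exact identity for every n: g is supported on the positive axis, so one of the two
  waves is absent and there is no interference term.\<close>

lemma U_norm:
  assumes "t > 0"
  shows "(cmod (U_seq \<alpha> \<beta> t g n))\<^sup>2 = U_density (n / t) * (1 / t)"
proof (cases "0 < n \<and> real n < t")
  case True
  then have x: "0 < n / t" "n / t < 1" using assms by auto
  have "- 1 * sqrt (1 - (n / t)\<^sup>2) \<notin> {l..r}"
  proof -
    have "(n / t)\<^sup>2 < 1" using x by (simp add: power_less_one_iff del: power_divide)
    then have "sqrt (1 - (n / t)\<^sup>2) > 0" by simp
    then show ?thesis using lr unfolding atLeastAtMost_iff by linarith
  qed
  then have neg: "h_amp 1 (- 1) gam g (n / t) = 0" by (simp add: h_amp_def supp del: power_divide)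
  have "U_seq \<alpha> \<beta> t g n = \<i> powi (- int n) * cis ((\<alpha> - \<beta>) * pi / 4) * of_real (t powr (- 1/2)) *
          (cis (psi (n / t) * t) * h_amp 1 1 gam g (n / t) + cis (- psi (n / t) * t) * h_amp 1 (- 1) gam g (n / t))"
    unfolding U_seq_def Let_def gam_def using True assms by simp
  then have "cmod (U_seq \<alpha> \<beta> t g n) = t powr (- 1/2) * cmod (h_amp 1 1 gam g (n / t))"
    unfolding neg powi_minus_i by (simp add: norm_mult)
  moreover have "(t powr (- 1/2))\<^sup>2 = 1 / t"
  proof -
    have "(t powr (- 1/2))\<^sup>2 = t powr (- 1)" by (simp add: power2_eq_square powr_add[symmetric])
    then show ?thesis using assms by (simp add: powr_minus_divide)
  qed
  ultimately show ?thesis using x by (simp add: U_density_def power_mult_distrib)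
next
  case False
  then have "\<not> (0 < n \<and> real n < \<bar>t\<bar>)" using assms by auto
  then have "U_seq \<alpha> \<beta> t g n = 0" unfolding U_seq_def by (rule if_not_P)
  moreover have "U_density (n / t) = 0" using False assms by (auto simp: U_density_def)
  ultimately show ?thesis by simp
qed

lemma U_summable: "square_summable (U_seq \<alpha> \<beta> t gg)"
  using U_approx.rep_eq[of \<alpha> \<beta> t gg] ell2_nth[of "U_approx \<alpha> \<beta> t gg"] by simp

text \<open>The squared norms are Riemann sums of \<open>U_density\<close> with mesh 1 / T j. The
  density is bounded because sqrt(1 - \<xi>^2) \<ge> l wherever g contributes.\<close>

lemma U_norm_limit:
  assumes T: "filterlim T at_top sequentially" and T1: "\<And>j. T j \<ge> 1"
  shows "(\<lambda>j. \<Sum>n. (cmod (U_seq \<alpha> \<beta> (T j) g n))\<^sup>2) \<longlonglongrightarrow> (LINT x|lborel. (cmod (g x))\<^sup>2)"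
proof -
  have Tpos: "T j > 0" for j using T1[of j] by simp
  define u where "u j \<xi> = ennreal (U_density (real (nat \<lfloor>\<xi> * T j\<rfloor>) / T j)) * indicator {0..} \<xi>" for j \<xi>
  have iu: "(\<integral>\<^sup>+ \<xi>. u j \<xi> \<partial>lborel) = ennreal (\<Sum>n. (cmod (U_seq \<alpha> \<beta> (T j) g n))\<^sup>2)" for j
  proof -
    have "(\<integral>\<^sup>+ \<xi>. u j \<xi> \<partial>lborel) = (\<Sum>n. ennreal (U_density (real n / T j)) * ennreal (1 / T j))"
      unfolding u_def by (rule nn_integral_floor[OF Tpos])
    also have "\<dots> = (\<Sum>n. ennreal ((cmod (U_seq \<alpha> \<beta> (T j) g n))\<^sup>2))"
    proof (rule suminf_cong)
      fix n
      show "ennreal (U_density (real n / T j)) * ennreal (1 / T j) = ennreal ((cmod (U_seq \<alpha> \<beta> (T j) g n))\<^sup>2)"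
        unfolding U_norm[OF Tpos] using Tpos[of j] by (subst ennreal_mult) (auto simp: U_density_nonneg)
    qed
    also have "\<dots> = ennreal (\<Sum>n. (cmod (U_seq \<alpha> \<beta> (T j) g n))\<^sup>2)"
      by (rule suminf_ennreal2) (use U_summable[where gg = g] in \<open>auto simp: square_summable_def\<close>)
    finally show ?thesis .
  qed
  have "bounded (g ` {l..r})" by (intro compact_imp_bounded compact_continuous_image gcont) auto
  then obtain M where M: "\<And>x. x \<in> {l..r} \<Longrightarrow> cmod (g x) \<le> M"
    unfolding bounded_iff by (auto simp del: atLeastAtMost_iff)
  have M0: "M \<ge> 0" using order_trans[OF norm_ge_zero M[of l]] lr by simp
  have wb: "U_density \<xi> \<le> M\<^sup>2 / l" for \<xi>
  proof (cases "0 < \<xi> \<and> \<xi> < 1 \<and> sqrt (1 - \<xi>\<^sup>2) \<in> {l..r}")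
    case True
    then have "U_density \<xi> = \<xi> / sqrt (1 - \<xi>\<^sup>2) * (cmod (g (sqrt (1 - \<xi>\<^sup>2))))\<^sup>2" by (intro U_density_eq) auto
    also have "\<dots> \<le> 1 / l * M\<^sup>2"
      using True M lr by (intro mult_mono frac_le power_mono) auto
    finally show ?thesis by simp
  next
    case False
    have "U_density \<xi> = 0"
    proof (cases "0 < \<xi> \<and> \<xi> < 1")
      case True
      with False have "sqrt (1 - \<xi>\<^sup>2) \<notin> {l..r}" by blast
      then show ?thesis using True supp by (simp add: U_density_eq)
    next
      case False
      then show ?thesis unfolding U_density_def by (simp only: if_False)
    qed
    then show ?thesis using M0 lr by simp
  qed
  have "(\<lambda>j. \<integral>\<^sup>+ \<xi>. u j \<xi> \<partial>lborel) \<longlonglongrightarrow> (\<integral>\<^sup>+ \<xi>. ennreal (U_density \<xi>) \<partial>lborel)"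
  proof (rule nn_integral_dominated_convergence)
    show "u j \<in> borel_measurable lborel" for j
      unfolding u_def[abs_def] by measurable
    show "(\<lambda>\<xi>::real. ennreal (M\<^sup>2 / l) * indicator {0..2} \<xi>) \<in> borel_measurable lborel" by measurable
    show "(\<integral>\<^sup>+ \<xi>. ennreal (M\<^sup>2 / l) * indicator {0..2::real} \<xi> \<partial>lborel) < \<infinity>"
      by (subst nn_integral_cmult_indicator) (auto simp: ennreal_mult_less_top)
    show "AE \<xi> in lborel. u j \<xi> \<le> ennreal (M\<^sup>2 / l) * indicator {0..2} \<xi>" for j
    proof (rule AE_I2)
      fix \<xi> :: real
      show "u j \<xi> \<le> ennreal (M\<^sup>2 / l) * indicator {0..2} \<xi>"
      proof (cases "\<xi> > 2")
        case True
        \<comment> \<open>For T j \<ge> 1 rounding down costs at most T j, so the index stays beyond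
          the cutoff n \<ge> t, and the interval from 0 to 2 carries a common majorant.\<close>
        have "\<xi> * T j \<ge> 2 * T j" using True Tpos[of j] by simp
        then have "real (nat \<lfloor>\<xi> * T j\<rfloor>) \<ge> T j" using T1[of j] by linarith
        then have "U_density (real (nat \<lfloor>\<xi> * T j\<rfloor>) / T j) = 0" using Tpos[of j] by (simp add: U_density_def)
        then show ?thesis by (simp add: u_def)
      next
        case False
        then show ?thesis using wb unfolding u_def by (auto simp: indicator_def intro!: ennreal_leI)
      qed
    qed
    show "AE \<xi> in lborel. (\<lambda>j. u j \<xi>) \<longlonglongrightarrow> ennreal (U_density \<xi>)"
      using AE_lborel_singleton[of "0::real"] AE_lborel_singleton[of "1::real"]
    proof eventually_elim
      case (elim \<xi>)
      consider "\<xi> < 0" | "0 < \<xi>" "\<xi> < 1" | "1 < \<xi>" using elim by linarith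
      then show ?case
      proof cases
        case 1
        then show ?thesis by (simp add: u_def U_density_def)
      next
        case 2
        have fl: "(\<lambda>j. real (nat \<lfloor>\<xi> * T j\<rfloor>) / T j) \<longlonglongrightarrow> \<xi>" by (rule floor_ratio_limit[OF T]) (use 2 in simp)
        have "isCont U_density \<xi>" using U_density_cont 2 by (simp add: continuous_on_eq_continuous_at)
        then have "(\<lambda>j. U_density (real (nat \<lfloor>\<xi> * T j\<rfloor>) / T j)) \<longlonglongrightarrow> U_density \<xi>" by (rule isCont_tendsto_compose[OF _ fl])
        then have "(\<lambda>j. ennreal (U_density (real (nat \<lfloor>\<xi> * T j\<rfloor>) / T j))) \<longlonglongrightarrow> ennreal (U_density \<xi>)" by (rule tendsto_ennrealI)
        then show ?thesis using 2 by (simp add: u_def)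
      next
        case 3
        have fl: "(\<lambda>j. real (nat \<lfloor>\<xi> * T j\<rfloor>) / T j) \<longlonglongrightarrow> \<xi>" by (rule floor_ratio_limit[OF T]) (use 3 in simp)
        have "eventually (\<lambda>j. real (nat \<lfloor>\<xi> * T j\<rfloor>) / T j > 1) sequentially" by (rule order_tendstoD(1)[OF fl 3])
        then have "eventually (\<lambda>j. u j \<xi> = 0) sequentially"
          by eventually_elim (simp add: u_def U_density_def)
        moreover have "U_density \<xi> = 0" using 3 by (simp add: U_density_def)
        ultimately show ?thesis using tendsto_eventually[of "\<lambda>j. u j \<xi>" 0 sequentially] by simp
      qed
    qed
  qed auto
  then have "(\<lambda>j. ennreal (\<Sum>n. (cmod (U_seq \<alpha> \<beta> (T j) g n))\<^sup>2)) \<longlonglongrightarrow> ennreal (LINT x|lborel. (cmod (g x))\<^sup>2)"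
    unfolding iu U_density_integral .
  then show ?thesis
    by (rule tendsto_ennrealD) (auto intro!: suminf_nonneg always_eventually integral_nonneg_AE simp: U_summable[where gg = g, unfolded square_summable_def])
qed

text \<open>For the squared norms D of the difference, S of the sum and V of U(t) g, one has D + S
  \<le> 2 G2 + 2 V. The right-hand side tends to 4 G2, while Fatou's lemma gives liminf S \<ge> 4
  G2.\<close>

lemma half_evolution_limit:
  "((\<lambda>t. \<Sum>n. (cmod (evolved_coef t g n - U_seq \<alpha> \<beta> t g n))\<^sup>2) \<longlongrightarrow> 0) at_top"
proof (rule tendsto_at_topI_sequentially)
  fix X :: "nat \<Rightarrow> real" assume X: "filterlim X at_top sequentially"
  then obtain N0 where N0: "\<And>j. j \<ge> N0 \<Longrightarrow> X j \<ge> 1"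
    unfolding filterlim_at_top eventually_sequentially by blast
  \<comment> \<open>Finitely many times are dropped so that T j \<ge> 1 holds throughout, as
    \<open>U_norm_limit\<close> requires; \<open>LIMSEQ_offset\<close> restores them.\<close>
  define T where "T j = X (j + N0)" for j
  have T: "filterlim T at_top sequentially" unfolding T_def by (rule filterlim_compose[OF X filterlim_add_const_nat_at_top])
  have T1: "T j \<ge> 1" for j unfolding T_def by (rule N0) simp
  have Tpos: "T j > 0" for j using T1[of j] by simp
  define G2 where "G2 = (LINT x|lborel. (cmod (g x))\<^sup>2)"
  have G0: "G2 \<ge> 0" unfolding G2_def by (rule integral_nonneg_AE) simp
  define V where "V j = (\<Sum>n. (cmod (U_seq \<alpha> \<beta> (T j) g n))\<^sup>2)" for j
  define S where "S j = (\<Sum>n. (cmod (evolved_coef (T j) g n + U_seq \<alpha> \<beta> (T j) g n))\<^sup>2)" for j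
  define D where "D j = (\<Sum>n. (cmod (evolved_coef (T j) g n - U_seq \<alpha> \<beta> (T j) g n))\<^sup>2)" for j
  have V: "V \<longlonglongrightarrow> G2" unfolding V_def G2_def by (rule U_norm_limit[OF T T1])
  have be: "bdd_supp (\<lambda>x. cis (- (t * x)) * g x)" for t by (intro bdd_supp_mult g_bdd_supp continuous_intros)
  have se: "square_summable (evolved_coef t g)" for t unfolding evolved_coef_def by (rule bessel(2)[OF be])
  have e: "(\<Sum>n. (cmod (evolved_coef t g n))\<^sup>2) \<le> G2" for t
    using bessel(3)[OF be[of t]] by (simp add: evolved_coef_def G2_def norm_mult)
  have ss: "summable (\<lambda>n. (cmod (evolved_coef t g n + U_seq \<alpha> \<beta> t g n))\<^sup>2)" for t
    using square_summable_add(1)[OF se[of t] U_summable[where gg = g and t = t]] by (simp add: square_summable_def)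
  have sd: "summable (\<lambda>n. (cmod (evolved_coef t g n - U_seq \<alpha> \<beta> t g n))\<^sup>2)" for t
    using square_summable_add(1)[OF se[of t], of "\<lambda>n. - U_seq \<alpha> \<beta> t g n"] U_summable[where gg = g and t = t] by (simp add: square_summable_def)
  have par: "D j + S j \<le> 2 * G2 + 2 * V j" for j
  proof -
    have "D j + S j = (\<Sum>n. (cmod (evolved_coef (T j) g n - U_seq \<alpha> \<beta> (T j) g n))\<^sup>2 + (cmod (evolved_coef (T j) g n + U_seq \<alpha> \<beta> (T j) g n))\<^sup>2)"
      unfolding D_def S_def by (rule suminf_add[OF sd ss])
    also have "(\<lambda>n. (cmod (evolved_coef (T j) g n - U_seq \<alpha> \<beta> (T j) g n))\<^sup>2 + (cmod (evolved_coef (T j) g n + U_seq \<alpha> \<beta> (T j) g n))\<^sup>2)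
      = (\<lambda>n. 2 * (cmod (evolved_coef (T j) g n))\<^sup>2 + 2 * (cmod (U_seq \<alpha> \<beta> (T j) g n))\<^sup>2)"
    proof
      fix n
      have "(cmod (x - y))\<^sup>2 + (cmod (x + y))\<^sup>2 = 2 * (cmod x)\<^sup>2 + 2 * (cmod y)\<^sup>2" for x y
        unfolding cmod_power2 by (simp add: power2_eq_square algebra_simps)
      then show "(cmod (evolved_coef (T j) g n - U_seq \<alpha> \<beta> (T j) g n))\<^sup>2 + (cmod (evolved_coef (T j) g n + U_seq \<alpha> \<beta> (T j) g n))\<^sup>2
        = 2 * (cmod (evolved_coef (T j) g n))\<^sup>2 + 2 * (cmod (U_seq \<alpha> \<beta> (T j) g n))\<^sup>2" .
    qed
    also have "suminf \<dots> = 2 * (\<Sum>n. (cmod (evolved_coef (T j) g n))\<^sup>2) + 2 * V j"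
      unfolding V_def using se[of "T j"] U_summable[where gg = g and t = "T j"]
      by (simp add: square_summable_def suminf_add[symmetric] suminf_mult summable_mult)
    also have "\<dots> \<le> 2 * G2 + 2 * V j" using e[of "T j"] by simp
    finally show ?thesis .
  qed
  define u where "u j \<xi> = ennreal (T j * (cmod (evolved_coef (T j) g (nat \<lfloor>\<xi> * T j\<rfloor>) + U_seq \<alpha> \<beta> (T j) g (nat \<lfloor>\<xi> * T j\<rfloor>)))\<^sup>2) * indicator {0..} \<xi>" for j \<xi>
  have iu: "(\<integral>\<^sup>+ \<xi>. u j \<xi> \<partial>lborel) = ennreal (S j)" for j
  proof -
    have "(\<integral>\<^sup>+ \<xi>. u j \<xi> \<partial>lborel) = (\<Sum>n. ennreal (T j * (cmod (evolved_coef (T j) g n + U_seq \<alpha> \<beta> (T j) g n))\<^sup>2) * ennreal (1 / T j))"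
      unfolding u_def by (rule nn_integral_floor[OF Tpos])
    also have "\<dots> = (\<Sum>n. ennreal ((cmod (evolved_coef (T j) g n + U_seq \<alpha> \<beta> (T j) g n))\<^sup>2))"
    proof (rule suminf_cong)
      fix n
      show "ennreal (T j * (cmod (evolved_coef (T j) g n + U_seq \<alpha> \<beta> (T j) g n))\<^sup>2) * ennreal (1 / T j) = ennreal ((cmod (evolved_coef (T j) g n + U_seq \<alpha> \<beta> (T j) g n))\<^sup>2)"
        using Tpos[of j] by (subst ennreal_mult[symmetric]) auto
    qed
    also have "\<dots> = ennreal (S j)" unfolding S_def by (rule suminf_ennreal2) (auto intro: ss)
    finally show ?thesis .
  qed
  have "ennreal (4 * G2) = (\<integral>\<^sup>+ \<xi>. ennreal (4 * U_density \<xi>) \<partial>lborel)"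
    by (simp add: ennreal_mult U_density_nonneg nn_integral_cmult U_density_integral G2_def G0[unfolded G2_def])
  also have "\<dots> \<le> (\<integral>\<^sup>+ \<xi>. liminf (\<lambda>j. u j \<xi>) \<partial>lborel)"
  proof (rule nn_integral_mono)
    fix \<xi> :: real
    show "ennreal (4 * U_density \<xi>) \<le> liminf (\<lambda>j. u j \<xi>)"
    \<comment> \<open>Where the density vanishes the lower bound is trivial; elsewhere g is nonzero
      at the stationary point and \<open>coefficient_asymptotics\<close> applies.\<close>
    proof (cases "U_density \<xi> = 0")
      case False
      then have x: "0 < \<xi>" "\<xi> < 1" by (auto simp: U_density_def split: if_splits)
      then have "g (sqrt (1 - \<xi>\<^sup>2)) \<noteq> 0" using False by (auto simp: U_density_eq)
      from coefficient_asymptotics[OF T Tpos x this]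
      have "(\<lambda>j. u j \<xi>) \<longlonglongrightarrow> ennreal (4 * (cmod (h_amp 1 1 gam g \<xi>))\<^sup>2) * indicator {0..} \<xi>"
        unfolding u_def using x by (simp add: tendsto_ennrealI)
      then have "liminf (\<lambda>j. u j \<xi>) = ennreal (4 * U_density \<xi>)"
        using x by (intro lim_imp_Liminf) (auto simp: U_density_def)
      then show ?thesis by simp
    qed simp
  qed
  also have "\<dots> \<le> liminf (\<lambda>j. \<integral>\<^sup>+ \<xi>. u j \<xi> \<partial>lborel)"
    by (rule nn_integral_liminf) (unfold u_def[abs_def], measurable)
  finally have L: "ennreal (4 * G2) \<le> liminf (\<lambda>j. ennreal (S j))" unfolding iu .
  have "D \<longlonglongrightarrow> 0"
  proof (rule tendstoI)
    fix \<epsilon> :: real assume \<epsilon>: "\<epsilon> > 0"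
    have S0: "S j \<ge> 0" for j unfolding S_def by (rule suminf_nonneg[OF ss]) simp
    have evS: "eventually (\<lambda>j. S j > 4 * G2 - \<epsilon> / 4) sequentially"
    \<comment> \<open>The embedding into \<open>ennreal\<close> truncates negative numbers to 0, so
      a strict comparison there is meaningful only for a nonnegative threshold.\<close>
    proof (cases "4 * G2 - \<epsilon> / 4 < 0")
      case True
      then show ?thesis using S0 by (intro always_eventually allI) (meson less_le_trans)
    next
      case False
      have "ennreal (4 * G2 - \<epsilon> / 4) < ennreal (4 * G2)" using False \<epsilon> by (intro ennreal_lessI) auto
      then have "ennreal (4 * G2 - \<epsilon> / 4) < liminf (\<lambda>j. ennreal (S j))" using L by (rule less_le_trans)
      then have "eventually (\<lambda>j. ennreal (4 * G2 - \<epsilon> / 4) < ennreal (S j)) sequentially" by (rule less_LiminfD)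
      then show ?thesis by eventually_elim (use False in \<open>simp add: ennreal_less_iff\<close>)
    qed
    have evV: "eventually (\<lambda>j. V j < G2 + \<epsilon> / 4) sequentially" by (rule order_tendstoD(2)[OF V]) (use \<epsilon> in simp)
    from evS evV show "\<forall>\<^sub>F j in sequentially. dist (D j) 0 < \<epsilon>"
    proof eventually_elim
      case (elim j)
      have "D j \<ge> 0" unfolding D_def by (rule suminf_nonneg[OF sd]) simp
      moreover have "D j < \<epsilon>" using par[of j] elim \<epsilon> by linarith
      ultimately show ?case by simp
    qed
  qed
  then have "(\<lambda>j. \<Sum>n. (cmod (evolved_coef (X (j + N0)) g n - U_seq \<alpha> \<beta> (X (j + N0)) g n))\<^sup>2) \<longlonglongrightarrow> 0"
    unfolding D_def T_def .
  then show "(\<lambda>j. \<Sum>n. (cmod (evolved_coef (X j) g n - U_seq \<alpha> \<beta> (X j) g n))\<^sup>2) \<longlonglongrightarrow> 0"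
    by (rule LIMSEQ_offset)
qed

end

section \<open>Reflection and conjugation\<close>

text \<open>A class stable under conjugation and reflection. The gap around 0 allows a cut there
  into a positive and a negative part without losing the derivative.\<close>

definition C1_packet :: "(real \<Rightarrow> complex) \<Rightarrow> bool" where
  "C1_packet g \<longleftrightarrow> (\<exists>g' K. (\<forall>x. (g has_vector_derivative g' x) (at x)) \<and> continuous_on UNIV g' \<and>
     compact K \<and> K \<subseteq> {-1<..<1} - {0} \<and> (\<forall>x. x \<notin> K \<longrightarrow> g x = 0))"

lemma smooth_C1_packet:
  assumes "smooth_compact_support ({-1<..<1} - {0}) g"
  shows "C1_packet g"
proof -
  define g' where "g' y = vector_derivative g (at y)" for y
  have "((\<lambda>u y. vector_derivative u (at y)) ^^ 0) g differentiable (at x)"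
    "((\<lambda>u y. vector_derivative u (at y)) ^^ 1) g differentiable (at x)" for x
    using assms unfolding smooth_compact_support_def by blast+
  then have d: "g differentiable (at x)" "g' differentiable (at x)" for x
    by (simp_all add: g'_def[abs_def])
  have "continuous_on UNIV g'" using d(2) by (simp add: continuous_on_eq_continuous_at differentiable_imp_continuous_within)
  moreover have "(g has_vector_derivative g' x) (at x)" for x
    using d(1) unfolding g'_def by (simp add: vector_derivative_works)
  moreover have "g x = 0" if "x \<notin> closure {x. g x \<noteq> 0}" for x
    using that closure_subset by force
  ultimately show ?thesis
    using assms unfolding C1_packet_def smooth_compact_support_def by blast
qed

lemma C1_packet_bdd_supp: "C1_packet g \<Longrightarrow> bdd_supp g"
proof -
  assume "C1_packet g"
  then obtain g' K where g: "\<And>x. (g has_vector_derivative g' x) (at x)" "compact K" "K \<subseteq> {-1<..<1} - {0}" "\<And>x. x \<notin> K \<Longrightarrow> g x = 0"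
    unfolding C1_packet_def by blast
  have c: "continuous_on S g" for S
    using g(1) by (meson continuous_at_imp_continuous_on has_vector_derivative_continuous)
  show ?thesis
  proof (cases "K = {}")
    case True
    then have "g = (\<lambda>x. 0)" using g(4) by auto
    then show ?thesis unfolding bdd_supp_def by (intro conjI exI[of _ 0] exI[of _ 0] exI[of _ 0]) auto
  next
    case False
    obtain l where l: "l \<in> K" "\<And>x. x \<in> K \<Longrightarrow> l \<le> x" using compact_attains_inf[OF g(2) False] by blast
    obtain r where r: "r \<in> K" "\<And>x. x \<in> K \<Longrightarrow> x \<le> r" using compact_attains_sup[OF g(2) False] by blast
    have "bounded (g ` K)" by (intro compact_imp_bounded compact_continuous_image c g)
    then obtain M where M: "\<And>x. x \<in> K \<Longrightarrow> cmod (g x) \<le> M" unfolding bounded_iff by blast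
    have "M \<ge> 0" using order_trans[OF norm_ge_zero M[OF l(1)]] .
    then have "cmod (g x) \<le> M" for x using M[of x] g(4)[of x] by (cases "x \<in> K") auto
    moreover have "g x = 0" if "x \<notin> {l..r}" for x
    proof (rule g(4))
      show "x \<notin> K" using that l(2) r(2) by (meson atLeastAtMost_iff)
    qed
    moreover have "-1 < l" "l \<le> r" "r < 1" using l r g(3) by auto
    ultimately show ?thesis unfolding bdd_supp_def
      using c by (intro conjI borel_measurable_continuous_onI exI[of _ M] exI[of _ l] exI[of _ r]) auto
  qed
qed

lemma C1_packet_cnj: "C1_packet g \<Longrightarrow> C1_packet (\<lambda>x. cnj (g x))"
proof -
  assume "C1_packet g"
  then obtain g' K where g: "\<And>x. (g has_vector_derivative g' x) (at x)" "continuous_on UNIV g'" "compact K" "K \<subseteq> {-1<..<1} - {0}" "\<And>x. x \<notin> K \<Longrightarrow> g x = 0"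
    unfolding C1_packet_def by blast
  then show ?thesis unfolding C1_packet_def
    by (intro exI[of _ "\<lambda>x. cnj (g' x)"] exI[of _ K]) (auto intro!: has_vector_derivative_cnj continuous_intros)
qed

lemma C1_packet_reflect: "C1_packet g \<Longrightarrow> C1_packet (\<lambda>x. g (- x))"
proof -
  assume "C1_packet g"
  then obtain g' K where g: "\<And>x. (g has_vector_derivative g' x) (at x)" "continuous_on UNIV g'" "compact K" "K \<subseteq> {-1<..<1} - {0}" "\<And>x. x \<notin> K \<Longrightarrow> g x = 0"
    unfolding C1_packet_def by blast
  have "((\<lambda>x. g (- x)) has_vector_derivative - g' (- x)) (at x)" for x
    using vector_diff_chain_at[of uminus "-1" x g "g' (- x)"] g(1)[of "- x"]
    by (simp add: o_def has_vector_derivative_minus has_vector_derivative_id)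
  moreover have "continuous_on UNIV (\<lambda>x. - g' (- x))"
    by (intro continuous_intros continuous_on_compose2[OF g(2)]) auto
  moreover have "compact (uminus ` K)" using g(3) by (intro compact_continuous_image continuous_intros)
  moreover have "uminus ` K \<subseteq> {-1<..<1} - {0}" using g(4) by auto
  moreover have "g (- x) = 0" if "x \<notin> uminus ` K" for x using that g(5)[of "- x"] by (metis image_eqI minus_minus)
  ultimately show ?thesis unfolding C1_packet_def
    by (intro exI[of _ "\<lambda>x. - g' (- x)"] exI[of _ "uminus ` K"]) auto
qed

definition pos_part :: "(real \<Rightarrow> complex) \<Rightarrow> real \<Rightarrow> complex" where
  "pos_part g x = (if x > 0 then g x else 0)"

text \<open>The compact set K misses 0, so its nonnegative part has a positive lower bound l, and g
  vanishes on (0, l). Cutting at 0 therefore creates no jump in g or in its derivative.\<close>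

lemma C1_packet_pos_part:
  assumes "C1_packet g"
  shows "\<exists>g' l r. (\<forall>x. (pos_part g has_vector_derivative g' x) (at x)) \<and> continuous_on UNIV g' \<and>
     0 < l \<and> l \<le> r \<and> r < 1 \<and> (\<forall>x. x \<notin> {l..r} \<longrightarrow> pos_part g x = 0)"
proof -
  obtain g' K where g: "\<And>x. (g has_vector_derivative g' x) (at x)" "continuous_on UNIV g'" "compact K" "K \<subseteq> {-1<..<1} - {0}" "\<And>x. x \<notin> K \<Longrightarrow> g x = 0"
    using assms unfolding C1_packet_def by blast
  have "compact (K \<inter> {0..})" using g(3) by (simp add: compact_Int_closed)
  have "\<exists>l r. 0 < l \<and> l \<le> r \<and> r < 1 \<and> K \<inter> {0..} \<subseteq> {l..r}"
  proof (cases "K \<inter> {0..} = {}")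
    case True
    then show ?thesis by (intro exI[of _ "1/2"]) auto
  next
    case False
    obtain l where l: "l \<in> K \<inter> {0..}" "\<And>x. x \<in> K \<inter> {0..} \<Longrightarrow> l \<le> x" using compact_attains_inf[OF \<open>compact (K \<inter> {0..})\<close> False] by blast
    obtain r where r: "r \<in> K \<inter> {0..}" "\<And>x. x \<in> K \<inter> {0..} \<Longrightarrow> x \<le> r" using compact_attains_sup[OF \<open>compact (K \<inter> {0..})\<close> False] by blast
    have "l \<noteq> 0" using l(1) g(4) by auto
    then have "0 < l" using l(1) by auto
    then show ?thesis using l r g(4) by (intro exI[of _ l] exI[of _ r]) auto
  qed
  then obtain l r where lr: "0 < l" "l \<le> r" "r < 1" "K \<inter> {0..} \<subseteq> {l..r}" by blast
  have z: "g x = 0" if "0 < x" "x \<notin> {l..r}" for x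
    using that lr(4) g(5)[of x] by force
  define p' where "p' x = (if x > 0 then g' x else 0)" for x
  \<comment> \<open>This makes the two continuous pieces of p' agree on the overlap (0, l).\<close>
  have g'0: "g' x = 0" if "0 < x" "x < l" for x
  proof -
    have "((\<lambda>x. 0) has_vector_derivative g' x) (at x)"
      by (rule has_vector_derivative_transform_within_open[OF g(1) open_greaterThanLessThan[of 0 l]]) (use that z in auto)
    then show ?thesis by (rule vector_derivative_unique_at) (rule has_vector_derivative_const)
  qed
  have "(pos_part g has_vector_derivative p' x) (at x)" for x
  proof (cases "x > 0")
    case True
    then have "(pos_part g has_vector_derivative g' x) (at x)"
      by (intro has_vector_derivative_transform_within_open[OF g(1) open_greaterThan[of 0]]) (auto simp: pos_part_def)
    then show ?thesis using True by (simp add: p'_def)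
  next
    case False
    have "(pos_part g has_vector_derivative 0) (at x)"
      by (rule has_vector_derivative_transform_within_open[OF has_vector_derivative_const[of 0] open_lessThan[of l]])
         (use False lr z in \<open>auto simp: pos_part_def\<close>)
    then show ?thesis using False by (simp add: p'_def)
  qed
  moreover have "continuous_on UNIV p'"
  proof -
    have "continuous_on {0<..} p'"
      by (rule continuous_on_eq[OF continuous_on_subset[OF g(2)]]) (auto simp: p'_def)
    moreover have "continuous_on {..<l} p'"
      by (rule continuous_on_eq[OF continuous_on_const[of _ 0]]) (auto simp: p'_def g'0)
    ultimately have "continuous_on ({0<..} \<union> {..<l}) p'" by (intro continuous_on_open_Un) auto
    moreover have "{0<..} \<union> {..<l} = UNIV" using lr by force
    ultimately show ?thesis by simp
  qed
  moreover have "pos_part g x = 0" if "x \<notin> {l..r}" for x using z that by (simp add: pos_part_def)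
  ultimately show ?thesis using lr by blast
qed

section \<open>Symmetries of the asymptotic formula\<close>

lemma powi_i: "\<i> powi (int n) = cis (real n * pi / 2)"
proof -
  have "cis (pi / 2) ^ n = cis (real n * (pi / 2))" by (rule Complex.DeMoivre)
  then show ?thesis by simp
qed

lemma h_amp_cnj: "cnj (h_amp \<sigma> s \<gamma> (\<lambda>x. cnj (g x)) \<xi>) = h_amp (- \<sigma>) s \<gamma> g \<xi>"
  by (simp add: h_amp_def cis_cnj)

text \<open>Conjugation reverses the phases and reflection reverses the argument of g; both are
  governed by s, so together they only exchange the two amplitudes.\<close>

lemma h_amp_reflect: "cnj (h_amp \<sigma> s \<gamma> (\<lambda>x. cnj (g (- x))) \<xi>) = h_amp \<sigma> (- s) \<gamma> g \<xi>"
  by (simp add: h_amp_def cis_cnj)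

lemma U_seq_add: "U_seq \<alpha> \<beta> t (\<lambda>x. g x + h x) n = U_seq \<alpha> \<beta> t g n + U_seq \<alpha> \<beta> t h n"
proof -
  have "h_amp \<sigma> s \<gamma> (\<lambda>x. g x + h x) \<xi> = h_amp \<sigma> s \<gamma> g \<xi> + h_amp \<sigma> s \<gamma> h \<xi>" for \<sigma> s \<gamma> \<xi>
    by (simp add: h_amp_def distrib_left)
  then show ?thesis unfolding U_seq_def Let_def by (simp only: if_distrib ring_distribs split: if_split) (simp add: algebra_simps)
qed

text \<open>For negative times every phase of the prefactors and of h is conjugated, while the
  arguments of g are unchanged; conjugating g beforehand compensates on the values of g.\<close>

lemma U_seq_conj:
  assumes "t > 0"
  shows "U_seq \<alpha> \<beta> (- t) g n = cnj (U_seq \<alpha> \<beta> t (\<lambda>x. cnj (g x)) n)"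
proof (cases "0 < n \<and> real n < t")
  case True
  let ?x = "real n / t" and ?\<gamma> = "(\<alpha> + \<beta> + 1) / 2"
  have "U_seq \<alpha> \<beta> (- t) g n = cis (real n * pi / 2) * cis ((\<beta> - \<alpha>) * pi / 4) * of_real (t powr (-1/2)) *
     (cis (- (psi ?x * t)) * h_amp (- 1) 1 ?\<gamma> g ?x + cis (psi ?x * t) * h_amp (- 1) (- 1) ?\<gamma> g ?x)"
    unfolding U_seq_def Let_def powi_i[symmetric] using True assms by simp
  moreover have "U_seq \<alpha> \<beta> t (\<lambda>x. cnj (g x)) n = cis (- (real n * pi / 2)) * cis ((\<alpha> - \<beta>) * pi / 4) * of_real (t powr (-1/2)) *
     (cis (psi ?x * t) * h_amp 1 1 ?\<gamma> (\<lambda>x. cnj (g x)) ?x + cis (- (psi ?x * t)) * h_amp 1 (- 1) ?\<gamma> (\<lambda>x. cnj (g x)) ?x)"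
    unfolding U_seq_def Let_def powi_minus_i[symmetric] using True assms by simp
  moreover have "- ((\<alpha> - \<beta>) * pi / 4) = (\<beta> - \<alpha>) * pi / 4" by (simp add: field_simps)
  ultimately show ?thesis by (simp only: complex_cnj_mult complex_cnj_add h_amp_cnj cis_cnj complex_cnj_complex_of_real minus_minus)
next
  case False
  then show ?thesis using assms by (auto simp: U_seq_def)
qed

text \<open>Conjugation turns i^(-n) into i^n = (-1)^n i^(-n), which explains the sign. It also
  reverses \<alpha> - \<beta>, which is undone by exchanging the parameters, and reverses psi, which
  is undone because the two amplitudes trade places.\<close>

lemma U_seq_reflect:
  assumes "t > 0"
  shows "U_seq \<alpha> \<beta> t g n = (-1) ^ n * cnj (U_seq \<beta> \<alpha> t (\<lambda>x. cnj (g (- x))) n)"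
proof (cases "0 < n \<and> real n < t")
  case True
  let ?x = "real n / t" and ?\<gamma> = "(\<alpha> + \<beta> + 1) / 2"
  have "U_seq \<alpha> \<beta> t g n = cis (- (real n * pi / 2)) * cis ((\<alpha> - \<beta>) * pi / 4) * of_real (t powr (-1/2)) *
     (cis (psi ?x * t) * h_amp 1 1 ?\<gamma> g ?x + cis (- (psi ?x * t)) * h_amp 1 (- 1) ?\<gamma> g ?x)"
    unfolding U_seq_def Let_def powi_minus_i[symmetric] using True assms by simp
  moreover have "U_seq \<beta> \<alpha> t (\<lambda>x. cnj (g (- x))) n = cis (- (real n * pi / 2)) * cis ((\<beta> - \<alpha>) * pi / 4) * of_real (t powr (-1/2)) *
     (cis (psi ?x * t) * h_amp 1 1 ?\<gamma> (\<lambda>x. cnj (g (- x))) ?x + cis (- (psi ?x * t)) * h_amp 1 (- 1) ?\<gamma> (\<lambda>x. cnj (g (- x))) ?x)"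
    unfolding U_seq_def Let_def powi_minus_i[symmetric] add.commute[of \<beta> \<alpha>] using True assms by simp
  moreover have "(-1) ^ n * cis (real n * pi / 2) = cis (- (real n * pi / 2))"
  proof -
    have "(-1) ^ n = cis (- (real n * pi))" by (simp add: complex_eq_iff)
    then show ?thesis by (simp add: cis_mult mult.commute)
  qed
  moreover have "- ((\<beta> - \<alpha>) * pi / 4) = (\<alpha> - \<beta>) * pi / 4" by (simp add: field_simps)
  ultimately show ?thesis
    by (simp only: complex_cnj_mult complex_cnj_add h_amp_reflect cis_cnj complex_cnj_complex_of_real minus_minus mult.assoc[symmetric])
       (simp only: add.commute)
next
  case False
  then show ?thesis using assms by (auto simp: U_seq_def)
qed

section \<open>Symmetries of the polynomials and of the evolution\<close>

lemma jacobi_moment_reflect: "jacobi_moment \<beta> \<alpha> (pcompose p [:0, -1:]) = jacobi_moment \<alpha> \<beta> p"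
proof -
  have "jacobi_moment \<alpha> \<beta> p = (LINT x|lborel. indicator {-1<..<1} x *\<^sub>R (poly p x * jacobi_weight 1 \<alpha> \<beta> x))"
    by (simp add: jacobi_moment_def set_lebesgue_integral_def)
  also have "\<dots> = \<bar>-1\<bar> *\<^sub>R (LINT x|lborel. indicator {-1<..<1} (0 + (-1) * x) *\<^sub>R (poly p (0 + (-1) * x) * jacobi_weight 1 \<alpha> \<beta> (0 + (-1) * x)))"
    by (rule lborel_integral_real_affine) simp
  also have "\<dots> = jacobi_moment \<beta> \<alpha> (pcompose p [:0, -1:])"
    unfolding jacobi_moment_def set_lebesgue_integral_def
    by (simp, intro Bochner_Integration.integral_cong) (auto simp: poly_pcompose jacobi_weight_def indicator_def)
  finally show ?thesis by simp
qed

context jacobi_polys begin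

text \<open>The sign restores the positive leading coefficient; this is the classical parity
  relation between the Jacobi polynomials for (\<alpha>, \<beta>) and (\<beta>, \<alpha>).\<close>

definition G_reflected :: "nat \<Rightarrow> real poly" where "G_reflected n = smult ((-1) ^ n) (pcompose (G n) [:0, -1:])"

lemma reflected: "jacobi_polys k \<beta> \<alpha> G_reflected"
proof
  show "ortho_jacobi k \<beta> \<alpha> G_reflected"
    unfolding ortho_jacobi_def
  proof (intro conjI allI)
    fix n
    have d: "degree (pcompose (G n) [:0, -1:]) = n" by (simp add: degree_pcompose deg)
    then show "degree (G_reflected n) = n" by (simp add: G_reflected_def)
    have "lead_coeff (pcompose (G n) [:0, -1:]) = lead_coeff (G n) * (-1) ^ n"
      by (subst lead_coeff_comp) (auto simp: deg)
    then have "lead_coeff (G_reflected n) = ((-1) ^ n * (-1) ^ n) * lead_coeff (G n)"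
      unfolding G_reflected_def lead_coeff_smult by (simp only: mult_ac)
    also have "(-1) ^ n * (-1) ^ n = (1 :: real)" by (simp add: power_mult_distrib[symmetric])
    finally show "lead_coeff (G_reflected n) > 0" using lc(1)[of n] by simp
  next
    fix m n
    have "G_reflected m * G_reflected n = smult ((-1) ^ m * (-1) ^ n) (pcompose (G m * G n) [:0, -1:])"
      by (simp add: G_reflected_def pcompose_mult mult_ac)
    then have "k * jacobi_moment \<beta> \<alpha> (G_reflected m * G_reflected n) = (-1) ^ m * (-1) ^ n * (k * jacobi_moment \<alpha> \<beta> (G m * G n))"
      using ab by (simp add: jacobi_moment_smult jacobi_moment_reflect)
    then show "k * jacobi_moment \<beta> \<alpha> (G_reflected m * G_reflected n) = (if m = n then 1 else 0)"
      unfolding orth by (simp add: power_mult_distrib[symmetric])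
  qed
qed (use ab k in auto)

lemma evolved_coef_cnj: "evolved_coef (- t) g n = cnj (evolved_coef t (\<lambda>x. cnj (g x)) n)"
proof -
  have "cnj (evolved_coef t (\<lambda>x. cnj (g x)) n) = (LINT x|lborel. cnj (cis (- (t * x)) * cnj (g x) * of_real (phi n x)))"
    unfolding evolved_coef_def coef_def by (rule Bochner_Integration.integral_cnj[symmetric])
  then show ?thesis unfolding evolved_coef_def coef_def by (simp add: cis_cnj)
qed

lemma evolved_coef_add:
  assumes "bdd_supp g" "bdd_supp h"
  shows "evolved_coef t (\<lambda>x. g x + h x) n = evolved_coef t g n + evolved_coef t h n"
proof -
  have "bdd_supp (\<lambda>x. cis (- (t * x)) * g x)" "bdd_supp (\<lambda>x. cis (- (t * x)) * h x)"
    by (intro bdd_supp_mult assms continuous_intros)+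
  from coef_add[OF this] show ?thesis by (simp add: evolved_coef_def distrib_left)
qed

text \<open>The reflection \<lambda> \<mapsto> -\<lambda> changes exp(-i \<lambda> t) into exp(i
  \<lambda> t), so it reverses time besides exchanging the parameters.\<close>

lemma evolved_coef_reflect:
  "evolved_coef t g n = (-1) ^ n * jacobi_polys.evolved_coef k \<beta> \<alpha> G_reflected (- t) (\<lambda>x. g (- x)) n"
proof -
  interpret R: jacobi_polys k \<beta> \<alpha> G_reflected by (rule reflected)
  have ph: "R.phi n (- x) = (-1) ^ n * phi n x" for x
  proof -
    have "indicator {-1<..<1} (- x) = (indicator {-1<..<1} x :: real)" by (auto simp: indicator_def)
    then show ?thesis by (simp add: R.phi_def phi_def G_reflected_def poly_pcompose jacobi_weight_def mult_ac)
  qed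
  have "evolved_coef t g n = (LINT x|lborel. cis (- (t * x)) * g x * of_real (phi n x))"
    by (simp add: evolved_coef_def coef_def)
  also have "\<dots> = \<bar>-1\<bar> *\<^sub>R (LINT x|lborel. cis (- (t * (0 + (-1) * x))) * g (0 + (-1) * x) * of_real (phi n (0 + (-1) * x)))"
    by (rule lborel_integral_real_affine) simp
  also have "\<dots> = (LINT x|lborel. (-1) ^ n * (cis (- (- t * x)) * g (- x) * of_real (R.phi n x)))"
  proof -
    have "phi n (- x) = (-1) ^ n * R.phi n x" for x
      using ph[of "- x"] by (simp add: mult.assoc[symmetric] power_mult_distrib[symmetric])
    then show ?thesis by (simp add: mult_ac)
  qed
  also have "\<dots> = (-1) ^ n * R.evolved_coef (- t) (\<lambda>x. g (- x)) n"
    unfolding R.evolved_coef_def R.coef_def by (rule integral_mult_right_zero)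
  finally show ?thesis .
qed

lemma pos_part_evolution:
  assumes "C1_packet g"
  shows "((\<lambda>t. \<Sum>n. (cmod (evolved_coef t (pos_part g) n - U_seq \<alpha> \<beta> t (pos_part g) n))\<^sup>2) \<longlongrightarrow> 0) at_top"
proof -
  obtain g' l r where "\<forall>x. (pos_part g has_vector_derivative g' x) (at x)" "continuous_on UNIV g'"
     "0 < l" "l \<le> r" "r < 1" "\<forall>x. x \<notin> {l..r} \<longrightarrow> pos_part g x = 0"
    using C1_packet_pos_part[OF assms] by blast
  then interpret P: jacobi_packet k \<alpha> \<beta> G "pos_part g" g' l r
    by unfold_locales auto
  show ?thesis by (rule P.half_evolution_limit)
qed

definition neg_part :: "(real \<Rightarrow> complex) \<Rightarrow> real \<Rightarrow> complex" where
  "neg_part g x = (if x < 0 then g x else 0)"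

end

lemma (in jacobi_polys) neg_part_evolution:
  assumes "C1_packet g"
  shows "((\<lambda>t. \<Sum>n. (cmod (evolved_coef t (neg_part g) n - U_seq \<alpha> \<beta> t (neg_part g) n))\<^sup>2) \<longlongrightarrow> 0) at_top"
proof -
  interpret R: jacobi_polys k \<beta> \<alpha> G_reflected by (rule reflected)
  \<comment> \<open>Reflection moves the negative part to the positive axis but reverses time;
    conjugation turns time back, so the positive case applies to p at t itself.\<close>
  define p where "p = (\<lambda>x. cnj (g (- x)))"
  have "C1_packet p" unfolding p_def by (intro C1_packet_cnj C1_packet_reflect assms)
  note lim = R.pos_part_evolution[OF this]
  have pn: "(\<lambda>x. cnj (neg_part g (- x))) = pos_part p" by (auto simp: neg_part_def pos_part_def p_def)
  show ?thesis
  proof (rule Lim_transform_eventually[OF lim])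
    show "\<forall>\<^sub>F t in at_top. (\<Sum>n. (cmod (R.evolved_coef t (pos_part p) n - U_seq \<beta> \<alpha> t (pos_part p) n))\<^sup>2) =
       (\<Sum>n. (cmod (evolved_coef t (neg_part g) n - U_seq \<alpha> \<beta> t (neg_part g) n))\<^sup>2)"
      using eventually_gt_at_top[of 0]
    proof eventually_elim
      case (elim t)
      show ?case
      proof (rule suminf_cong)
        fix n
        have "evolved_coef t (neg_part g) n = (-1) ^ n * cnj (R.evolved_coef t (pos_part p) n)"
          unfolding evolved_coef_reflect[of t] R.evolved_coef_cnj[of t] pn ..
        moreover have "U_seq \<alpha> \<beta> t (neg_part g) n = (-1) ^ n * cnj (U_seq \<beta> \<alpha> t (pos_part p) n)"
          unfolding U_seq_reflect[OF elim, of \<alpha> \<beta> "neg_part g"] pn ..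
        ultimately have "evolved_coef t (neg_part g) n - U_seq \<alpha> \<beta> t (neg_part g) n = (-1) ^ n * cnj (R.evolved_coef t (pos_part p) n - U_seq \<beta> \<alpha> t (pos_part p) n)"
          by (simp add: algebra_simps)
        then show "(cmod (R.evolved_coef t (pos_part p) n - U_seq \<beta> \<alpha> t (pos_part p) n))\<^sup>2 = (cmod (evolved_coef t (neg_part g) n - U_seq \<alpha> \<beta> t (neg_part g) n))\<^sup>2"
          by (simp add: norm_mult norm_power del: complex_cnj_diff)
      qed
    qed
  qed
qed

section \<open>Both halves together and the two directions of time\<close>

context jacobi_polys begin

lemma evolved_coef_U_summable:
  assumes "bdd_supp g"
  shows "summable (\<lambda>n. (cmod (evolved_coef t g n - U_seq \<alpha> \<beta> t g n))\<^sup>2)"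
proof -
  have "bdd_supp (\<lambda>x. cis (- (t * x)) * g x)" by (intro bdd_supp_mult assms continuous_intros)
  then have "square_summable (evolved_coef t g)" unfolding evolved_coef_def by (rule bessel)
  moreover have "square_summable (\<lambda>n. - U_seq \<alpha> \<beta> t g n)"
    using U_approx.rep_eq[of \<alpha> \<beta> t g] ell2_nth[of "U_approx \<alpha> \<beta> t g"] by (simp add: square_summable_def)
  ultimately have "square_summable (\<lambda>n. evolved_coef t g n + - U_seq \<alpha> \<beta> t g n)" by (rule square_summable_add)
  then show ?thesis by (simp add: square_summable_def)
qed

lemma evolution_at_top:
  assumes g: "C1_packet g"
  shows "((\<lambda>t. \<Sum>n. (cmod (evolved_coef t g n - U_seq \<alpha> \<beta> t g n))\<^sup>2) \<longlongrightarrow> 0) at_top"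
proof -
  have bg: "bdd_supp g" by (rule C1_packet_bdd_supp[OF g])
  \<comment> \<open>The parts cover every point except 0, where g vanishes because its support
    avoids 0.\<close>
  have split: "g = (\<lambda>x. pos_part g x + neg_part g x)"
  proof
    fix x
    have "g 0 = 0" using g unfolding C1_packet_def by blast
    then show "g x = pos_part g x + neg_part g x" by (auto simp: pos_part_def neg_part_def not_less le_less)
  qed
  have parts: "bdd_supp (pos_part g)" "bdd_supp (neg_part g)"
  proof -
    obtain M l r where b: "g \<in> borel_measurable borel" "-1 < l" "l \<le> r" "r < 1" "\<And>x. cmod (g x) \<le> M" "\<And>x. x \<notin> {l..r} \<Longrightarrow> g x = 0"
      using bg unfolding bdd_supp_def by blast
    have "0 \<le> M" using order_trans[OF norm_ge_zero b(5)] .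
    note b(1)[measurable]
    have "pos_part g \<in> borel_measurable borel" "neg_part g \<in> borel_measurable borel"
      unfolding pos_part_def[abs_def] neg_part_def[abs_def] by measurable
    moreover have "\<forall>x. cmod (pos_part g x) \<le> M" "\<forall>x. cmod (neg_part g x) \<le> M"
      using b(5) \<open>0 \<le> M\<close> by (simp_all add: pos_part_def neg_part_def)
    moreover have "\<forall>x. x \<notin> {l..r} \<longrightarrow> pos_part g x = 0" "\<forall>x. x \<notin> {l..r} \<longrightarrow> neg_part g x = 0"
      using b(6) by (simp_all add: pos_part_def neg_part_def)
    ultimately show "bdd_supp (pos_part g)" "bdd_supp (neg_part g)"
      unfolding bdd_supp_def using b(2-4) by blast+
  qed
  let ?P = "\<lambda>t. \<Sum>n. (cmod (evolved_coef t (pos_part g) n - U_seq \<alpha> \<beta> t (pos_part g) n))\<^sup>2"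
  let ?N = "\<lambda>t. \<Sum>n. (cmod (evolved_coef t (neg_part g) n - U_seq \<alpha> \<beta> t (neg_part g) n))\<^sup>2"
  have le: "(\<Sum>n. (cmod (evolved_coef t g n - U_seq \<alpha> \<beta> t g n))\<^sup>2) \<le> 2 * ?P t + 2 * ?N t" for t
  proof -
    note sP = evolved_coef_U_summable[OF parts(1), of t] and sN = evolved_coef_U_summable[OF parts(2), of t]
    have "(\<Sum>n. (cmod (evolved_coef t g n - U_seq \<alpha> \<beta> t g n))\<^sup>2) \<le>
      (\<Sum>n. 2 * (cmod (evolved_coef t (pos_part g) n - U_seq \<alpha> \<beta> t (pos_part g) n))\<^sup>2 + 2 * (cmod (evolved_coef t (neg_part g) n - U_seq \<alpha> \<beta> t (neg_part g) n))\<^sup>2)"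
    proof (rule suminf_le)
      fix n
      have "evolved_coef t g n = evolved_coef t (pos_part g) n + evolved_coef t (neg_part g) n"
        using evolved_coef_add[OF parts, of t n] unfolding split[symmetric] .
      moreover have "U_seq \<alpha> \<beta> t g n = U_seq \<alpha> \<beta> t (pos_part g) n + U_seq \<alpha> \<beta> t (neg_part g) n"
        using U_seq_add[of \<alpha> \<beta> t "pos_part g" "neg_part g" n] unfolding split[symmetric] .
      ultimately have "evolved_coef t g n - U_seq \<alpha> \<beta> t g n = (evolved_coef t (pos_part g) n - U_seq \<alpha> \<beta> t (pos_part g) n) + (evolved_coef t (neg_part g) n - U_seq \<alpha> \<beta> t (neg_part g) n)"
        by (simp add: algebra_simps)
      moreover have "(cmod (x + y))\<^sup>2 \<le> 2 * (cmod x)\<^sup>2 + 2 * (cmod y)\<^sup>2" for x y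
      proof -
        have "(cmod (x + y))\<^sup>2 \<le> (cmod x + cmod y)\<^sup>2" by (intro power_mono norm_triangle_ineq) auto
        also have "\<dots> \<le> 2 * (cmod x)\<^sup>2 + 2 * (cmod y)\<^sup>2"
          using sum_squares_bound[of "cmod x" "cmod y"] by (simp add: power2_sum)
        finally show ?thesis .
      qed
      ultimately show "(cmod (evolved_coef t g n - U_seq \<alpha> \<beta> t g n))\<^sup>2 \<le> 2 * (cmod (evolved_coef t (pos_part g) n - U_seq \<alpha> \<beta> t (pos_part g) n))\<^sup>2 + 2 * (cmod (evolved_coef t (neg_part g) n - U_seq \<alpha> \<beta> t (neg_part g) n))\<^sup>2"
        by simp
    qed (intro evolved_coef_U_summable bg summable_add summable_mult sP sN)+
    also have "\<dots> = 2 * ?P t + 2 * ?N t"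
      using sP sN by (simp add: suminf_add[symmetric] suminf_mult summable_mult)
    finally show ?thesis .
  qed
  have "((\<lambda>t. 2 * ?P t + 2 * ?N t) \<longlongrightarrow> 2 * 0 + 2 * 0) at_top"
    by (intro tendsto_intros pos_part_evolution neg_part_evolution g)
  then have lim: "((\<lambda>t. 2 * ?P t + 2 * ?N t) \<longlongrightarrow> 0) at_top" by simp
  show ?thesis
  proof (rule Lim_null_comparison[OF _ lim])
    have "0 \<le> (\<Sum>n. (cmod (evolved_coef t g n - U_seq \<alpha> \<beta> t g n))\<^sup>2)" for t
      by (rule suminf_nonneg[OF evolved_coef_U_summable[OF bg]]) simp
    then show "\<forall>\<^sub>F t in at_top. norm (\<Sum>n. (cmod (evolved_coef t g n - U_seq \<alpha> \<beta> t g n))\<^sup>2) \<le> 2 * ?P t + 2 * ?N t"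
      using le by simp
  qed
qed

text \<open>The functions \<open>phi\<close> are real, so the error at time -t for g is the
  conjugate of the error at time t for the conjugate of g.\<close>

lemma evolution_at_bot:
  assumes g: "C1_packet g"
  shows "((\<lambda>t. \<Sum>n. (cmod (evolved_coef t g n - U_seq \<alpha> \<beta> t g n))\<^sup>2) \<longlongrightarrow> 0) at_bot"
  unfolding filterlim_at_bot_mirror
proof (rule Lim_transform_eventually[OF evolution_at_top[OF C1_packet_cnj[OF g]]])
  show "\<forall>\<^sub>F t in at_top. (\<Sum>n. (cmod (evolved_coef t (\<lambda>x. cnj (g x)) n - U_seq \<alpha> \<beta> t (\<lambda>x. cnj (g x)) n))\<^sup>2)
     = (\<Sum>n. (cmod (evolved_coef (- t) g n - U_seq \<alpha> \<beta> (- t) g n))\<^sup>2)"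
    using eventually_gt_at_top[of 0]
  proof eventually_elim
    case (elim t)
    have "evolved_coef (- t) g n - U_seq \<alpha> \<beta> (- t) g n = cnj (evolved_coef t (\<lambda>x. cnj (g x)) n - U_seq \<alpha> \<beta> t (\<lambda>x. cnj (g x)) n)" for n
      unfolding evolved_coef_cnj[of t] U_seq_conj[OF elim] by simp
    then show ?case by (simp del: complex_cnj_diff)
  qed
qed

end

theorem theorem4p9:
  fixes \<alpha> \<beta> k :: real
    and G :: "nat \<Rightarrow> real poly"
    and a b :: "nat \<Rightarrow> real"
    and f :: ell2
    and g :: "real \<Rightarrow> complex"
  assumes "\<alpha> > -1" and "\<beta> > -1"
    and "k > 0"
    and "(LINT x:{-1<..<1}|lborel. jacobi_weight k \<alpha> \<beta> x) = 1"
    and "orthonormal_polys (jacobi_weight k \<alpha> \<beta>) G"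
    and "recurrence_coeffs G a b"
    and "is_Phi (jacobi_weight k \<alpha> \<beta>) G f g"
    and "smooth_compact_support ({-1<..<1} - {0}) g"
  shows "((\<lambda>t. norm (unitary_group (jacobi_op a b) t f - U_approx \<alpha> \<beta> t g)) \<longlongrightarrow> 0) at_top \<and>
         ((\<lambda>t. norm (unitary_group (jacobi_op a b) t f - U_approx \<alpha> \<beta> t g)) \<longlongrightarrow> 0) at_bot"
proof -
  interpret jacobi_polys k \<alpha> \<beta> G
    using assms ortho_jacobi_iff by unfold_locales auto
  have g: "C1_packet g" by (rule smooth_C1_packet) fact
  have "norm (unitary_group (jacobi_op a b) t f - U_approx \<alpha> \<beta> t g) = sqrt (\<Sum>n. (cmod (evolved_coef t g n - U_seq \<alpha> \<beta> t g n))\<^sup>2)" for t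
    unfolding norm_ell2.rep_eq minus_ell2.rep_eq U_approx.rep_eq evolved_coef_def
      unitary_group_coef[OF C1_packet_bdd_supp[OF g] assms(7,6)] ..
  then show ?thesis
    using tendsto_real_sqrt[OF evolution_at_top[OF g]] tendsto_real_sqrt[OF evolution_at_bot[OF g]] by simp
qed

end
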